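(* Let $G$ be a doubly-connected graph of order $n\ge 4$ and let $\overline G$ be its complement. Then $2\le\beta(G)+\beta(\overline G)\le 2n-6$. Moreover: (i) $\beta(G)+\beta(\overline G)=2$ if and only if $G=P_4$; (ii) $\beta(G)+\beta(\overline G)=2n-6$ if and only if $G\in\Omega_1\cup\Omega_2\cup\Omega_3$, where $\Omega_1=\{P_4,C_5,B\}$, $\Omega_2=\{P_4[K_{n-3}^{(1)}],\ P_4[\overline K_{n-3}^{(1)}],\ P_4[K_{n-3}^{(2)}],\ P_4[\overline K_{n-3}^{(2)}]\}$, $\Omega_3=\{P_4[K_r^{(1)},K_{n-r-2}^{(2)}]:1\le r\le n-3\}\cup\{P_4[\overline K_r^{(1)},\overline K_{n-r-2}^{(3)}]:1\le r\le n-3\}$. (Equality and membership are up to isomorphism.)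
   Context: Graphs are finite, simple and undirected. A graph $G$ is doubly-connected if both $G$ and its complement $\overline G$ are connected. For a connected graph $G=(V,E)$ with distance $d$, a set $D=\{x_1,\dots,x_k\}\subseteq V$ is a locating set if the vectors $(d(v,x_1),\dots,d(v,x_k))$, $v\in V$, are pairwise distinct; the location number (metric dimension) $\beta(G)$ is the minimum cardinality of a locating set. $K_m$, $\overline K_m$, $C_m$, $P_m$ denote the complete graph, edgeless graph, cycle and path on $m$ vertices. The bull graph $B$ is the 5-vertex graph obtained from a triangle by attaching one pendant vertex to each of two distinct vertices of the triangle. The vertices of $P_4$ are labelled $1,2,3,4$ consecutively along the path (edges $12,23,34$). For a graph $\Gamma$ with vertices labelled by integers, $\Gamma[H^{(i)}]$ denotes the graph obtained from $\Gamma$ by replacing vertex $i$ by the graph $H$ and joining every vertex of $H$ to every neighbor of $i$ in $\Gamma$. Similarly, $\Gamma[H_1^{(i)},H_2^{(j)}]$ ($i\neq j$) is the graph obtained from $\Gamma$ by replacing vertex $i$ by $H_1$ and vertex $j$ by $H_2$, joining every vertex of $H_1$ (resp. $H_2$) to every remaining neighbor of $i$ (resp. $j$) in $\Gamma$, and, exactly when $ij$ is an edge of $\Gamma$, also joining every vertex of $H_1$ to every vertex of $H_2$. *)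

theory Defs
  imports "Graph_Theory.Graph_Theory" "HOL-Library.FuncSet"
begin

text \<open>
  Finite simple undirected graphs are modelled by the locale \<open>pair_graph\<close>: an edge \<open>uv\<close> is
  represented by the two arcs \<open>(u, v)\<close> and \<open>(v, u)\<close>, and isomorphism is \<open>digraph_iso\<close>.
\<close>

definition complement :: "'a pair_pre_digraph \<Rightarrow> 'a pair_pre_digraph" where
  "complement G = \<lparr> pverts = pverts G,
     parcs = {(u, v). u \<in> pverts G \<and> v \<in> pverts G \<and> u \<noteq> v \<and> (u, v) \<notin> parcs G} \<rparr>"

text \<open>Qualified because \<open>connected\<close> is also a topological notion.\<close>

definition doubly_connected :: "'a pair_pre_digraph \<Rightarrow> bool" where
  "doubly_connected G \<longleftrightarrow>
     Digraph_Component.connected (with_proj G) \<and>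
     Digraph_Component.connected (with_proj (complement G))"


section \<open>Location number\<close>

text \<open>The graph distance is the shortest-path distance with all arc weights equal to 1.\<close>

definition distance :: "'a pair_pre_digraph \<Rightarrow> 'a \<Rightarrow> 'a \<Rightarrow> ereal" where
  "distance G u v = wf_digraph.\<mu> (with_proj G) (\<lambda>_. 1) u v"

text \<open>The vector of distances from \<open>v\<close> to the elements of \<open>D\<close> is a function on \<open>D\<close>.\<close>

definition locating_set :: "'a pair_pre_digraph \<Rightarrow> 'a set \<Rightarrow> bool" where
  "locating_set G D \<longleftrightarrow>
     D \<subseteq> pverts G \<and> inj_on (\<lambda>v. \<lambda>x\<in>D. distance G v x) (pverts G)"

text \<open>The full vertex set of a finite graph is locating, so the minimum below is attained.\<close>

definition location_number :: "'a pair_pre_digraph \<Rightarrow> nat" where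
  "location_number G = (LEAST k. \<exists>D. locating_set G D \<and> card D = k)"


section \<open>Particular graphs\<close>

definition complete_graph :: "nat \<Rightarrow> nat pair_pre_digraph" where
  "complete_graph m = \<lparr> pverts = {0..<m}, parcs = {(i, j). i < m \<and> j < m \<and> i \<noteq> j} \<rparr>"

definition edgeless_graph :: "nat \<Rightarrow> nat pair_pre_digraph" where
  "edgeless_graph m = \<lparr> pverts = {0..<m}, parcs = {} \<rparr>"

definition path_graph :: "nat \<Rightarrow> nat pair_pre_digraph" where
  "path_graph m = \<lparr> pverts = {1..m},
     parcs = {(i, j). i \<in> {1..m} \<and> j \<in> {1..m} \<and> (j = i + 1 \<or> i = j + 1)} \<rparr>"

definition cycle_graph :: "nat \<Rightarrow> nat pair_pre_digraph" where
  "cycle_graph m = \<lparr> pverts = {0..<m},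
     parcs = {(i, j). i < m \<and> j < m \<and> (j = (i + 1) mod m \<or> i = (j + 1) mod m)} \<rparr>"

definition bull_graph :: "nat pair_pre_digraph" where
  "bull_graph = \<lparr> pverts = {0, 1, 2, 3, 4},
     parcs = symcl {(0, 1), (1, 2), (0, 2), (0, 3), (1, 4)} \<rparr>"


section \<open>Substituting graphs for vertices\<close>

text \<open>
  Every vertex \<open>i\<close> of \<open>\<Gamma>\<close> is replaced by the graph \<open>F i\<close>, whose copy has the vertices \<open>(i, h)\<close>
  with \<open>h\<close> a vertex of \<open>F i\<close>. A vertex that is to be kept is replaced by a one-vertex graph.
\<close>

definition substitute ::
    "'a pair_pre_digraph \<Rightarrow> ('a \<Rightarrow> 'b pair_pre_digraph) \<Rightarrow> ('a \<times> 'b) pair_pre_digraph" where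
  "substitute \<Gamma> F = \<lparr> pverts = (SIGMA i : pverts \<Gamma>. pverts (F i)),
     parcs = {((i, h), (j, h')).
       i \<in> pverts \<Gamma> \<and> h \<in> pverts (F i) \<and> j \<in> pverts \<Gamma> \<and> h' \<in> pverts (F j) \<and>
       ((i, j) \<in> parcs \<Gamma> \<or> i = j \<and> (h, h') \<in> parcs (F i))} \<rparr>"

definition substitute1 ::
    "'a pair_pre_digraph \<Rightarrow> 'a \<Rightarrow> nat pair_pre_digraph \<Rightarrow> ('a \<times> nat) pair_pre_digraph" where
  "substitute1 \<Gamma> i H = substitute \<Gamma> ((\<lambda>_. complete_graph 1)(i := H))"

text \<open>Only meaningful for \<open>i \<noteq> j\<close>.\<close>

definition substitute2 ::
    "'a pair_pre_digraph \<Rightarrow> 'a \<Rightarrow> nat pair_pre_digraph \<Rightarrow> 'a \<Rightarrow> nat pair_pre_digraph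
      \<Rightarrow> ('a \<times> nat) pair_pre_digraph" where
  "substitute2 \<Gamma> i H\<^sub>1 j H\<^sub>2 = substitute \<Gamma> ((\<lambda>_. complete_graph 1)(i := H\<^sub>1, j := H\<^sub>2))"


section \<open>The extremal families\<close>

definition Omega1 :: "nat pair_pre_digraph set" where
  "Omega1 = {path_graph 4, cycle_graph 5, bull_graph}"

definition Omega2 :: "nat \<Rightarrow> (nat \<times> nat) pair_pre_digraph set" where
  "Omega2 n =
     {substitute1 (path_graph 4) 1 (complete_graph (n - 3)),
      substitute1 (path_graph 4) 1 (edgeless_graph (n - 3)),
      substitute1 (path_graph 4) 2 (complete_graph (n - 3)),
      substitute1 (path_graph 4) 2 (edgeless_graph (n - 3))}"

definition Omega3 :: "nat \<Rightarrow> (nat \<times> nat) pair_pre_digraph set" where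
  "Omega3 n =
     {substitute2 (path_graph 4) 1 (complete_graph r) 2 (complete_graph (n - r - 2)) |r.
        1 \<le> r \<and> r \<le> n - 3} \<union>
     {substitute2 (path_graph 4) 1 (edgeless_graph r) 3 (edgeless_graph (n - r - 2)) |r.
        1 \<le> r \<and> r \<le> n - 3}"


section \<open>All graphs defined above are finite simple graphs\<close>

lemma pair_graphI:
  assumes "finite (pverts G)" "parcs G \<subseteq> pverts G \<times> pverts G" "sym (parcs G)" "irrefl (parcs G)"
  shows "pair_graph G"
proof
  show "finite (parcs G)"
    using assms(1,2) by (meson finite_SigmaI finite_subset)
  show "symmetric (with_proj G)"
    using assms(3) by (simp add: symmetric_def)
qed (use assms in \<open>auto simp: irrefl_def\<close>)

lemma pair_graph_complement: "pair_graph G \<Longrightarrow> pair_graph (complement G)"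
proof (rule pair_graphI)
  assume "pair_graph G"
  then interpret pair_graph G .
  show "finite (pverts (complement G))"
    using pair_finite_verts by (simp add: complement_def)
  show "sym (parcs (complement G))"
    using pair_sym_arcs by (auto simp: complement_def symmetric_def intro!: symI dest: symD)
qed (auto simp: complement_def irrefl_def)

lemma pair_graph_complete_graph: "pair_graph (complete_graph m)"
  by (rule pair_graphI) (auto simp: complete_graph_def sym_def irrefl_def)

lemma pair_graph_edgeless_graph: "pair_graph (edgeless_graph m)"
  by (rule pair_graphI) (auto simp: edgeless_graph_def sym_def irrefl_def)

lemma pair_graph_path_graph: "pair_graph (path_graph m)"
  by (rule pair_graphI) (auto simp: path_graph_def sym_def irrefl_def)

lemma pair_graph_cycle_graph: "m \<ge> 2 \<Longrightarrow> pair_graph (cycle_graph m)"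
  by (rule pair_graphI) (auto simp: cycle_graph_def irrefl_def mod_Suc intro!: symI split: if_splits)

lemma pair_graph_bull_graph: "pair_graph bull_graph"
  by (rule pair_graphI) (auto simp: bull_graph_def symcl_def irrefl_def intro!: symI)

lemma pair_graph_substitute:
  assumes "pair_graph \<Gamma>" "\<And>i. i \<in> pverts \<Gamma> \<Longrightarrow> pair_graph (F i)"
  shows "pair_graph (substitute \<Gamma> F)"
proof (rule pair_graphI)
  interpret pair_graph \<Gamma> by fact
  have fin: "finite (pverts (F i))" and sym: "sym (parcs (F i))"
    and irrefl: "(h, h) \<notin> parcs (F i)" if "i \<in> pverts \<Gamma>" for i h
  proof -
    interpret F: pair_graph "F i" using assms(2) that .
    show "finite (pverts (F i))" by (rule F.pair_finite_verts)
    show "sym (parcs (F i))" using F.pair_sym_arcs by (simp add: symmetric_def)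
    show "(h, h) \<notin> parcs (F i)" using F.pair_no_loops by force
  qed
  show "finite (pverts (substitute \<Gamma> F))"
    using pair_finite_verts fin by (simp add: substitute_def)
  have "sym (parcs \<Gamma>)"
    using pair_sym_arcs by (simp add: symmetric_def)
  then show "sym (parcs (substitute \<Gamma> F))"
    using sym by (fastforce simp: substitute_def intro!: symI dest: symD)
  have "(i, i) \<notin> parcs \<Gamma>" for i
    using pair_no_loops by force
  then show "irrefl (parcs (substitute \<Gamma> F))"
    using irrefl by (auto simp: substitute_def irrefl_def)
qed (auto simp: substitute_def)

end

theory Submission
  imports Defs
begin

text \<open>
  A set is free if its complement is locating, so the location number is at least \<open>n - 3\<close> iff no
  four vertices form a free set. A doubly-connected graph has an induced path \<open>abcd\<close>, and from it
  one reads off a free triple, which gives the upper bound for the graph and for its complement.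
  Equality means that neither the graph nor the complement has a free quadruple.

  If \<open>a\<close> and \<open>d\<close> are more than two steps apart, then vertices on different spheres around \<open>a\<close> are
  resolved by \<open>a\<close>, so two vertices of one sphere can only be resolved by a vertex that is alone on
  its sphere; hence the spheres consist of twins up to few exceptions. Looking from \<open>a\<close> and from
  \<open>d\<close> leaves the bull, a clique with a pendant path attached to a part of it, and the complement of
  such a graph. The last two are the blow-ups in \<open>\<Omega>\<^sub>2 \<union> \<Omega>\<^sub>3\<close>. If neither the graph nor its
  complement has such a pair \<open>a, d\<close>, the adjacencies among six vertices leave only the pentagon.
\<close>

section \<open>Distances in simple graphs\<close>

text \<open>One induced path \<open>a b c d\<close> serves the graph and its complement at once,
  since in the complement it becomes the path \<open>b d a c\<close>. What matters is whether
  \<open>a\<close> and \<open>d\<close> have a common neighbour, and whether \<open>b\<close> and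
  \<open>c\<close> have a common non-neighbour. If both exist, they and the path are the six
  vertices. There only adjacencies are compared, and complementing merely negates them. In the far
  case one graph alone is not rigid enough: the path on four vertices with both inner vertices
  replaced by cliques of size at least two has no free quadruple, although its complement has one.
  Hence many quadruples are exhibited in the complement, where two dominating vertices are at
  distance greater than two. The sum 2 means that a single vertex locates each graph. Such a vertex
  bounds all degrees of its graph by two, while in the complement it has degree at most one;
  together these force four vertices.\<close>

primrec dist_le :: "('a \<Rightarrow> 'a \<Rightarrow> bool) \<Rightarrow> nat \<Rightarrow> 'a \<Rightarrow> 'a \<Rightarrow> bool" where
  "dist_le E 0 u v \<longleftrightarrow> u = v"
| "dist_le E (Suc k) u v \<longleftrightarrow> dist_le E k u v \<or> (\<exists>w. E u w \<and> dist_le E k w v)"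

text \<open>Two vertices are equidistant from \<open>x\<close> exactly when they lie in the same
  balls around \<open>x\<close>. Comparing balls avoids numerical distances, and two vertices that
  cannot reach \<open>x\<close> count as equidistant.\<close>

definition resolves :: "('a \<Rightarrow> 'a \<Rightarrow> bool) \<Rightarrow> 'a \<Rightarrow> 'a \<Rightarrow> 'a \<Rightarrow> bool" where
  "resolves E x u v \<longleftrightarrow> (\<exists>k. dist_le E k u x \<noteq> dist_le E k v x)"

text \<open>The sets \<open>W\<close> for which \<open>V - W\<close> is locating.\<close>

definition free_set :: "'a set \<Rightarrow> ('a \<Rightarrow> 'a \<Rightarrow> bool) \<Rightarrow> 'a set \<Rightarrow> bool" where
  "free_set V E W \<longleftrightarrow>
     W \<subseteq> V \<and> (\<forall>u\<in>W. \<forall>v\<in>W. u \<noteq> v \<longrightarrow> (\<exists>x\<in>V - W. resolves E x u v))"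

text \<open>Since subsets of free sets are free, this says that the location number is at least \<open>n - 3\<close>.\<close>

definition tight :: "'a set \<Rightarrow> ('a \<Rightarrow> 'a \<Rightarrow> bool) \<Rightarrow> bool" where
  "tight V E \<longleftrightarrow> (\<forall>W. free_set V E W \<longrightarrow> card W \<noteq> 4)"

definition co :: "'a set \<Rightarrow> ('a \<Rightarrow> 'a \<Rightarrow> bool) \<Rightarrow> 'a \<Rightarrow> 'a \<Rightarrow> bool" where
  "co V E u v \<longleftrightarrow> u \<in> V \<and> v \<in> V \<and> u \<noteq> v \<and> \<not> E u v"

definition connected_on :: "'a set \<Rightarrow> ('a \<Rightarrow> 'a \<Rightarrow> bool) \<Rightarrow> bool" where
  "connected_on V E \<longleftrightarrow> (\<forall>u\<in>V. \<forall>v\<in>V. \<exists>k. dist_le E k u v)"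

lemma dist_le_refl [simp]: "dist_le E k u u"
  by (induction k) auto

lemma dist_le_mono: "dist_le E k u v \<Longrightarrow> k \<le> l \<Longrightarrow> dist_le E l u v"
  by (induction l) (auto simp: le_Suc_eq)

text \<open>The recursion peels off the first edge of a walk, whereas symmetry and the arguments
  about spheres need the last one.\<close>

lemma dist_le_Suc_back:
  "dist_le E (Suc k) u v \<longleftrightarrow> dist_le E k u v \<or> (\<exists>w. dist_le E k u w \<and> E w v)"
proof (induction k arbitrary: u)
  case (Suc k)
  have "(\<exists>w. E u w \<and> dist_le E (Suc k) w v)
      \<longleftrightarrow> (\<exists>w. E u w \<and> dist_le E k w v) \<or> (\<exists>w x. E u w \<and> dist_le E k w x \<and> E x v)"
    unfolding Suc.IH by blast
  moreover have "(\<exists>x. dist_le E (Suc k) u x \<and> E x v)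
      \<longleftrightarrow> (\<exists>x. dist_le E k u x \<and> E x v) \<or> (\<exists>w x. E u w \<and> dist_le E k w x \<and> E x v)"
    by auto
  moreover have "dist_le E (Suc (Suc k)) u v
      \<longleftrightarrow> dist_le E (Suc k) u v \<or> (\<exists>w. E u w \<and> dist_le E (Suc k) w v)"
    by (rule dist_le.simps)
  moreover have "(\<exists>w. E u w \<and> dist_le E k w v) \<Longrightarrow> dist_le E (Suc k) u v" by simp
  moreover have "(\<exists>x. dist_le E k u x \<and> E x v) \<Longrightarrow> dist_le E (Suc k) u v" using Suc.IH by blast
  ultimately show ?case by argo
qed auto

lemma resolves_sym: "resolves E x u v \<Longrightarrow> resolves E x v u"
  by (auto simp: resolves_def)

lemma resolves_self: "u \<noteq> v \<Longrightarrow> resolves E u u v"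
  unfolding resolves_def by (rule exI[of _ 0]) auto

lemma resolves_adjI: "E u x \<noteq> E v x \<Longrightarrow> x \<noteq> u \<Longrightarrow> x \<noteq> v \<Longrightarrow> resolves E x u v"
  unfolding resolves_def by (rule exI[of _ "Suc 0"]) auto

text \<open>The ball of radius two around \<open>x\<close> contains \<open>u\<close> but not
  \<open>v\<close>. This serves for resolvers adjacent to neither vertex, mostly in
  complements.\<close>

lemma resolves_2I:
  assumes "E u x \<or> (\<exists>w. E u w \<and> E w x)" "v \<noteq> x" "\<not> E v x" "\<not> (\<exists>w. E v w \<and> E w x)"
  shows "resolves E x u v"
  unfolding resolves_def by (rule exI[of _ "Suc (Suc 0)"]) (use assms in auto)

lemma free_set_subset: "free_set V E W \<Longrightarrow> W' \<subseteq> W \<Longrightarrow> free_set V E W'"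
  unfolding free_set_def by blast

text \<open>Resolving is symmetric in the pair, so six unordered pairs suffice. Every use exhibits
  four vertices and resolvers outside of them.\<close>

lemma tightD:
  assumes "tight V E" "distinct [p, q, r, s]" "{p, q, r, s} \<subseteq> V"
    and "\<exists>x\<in>V - {p, q, r, s}. resolves E x p q" "\<exists>x\<in>V - {p, q, r, s}. resolves E x p r"
    and "\<exists>x\<in>V - {p, q, r, s}. resolves E x p s" "\<exists>x\<in>V - {p, q, r, s}. resolves E x q r"
    and "\<exists>x\<in>V - {p, q, r, s}. resolves E x q s" "\<exists>x\<in>V - {p, q, r, s}. resolves E x r s"
  shows False
proof -
  have all_pairs: "R u v" if "\<And>u v. R u v \<Longrightarrow> R v u" "R p q" "R p r" "R p s" "R q r" "R q s" "R r s"
    "u \<in> {p, q, r, s}" "v \<in> {p, q, r, s}" "u \<noteq> v" for R :: "'a \<Rightarrow> 'a \<Rightarrow> bool" and u v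
    using that by auto
  have *: "\<exists>x\<in>V - {p, q, r, s}. resolves E x u v"
    if "u \<in> {p, q, r, s}" "v \<in> {p, q, r, s}" "u \<noteq> v" for u v
    by (rule all_pairs[OF _ assms(4-9) that]) (meson resolves_sym)
  have "free_set V E {p, q, r, s}"
    unfolding free_set_def using assms(3) * by (intro conjI ballI impI) assumption+
  moreover have "card {p, q, r, s} = 4" using assms(2) by simp
  ultimately show False using assms(1) by (auto simp: tight_def)
qed

locale ugraph =
  fixes V :: "'a set" and E :: "'a \<Rightarrow> 'a \<Rightarrow> bool"
  assumes finite_V: "finite V" and adj_in: "E u v \<Longrightarrow> u \<in> V \<and> v \<in> V"
    and adj_sym: "E u v \<Longrightarrow> E v u" and adj_irrefl [simp]: "\<not> E u u"
begin

lemma adj_commute: "E u v \<longleftrightarrow> E v u"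
  using adj_sym by blast

lemma ugraph_co: "ugraph V (co V E)"
  by standard (auto simp: co_def finite_V dest: adj_sym)

lemma co_co: "co V (co V E) = E"
  unfolding co_def fun_eq_iff using adj_in adj_irrefl by blast

lemma dist_le_sym: "dist_le E k u v \<Longrightarrow> dist_le E k v u"
proof (induction k arbitrary: u v)
  case (Suc k)
  from Suc.prems consider "dist_le E k u v" | w where "E u w" "dist_le E k w v" by auto
  then show ?case
  proof cases
    case 2
    then show ?thesis using Suc.IH[of w v] adj_sym[of u w] dist_le_Suc_back[of E k v u] by blast
  qed (use Suc.IH in simp)
qed auto

text \<open>The distance from \<open>u\<close> grows by at most one along an edge, so a walk leaving
  the ball of radius \<open>k\<close> skips no value.\<close>

lemma exact_distance:
  assumes "dist_le E l u v" "\<not> dist_le E k u v"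
  shows "\<exists>w. dist_le E (Suc k) u w \<and> \<not> dist_le E k u w"
  using assms
proof (induction l arbitrary: v)
  case (Suc l)
  show ?case
  proof (cases "dist_le E l u v")
    case False
    then obtain w where w: "dist_le E l u w" "E w v" using Suc.prems dist_le_Suc_back by metis
    show ?thesis
    proof (cases "dist_le E k u w")
      case True
      then show ?thesis using w Suc.prems dist_le_Suc_back by metis
    qed (use Suc.IH w in blast)
  qed (use Suc in blast)
qed auto

end

locale connected_ugraph = ugraph +
  assumes connected: "connected_on V E"
begin

text \<open>The path is a geodesic to some vertex at distance exactly three, and geodesics are
  induced. Its end \<open>d\<close> need not be \<open>v\<close>.\<close>

lemma far_path:
  assumes "u \<in> V" "v \<in> V" "\<not> dist_le E 2 u v"
  obtains b c d where "E u b" "E b c" "E c d" "\<not> E u c" "\<not> E u d" "\<not> E b d" "\<not> dist_le E 2 u d"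
    "distinct [u, b, c, d]"
proof -
  obtain l where "dist_le E l u v" using connected assms by (auto simp: connected_on_def)
  then obtain d where "dist_le E (Suc 2) u d" "\<not> dist_le E 2 u d"
    using exact_distance assms(3) by blast
  then obtain b c where "E u b" "E b c" "E c d"
    by (auto simp: numeral_2_eq_2)
  moreover have "\<not> E u d" "\<not> E b d" "u \<noteq> d"
    using \<open>\<not> dist_le E 2 u d\<close> \<open>E u b\<close> by (auto simp: numeral_2_eq_2)
  moreover have "\<not> E u c" using \<open>\<not> dist_le E 2 u d\<close> \<open>E c d\<close> by (auto simp: numeral_2_eq_2)
  moreover have "u \<noteq> c" "b \<noteq> d" using calculation by (auto simp: adj_commute)
  ultimately show ?thesis
    using that[of b c d] \<open>\<not> dist_le E 2 u d\<close> by auto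
qed

end

locale tight_graph = connected_ugraph +
  assumes tight: "tight V E"
begin

text \<open>On a geodesic \<open>u w1 w2 w3 w4\<close> the last four vertices have different
  distances from \<open>u\<close>, so \<open>u\<close> alone would make them a free
  quadruple.\<close>

lemma dist_le_3:
  assumes "u \<in> V" "v \<in> V"
  shows "dist_le E 3 u v"
proof (rule ccontr)
  assume n: "\<not> dist_le E 3 u v"
  obtain l where "dist_le E l u v" using connected assms by (auto simp: connected_on_def)
  then obtain w4 where w4: "dist_le E (Suc 3) u w4" "\<not> dist_le E 3 u w4"
    using exact_distance[of l u v 3] n by blast
  then obtain w3 where w3: "dist_le E 3 u w3" "E w3 w4"
    using dist_le_Suc_back[of E 3 u w4] by blast
  have n3: "\<not> dist_le E 2 u w3"
    using w4 w3 dist_le_Suc_back[of E 2 u w4] by (metis Suc_numeral semiring_norm(5) add_One)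
  then obtain w2 where w2: "dist_le E 2 u w2" "E w2 w3"
    using w3 dist_le_Suc_back[of E 2 u w3] by (metis Suc_numeral semiring_norm(5) add_One)
  have n2: "\<not> dist_le E 1 u w2"
    using n3 w2 dist_le_Suc_back[of E 1 u w3] by (metis Suc_1)
  then obtain w1 where w1: "dist_le E 1 u w1" "E w1 w2"
    using w2 dist_le_Suc_back[of E 1 u w2] by (metis Suc_1)
  have n1: "u \<noteq> w1" using n2 w1 by auto
  have ne: "p \<noteq> q" if "dist_le E k u p" "\<not> dist_le E k u q" for p q k
    using that by auto
  have mono: "dist_le E l u x" if "dist_le E k u x" "k \<le> l" for k l x
    using that by (rule dist_le_mono)
  have le: "dist_le E 2 u w1" "dist_le E 3 u w1" "dist_le E 3 u w2"
    using mono[OF w1(1)] mono[OF w2(1)] by simp_all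
  have dist: "distinct [w1, w2, w3, w4]"
    using ne[OF w1(1) n2] ne[OF le(1) n3] ne[OF le(2) w4(2)] ne[OF w2(1) n3]
      ne[OF le(3) w4(2)] ne[OF w3(1) w4(2)] by simp
  have u: "u \<in> V - {w1, w2, w3, w4}"
    using assms n1 n2 n3 w4(2) by auto
  have r: "\<exists>x\<in>V - {w1, w2, w3, w4}. resolves E x p q"
    if "dist_le E k u p" "\<not> dist_le E k u q" for p q k
    using that dist_le_sym u unfolding resolves_def by blast
  have V: "{w1, w2, w3, w4} \<subseteq> V" using adj_in[OF w1(2)] adj_in[OF w3(2)] by simp
  show False
    by (rule tightD[OF tight dist V r[OF w1(1) n2] r[OF le(1) n3] r[OF le(2) w4(2)]
        r[OF w2(1) n3] r[OF le(3) w4(2)] r[OF w3(1) w4(2)]])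
qed

end

section \<open>Spheres around a vertex\<close>

text \<open>
  The blow-ups of \<open>P\<^sub>4\<close> along \<open>A, B, {c}, {d}\<close> with cliques \<open>A\<close> and \<open>B\<close>. Their complements are the
  blow-ups along \<open>B, {d}, A, {c}\<close> with edgeless \<open>A\<close> and \<open>B\<close>.
\<close>

definition clique_type :: "'a set \<Rightarrow> ('a \<Rightarrow> 'a \<Rightarrow> bool) \<Rightarrow> bool" where
  "clique_type V E \<longleftrightarrow> (\<exists>A B c d. V = A \<union> B \<union> {c, d} \<and> A \<inter> B = {} \<and> c \<notin> A \<union> B \<and> d \<notin> A \<union> B \<and>
     c \<noteq> d \<and> A \<noteq> {} \<and> B \<noteq> {} \<and> (\<forall>u\<in>A \<union> B. \<forall>v\<in>A \<union> B. u \<noteq> v \<longrightarrow> E u v) \<and>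
     (\<forall>u\<in>A. \<not> E u c \<and> \<not> E u d) \<and> (\<forall>u\<in>B. E u c \<and> \<not> E u d) \<and> E c d)"

lemma clique_typeI:
  assumes "V = A \<union> B \<union> {c, d}" "A \<inter> B = {}" "c \<notin> A \<union> B" "d \<notin> A \<union> B" "c \<noteq> d"
    "A \<noteq> {}" "B \<noteq> {}"
    "\<And>u v. u \<in> A \<union> B \<Longrightarrow> v \<in> A \<union> B \<Longrightarrow> u \<noteq> v \<Longrightarrow> E u v"
    "\<And>u. u \<in> A \<Longrightarrow> \<not> E u c \<and> \<not> E u d" "\<And>u. u \<in> B \<Longrightarrow> E u c \<and> \<not> E u d" "E c d"
  shows "clique_type V E"
proof -
  have "\<forall>u\<in>A \<union> B. \<forall>v\<in>A \<union> B. u \<noteq> v \<longrightarrow> E u v" "\<forall>u\<in>A. \<not> E u c \<and> \<not> E u d" "\<forall>u\<in>B. E u c \<and> \<not> E u d"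
    using assms(8-10) by simp_all
  then show ?thesis
    unfolding clique_type_def using assms(1-7,11)
    by (intro exI[of _ A] exI[of _ B] exI[of _ c] exI[of _ d] conjI) assumption+
qed

lemma co_clique_typeI:
  assumes "V = A \<union> B \<union> {c, d}" "A \<inter> B = {}" "c \<notin> A \<union> B" "d \<notin> A \<union> B" "c \<noteq> d"
    "A \<noteq> {}" "B \<noteq> {}"
    "\<And>u v. u \<in> A \<union> B \<Longrightarrow> v \<in> A \<union> B \<Longrightarrow> \<not> E u v"
    "\<And>u. u \<in> A \<Longrightarrow> E u c \<and> E u d" "\<And>u. u \<in> B \<Longrightarrow> \<not> E u c \<and> E u d" "\<not> E c d"
  shows "clique_type V (co V E)"
  by (rule clique_typeI[OF assms(1-7)]) (use assms in \<open>auto simp: co_def\<close>)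

context ugraph
begin

definition sphere2 :: "'a \<Rightarrow> 'a set" where
  "sphere2 a = {x. x \<noteq> a \<and> \<not> E a x \<and> (\<exists>w. E a w \<and> E w x)}"

text \<open>Defined as the remainder, so that \<open>layers\<close> covers the vertex set of any
  graph. Under tightness \<open>dist_le_3\<close> turns it into the sphere of radius three.\<close>

definition beyond2 :: "'a \<Rightarrow> 'a set" where
  "beyond2 a = {x \<in> V. x \<noteq> a \<and> \<not> E a x \<and> \<not> (\<exists>w. E a w \<and> E w x)}"

lemma layers: "a \<in> V \<Longrightarrow> V = {a} \<union> {x. E a x} \<union> sphere2 a \<union> beyond2 a"
  unfolding sphere2_def beyond2_def using adj_in by blast

lemma sphere2_in: "x \<in> sphere2 a \<Longrightarrow> x \<in> V"
  unfolding sphere2_def using adj_in by blast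

lemma beyond2_in: "x \<in> beyond2 a \<Longrightarrow> x \<in> V"
  unfolding beyond2_def by blast

lemma beyond2_iff: "x \<in> V \<Longrightarrow> x \<in> beyond2 a \<longleftrightarrow> \<not> dist_le E 2 a x"
  unfolding beyond2_def by (auto simp: numeral_2_eq_2)

lemma beyond2_commute: "a \<in> V \<Longrightarrow> x \<in> beyond2 a \<Longrightarrow> a \<in> beyond2 x"
  unfolding beyond2_def using adj_sym by blast

lemma resolves_from:
  "dist_le E k a p \<Longrightarrow> \<not> dist_le E k a q \<Longrightarrow> resolves E a p q"
  unfolding resolves_def using dist_le_sym by blast

lemma resolves_layers:
  shows "E a x \<Longrightarrow> y \<in> sphere2 a \<Longrightarrow> resolves E a x y"
    and "E a x \<Longrightarrow> z \<in> beyond2 a \<Longrightarrow> resolves E a x z"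
    and "y \<in> sphere2 a \<Longrightarrow> z \<in> beyond2 a \<Longrightarrow> resolves E a y z"
proof -
  note [simp] = sphere2_def beyond2_def
  show "E a x \<Longrightarrow> y \<in> sphere2 a \<Longrightarrow> resolves E a x y"
    by (rule resolves_from[of "Suc 0"]) auto
  show "E a x \<Longrightarrow> z \<in> beyond2 a \<Longrightarrow> resolves E a x z"
    by (rule resolves_from[of "Suc 0"]) auto
  show "y \<in> sphere2 a \<Longrightarrow> z \<in> beyond2 a \<Longrightarrow> resolves E a y z"
    by (rule resolves_from[of "Suc (Suc 0)"]) auto
qed

lemma layers_disjoint:
  shows "E a x \<Longrightarrow> y \<in> sphere2 a \<Longrightarrow> x \<noteq> y"
    and "E a x \<Longrightarrow> z \<in> beyond2 a \<Longrightarrow> x \<noteq> z"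
    and "y \<in> sphere2 a \<Longrightarrow> z \<in> beyond2 a \<Longrightarrow> y \<noteq> z"
  unfolding sphere2_def beyond2_def by blast+

lemma beyond2_not_adj: "z \<in> beyond2 a \<Longrightarrow> E a x \<Longrightarrow> \<not> E x z \<and> \<not> E z x"
  unfolding beyond2_def using adj_sym by blast

end

context tight_graph
begin

lemma beyond2_neighbour:
  assumes "a \<in> V" "x \<in> beyond2 a"
  obtains w where "w \<in> sphere2 a" "E w x"
proof -
  have "dist_le E (Suc 2) a x" using dist_le_3[OF assms(1) beyond2_in[OF assms(2)]]
    by (simp add: eval_nat_numeral)
  moreover have "\<not> dist_le E 2 a x" using assms beyond2_iff beyond2_in by blast
  ultimately obtain w where w: "dist_le E 2 a w" "E w x" unfolding dist_le_Suc_back by blast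
  have "w \<noteq> a" "\<not> E a w" using w(2) assms(2) unfolding beyond2_def by blast+
  then have "w \<in> sphere2 a" using w(1) unfolding sphere2_def by (auto simp: numeral_2_eq_2)
  then show ?thesis using w(2) that by blast
qed

text \<open>With representatives \<open>c\<close> and \<open>d\<close> of the other layers,
  \<open>a\<close> resolves five of the six pairs of \<open>{x, y, c, d}\<close>. A resolver of
  \<open>x\<close> and \<open>y\<close> outside this set would complete a free quadruple. Since the
  representatives are arbitrary, the only possible resolver is a vertex that is alone on its
  layer.\<close>

lemma layer1_resolver:
  assumes "a \<in> V" "E a x" "E a y" "x \<noteq> y" "c \<in> sphere2 a" "d \<in> beyond2 a"
    and "z \<in> V" "z \<noteq> x" "z \<noteq> y" "resolves E z x y"
  shows "z = c \<or> z = d"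
proof (rule ccontr)
  assume "\<not> (z = c \<or> z = d)"
  then have z: "z \<in> V - {x, y, c, d}" using assms by blast
  have dist: "distinct [x, y, c, d]" using assms layers_disjoint
    by (metis distinct_length_2_or_more distinct_singleton)
  have V: "{x, y, c, d} \<subseteq> V" using assms adj_in sphere2_in beyond2_in by blast
  have a: "a \<in> V - {x, y, c, d}" using assms by (auto simp: sphere2_def beyond2_def)
  have R: "\<exists>x\<in>V - {x, y, c, d}. resolves E x p q" if "resolves E a p q" for p q
    using that a by blast
  have Z: "\<exists>x\<in>V - {x, y, c, d}. resolves E x x' y'" if "resolves E z x' y'" for x' y'
    using that z by blast
  note L = resolves_layers
  show False
    by (rule tightD[OF tight dist V Z[OF assms(10)]
        R[OF L(1)[OF assms(2) assms(5)]]
        R[OF L(2)[OF assms(2) assms(6)]]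
        R[OF L(1)[OF assms(3) assms(5)]]
        R[OF L(2)[OF assms(3) assms(6)]]
        R[OF L(3)[OF assms(5) assms(6)]]])
qed

lemma layer2_resolver:
  assumes "a \<in> V" "E a b" "x \<in> sphere2 a" "y \<in> sphere2 a" "x \<noteq> y" "d \<in> beyond2 a"
    and "z \<in> V" "z \<noteq> x" "z \<noteq> y" "resolves E z x y"
  shows "z = b \<or> z = d"
proof (rule ccontr)
  assume "\<not> (z = b \<or> z = d)"
  then have z: "z \<in> V - {b, x, y, d}" using assms by blast
  have dist: "distinct [b, x, y, d]" using assms layers_disjoint
    by (metis distinct_length_2_or_more distinct_singleton)
  have V: "{b, x, y, d} \<subseteq> V" using assms adj_in sphere2_in beyond2_in by blast
  have a: "a \<in> V - {b, x, y, d}" using assms by (auto simp: sphere2_def beyond2_def)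
  have R: "\<exists>x\<in>V - {b, x, y, d}. resolves E x p q" if "resolves E a p q" for p q
    using that a by blast
  have Z: "\<exists>x\<in>V - {b, x, y, d}. resolves E x x' y'" if "resolves E z x' y'" for x' y'
    using that z by blast
  note L = resolves_layers
  show False
    by (rule tightD[OF tight dist V R[OF L(1)[OF assms(2) assms(3)]]
        R[OF L(1)[OF assms(2) assms(4)]]
        R[OF L(2)[OF assms(2) assms(6)]]
        Z[OF assms(10)]
        R[OF L(3)[OF assms(3) assms(6)]]
        R[OF L(3)[OF assms(4) assms(6)]]])
qed

lemma layer3_resolver:
  assumes "a \<in> V" "E a b" "c \<in> sphere2 a" "x \<in> beyond2 a" "y \<in> beyond2 a" "x \<noteq> y"
    and "z \<in> V" "z \<noteq> x" "z \<noteq> y" "resolves E z x y"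
  shows "z = b \<or> z = c"
proof (rule ccontr)
  assume "\<not> (z = b \<or> z = c)"
  then have z: "z \<in> V - {b, c, x, y}" using assms by blast
  have dist: "distinct [b, c, x, y]" using assms layers_disjoint
    by (metis distinct_length_2_or_more distinct_singleton)
  have V: "{b, c, x, y} \<subseteq> V" using assms adj_in sphere2_in beyond2_in by blast
  have a: "a \<in> V - {b, c, x, y}" using assms by (auto simp: sphere2_def beyond2_def)
  have R: "\<exists>x\<in>V - {b, c, x, y}. resolves E x p q" if "resolves E a p q" for p q
    using that a by blast
  have Z: "\<exists>x\<in>V - {b, c, x, y}. resolves E x x' y'" if "resolves E z x' y'" for x' y'
    using that z by blast
  note L = resolves_layers
  show False
    by (rule tightD[OF tight dist V R[OF L(1)[OF assms(2) assms(3)]]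
        R[OF L(2)[OF assms(2) assms(4)]]
        R[OF L(2)[OF assms(2) assms(5)]]
        R[OF L(3)[OF assms(3) assms(4)]]
        R[OF L(3)[OF assms(3) assms(5)]]
        Z[OF assms(10)]])
qed

end

section \<open>Layers that are not classes of twins\<close>

definition twins_on :: "('a \<Rightarrow> 'a \<Rightarrow> bool) \<Rightarrow> 'a set \<Rightarrow> bool" where
  "twins_on E S \<longleftrightarrow> (\<forall>x\<in>S. \<forall>y\<in>S. \<forall>z. z \<noteq> x \<longrightarrow> z \<noteq> y \<longrightarrow> E z x = E z y)"

lemma twins_onD: "twins_on E S \<Longrightarrow> x \<in> S \<Longrightarrow> y \<in> S \<Longrightarrow> z \<noteq> x \<Longrightarrow> z \<noteq> y \<Longrightarrow> E z x = E z y"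
  unfolding twins_on_def by blast

lemma not_twins_onE:
  assumes "\<not> twins_on E S"
  obtains x y z where "x \<in> S" "y \<in> S" "z \<noteq> x" "z \<noteq> y" "E z x" "\<not> E z y"
  using assms unfolding twins_on_def by blast

locale far_pair = tight_graph +
  fixes a d
  assumes a_in: "a \<in> V" and far: "d \<in> beyond2 a"
begin

lemma far_pair_reverse: "far_pair V E d a"
  using beyond2_in[OF far] beyond2_commute[OF a_in far] tight_graph_axioms
  by (simp add: far_pair_def far_pair_axioms_def)

text \<open>The separating vertex \<open>z\<close> turns out to be the whole second sphere and
  \<open>d\<close> the whole third, so every route from a neighbour of \<open>a\<close> to
  \<open>d\<close> passes through \<open>z\<close>. The neighbours of \<open>a\<close> then form a
  clique with \<open>a\<close>, and adjacency to \<open>z\<close> divides it into the two parts of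
  the blow-up, with \<open>z d\<close> as the pendant path.\<close>

lemma layer1_split:
  assumes "\<not> twins_on E {x. E a x}"
  shows "clique_type V E"
proof -
  obtain x y z where xy: "E a x" "E a y" and z: "z \<noteq> x" "z \<noteq> y" "E z x" "\<not> E z y"
    using not_twins_onE[OF assms] by blast
  have zV: "z \<in> V" using adj_in[OF z(3)] by simp
  have xy_ne: "x \<noteq> y" using z by blast
  have "resolves E z x y" by (rule resolves_adjI) (use z adj_commute in metis)+
  note res = layer1_resolver[OF a_in xy xy_ne _ _ zV z(1,2) this]
  \<comment> \<open>Being adjacent to a neighbour of \<open>a\<close>, the vertex \<open>z\<close>
    cannot be the representative of the third layer, so it equals every possible representative of
    the second.\<close>
  have "z \<notin> beyond2 a" using beyond2_not_adj[OF _ xy(1)] z(3) adj_sym by blast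
  then have z_unique: "z = c" if "c \<in> sphere2 a" for c using res[OF that far] far by blast
  obtain c where "c \<in> sphere2 a" using beyond2_neighbour[OF a_in far] .
  then have z2: "z \<in> sphere2 a" using z_unique by blast
  then have az: "\<not> E a z" "z \<noteq> a" by (auto simp: sphere2_def)
  have zd: "E z e" if "e \<in> beyond2 a" for e
    using beyond2_neighbour[OF a_in that] z_unique by metis
  have d_nbr: "w = z" if "E w e" "e \<in> beyond2 a" "w \<notin> beyond2 a" for w e
  proof -
    have "w \<noteq> a" "\<not> E a w" using that beyond2_not_adj unfolding beyond2_def by blast+
    then have "w \<in> sphere2 a" using that layers[OF a_in] adj_in[OF that(1)] by blast
    then show ?thesis using z_unique by blast
  qed
  \<comment> \<open>Such an \<open>e\<close> is two steps from \<open>x\<close> by way of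
    \<open>z\<close>, but farther from \<open>y\<close>, which misses \<open>z\<close>. So
    \<open>e\<close> itself resolves \<open>x\<close> and \<open>y\<close> and must be alone on its
    layer.\<close>
  have d_unique: "e = d" if e: "e \<in> beyond2 a" for e
  proof (rule ccontr)
    assume "e \<noteq> d"
    have n: "e \<noteq> x" "e \<noteq> y" using e xy by (auto simp: beyond2_def)
    have "resolves E e x y"
    proof (rule resolves_2I)
      show "E x e \<or> (\<exists>w. E x w \<and> E w e)" using zd[OF e] adj_sym[OF z(3)] by blast
      show "\<not> E y e" using beyond2_not_adj[OF e xy(2)] by simp
      show "\<not> (\<exists>w. E y w \<and> E w e)"
        using d_nbr[OF _ e] beyond2_not_adj[OF _ xy(2)] z(4) adj_sym by metis
    qed (use n in simp)
    then have "e = z \<or> e = d"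
      using layer1_resolver[OF a_in xy xy_ne z2 far beyond2_in[OF e] n] by simp
    then show False using \<open>e \<noteq> d\<close> \<open>z \<notin> beyond2 a\<close> e by blast
  qed
  have V: "V = {a} \<union> {x. E a x} \<union> {z, d}"
    using layers[OF a_in] z_unique d_unique z2 far by blast
  have da: "d \<noteq> a" "\<not> E a d" using far by (auto simp: beyond2_def)
  have dz: "d \<noteq> z" using far \<open>z \<notin> beyond2 a\<close> by blast
  have T: "E t u = E t v" if "E a u" "E a v" "t \<in> V" "t \<notin> {u, v, z, d}" for t u v
  proof (rule ccontr)
    assume n: "E t u \<noteq> E t v"
    then have "u \<noteq> v" by blast
    moreover have "resolves E t u v" by (rule resolves_adjI) (use n that adj_commute in auto)
    ultimately show False
      using layer1_resolver[OF a_in that(1,2) _ z2 far that(3)] that(4) by blast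
  qed
  \<comment> \<open>By the diameter bound \<open>u\<close> reaches \<open>d\<close> in three steps,
    and the last of them is \<open>z d\<close>. The vertex before \<open>z\<close> is the common
    neighbour.\<close>
  have linked: "\<exists>w. E a w \<and> E z w \<and> E u w" if u: "E a u" "\<not> E z u" for u
  proof -
    have "u \<in> V" using adj_in[OF u(1)] by simp
    then have "dist_le E (Suc 2) u d"
      using dist_le_3[OF _ beyond2_in[OF far]] by (simp add: eval_nat_numeral)
    moreover have "u \<noteq> d" "\<not> E u d" "u \<noteq> z" "\<not> E u z"
      using u da az adj_commute beyond2_not_adj[OF far u(1)] by auto
    moreover have no2: "\<not> (\<exists>w. E u w \<and> E w d)"
      using d_nbr[OF _ far] beyond2_not_adj[OF far u(1)] d_unique \<open>\<not> E u z\<close> by metis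
    ultimately obtain w1 w2 where w: "E u w1" "E w1 w2" "E w2 d"
      by (auto simp: numeral_2_eq_2)
    then have "w2 = z" using d_nbr[OF w(3) far] d_unique adj_irrefl by metis
    then have "E z w1" using w adj_sym by blast
    moreover have "w1 \<noteq> a" "w1 \<noteq> z" "w1 \<noteq> d"
      using \<open>E z w1\<close> az w \<open>\<not> E u z\<close> \<open>\<not> E u d\<close> adj_sym by auto
    then have "E a w1" using V adj_in[OF w(1)] by blast
    ultimately show ?thesis using w(1) by blast
  qed
  have adj_split: "E u v" if u: "E a u" "\<not> E z u" and v: "E a v" "u \<noteq> v" for u v
  proof -
    obtain w where w: "E a w" "E z w" "E u w" using linked[OF u] by blast
    have "u \<noteq> w" using w u by blast
    then have "v = w \<or> E u v = E u w"
      using T[OF v(1) w(1), of u] u v adj_in[OF u(1)] az da by blast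
    then show ?thesis using w(3) by blast
  qed
  have clique: "E u v" if u: "E a u" and v: "E a v" and "u \<noteq> v" for u v
  proof (cases "E z u \<and> E z v")
    case True
    \<comment> \<open>The vertex \<open>y\<close> misses \<open>z\<close>, so
      \<open>adj_split\<close> joins it to all other neighbours of \<open>a\<close>; comparing
      \<open>y\<close> with \<open>u\<close> at \<open>v\<close> carries the edge over to
      \<open>u\<close>.\<close>
    have "E y u" "E y v" using adj_split[OF xy(2) z(4)] u v True z(4) by metis+
    moreover have "E v y = E v u"
      using T[OF xy(2) u, of v] adj_in[OF v] True \<open>u \<noteq> v\<close> z(4) v az da by auto
    ultimately show ?thesis using adj_sym by blast
  next
    case False
    then consider "\<not> E z u" | "\<not> E z v" by blast
    then show ?thesis
    proof cases
      case 1
      then show ?thesis by (rule adj_split[OF u _ v \<open>u \<noteq> v\<close>])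
    next
      case 2
      then show ?thesis using adj_split[OF v _ u] \<open>u \<noteq> v\<close> adj_sym by blast
    qed
  qed
  have dN: "\<not> E u d" if "E a u" for u using beyond2_not_adj[OF far that] by simp
  show ?thesis
  proof (rule clique_typeI[of V "{a} \<union> {x. E a x \<and> \<not> E z x}" "{x. E a x \<and> E z x}" z d])
    show "V = {a} \<union> {x. E a x \<and> \<not> E z x} \<union> {x. E a x \<and> E z x} \<union> {z, d}" using V by blast
    show "E z d" using zd[OF far] .
    show "{x. E a x \<and> E z x} \<noteq> {}" using xy z by blast
    show "E u v" if "u \<in> {a} \<union> {x. E a x \<and> \<not> E z x} \<union> {x. E a x \<and> E z x}"
      "v \<in> {a} \<union> {x. E a x \<and> \<not> E z x} \<union> {x. E a x \<and> E z x}" "u \<noteq> v" for u v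
    proof -
      have "u = a \<or> E a u" "v = a \<or> E a v" using that by blast+
      then show ?thesis using clique \<open>u \<noteq> v\<close> adj_sym by metis
    qed
    show "\<not> E u z \<and> \<not> E u d" if "u \<in> {a} \<union> {x. E a x \<and> \<not> E z x}" for u
      using that az da dN adj_sym by blast
    show "E u z \<and> \<not> E u d" if "u \<in> {x. E a x \<and> E z x}" for u
      using that dN adj_sym by blast
  qed (use az da dz in auto)
qed

text \<open>A vertex \<open>z\<close> that sees \<open>x\<close> but not \<open>y\<close> must be
  one of the representatives \<open>b\<close>, \<open>c\<close> of the inner layers. Taking
  \<open>c\<close> adjacent to \<open>y\<close> excludes \<open>c\<close>, and a vertex that sees
  \<open>x\<close> is no neighbour of \<open>a\<close>, which excludes \<open>b\<close>.\<close>

lemma layer3_twins: "twins_on E (beyond2 a)"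
proof (rule ccontr)
  assume "\<not> twins_on E (beyond2 a)"
  then obtain x y z where xy: "x \<in> beyond2 a" "y \<in> beyond2 a" and z: "z \<noteq> x" "z \<noteq> y" "E z x"
    "\<not> E z y"
    by (rule not_twins_onE)
  have zV: "z \<in> V" using adj_in[OF z(3)] by simp
  have "resolves E z x y" by (rule resolves_adjI) (use z adj_commute in metis)+
  moreover have "x \<noteq> y" using z by blast
  moreover have z1: "\<not> E a z" using beyond2_not_adj[OF xy(1)] z(3) by blast
  obtain c where c: "c \<in> sphere2 a" "E c y" using beyond2_neighbour[OF a_in xy(2)] .
  moreover obtain b where "E a b" using c(1) by (auto simp: sphere2_def)
  ultimately have "z = b \<or> z = c" using layer3_resolver[OF a_in _ _ xy _ zV z(1,2)] by blast
  then show False using z1 \<open>E a b\<close> c(2) z(4) by blast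
qed

text \<open>Taking the representative of the first layer adjacent to \<open>y\<close> excludes it as
  the separating vertex. What remains is every vertex of the third layer, which is therefore
  \<open>{d}\<close>, and \<open>d\<close> is the only separator.\<close>

lemma layer2_split:
  assumes "\<not> twins_on E (sphere2 a)"
  shows "beyond2 a = {d}" "\<And>x y z. x \<in> sphere2 a \<Longrightarrow> y \<in> sphere2 a \<Longrightarrow> z \<noteq> x \<Longrightarrow> z \<noteq> y \<Longrightarrow> z \<noteq> d \<Longrightarrow> E z x =
    E z y"
    "\<exists>x\<in>sphere2 a. \<exists>y\<in>sphere2 a. E x d \<and> \<not> E y d"
proof -
  have *: "beyond2 a = {z}"
    if xy: "x \<in> sphere2 a" "y \<in> sphere2 a" and z: "z \<noteq> x" "z \<noteq> y" "E z x" "\<not> E z y" for x y z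
  proof -
    have zV: "z \<in> V" using adj_in[OF z(3)] by simp
    have "x \<noteq> y" using z by blast
    have "resolves E z x y" by (rule resolves_adjI) (use z adj_commute in metis)+
    note res = layer2_resolver[OF a_in _ xy \<open>x \<noteq> y\<close> _ zV z(1,2) this]
    obtain b where b: "E a b" "E b y" using xy(2) by (auto simp: sphere2_def)
    have "z \<noteq> b" using b z by blast
    then have "z = e" if "e \<in> beyond2 a" for e using res[OF b(1) that] by blast
    then show ?thesis using far by blast
  qed
  obtain x y z where xy: "x \<in> sphere2 a" "y \<in> sphere2 a" and z: "z \<noteq> x" "z \<noteq> y" "E z x" "\<not> E z y"
    using not_twins_onE[OF assms] .
  have "d = z" using *[OF xy z] far by simp
  then show "beyond2 a = {d}" using *[OF xy z] by simp
  show "\<exists>x\<in>sphere2 a. \<exists>y\<in>sphere2 a. E x d \<and> \<not> E y d"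
    using xy z(3,4) \<open>d = z\<close> adj_sym by blast
  show "E z x = E z y" if "x \<in> sphere2 a" "y \<in> sphere2 a" "z \<noteq> x" "z \<noteq> y" "z \<noteq> d" for x y z
  proof (rule ccontr)
    assume "E z x \<noteq> E z y"
    then have "beyond2 a = {z}" using *[OF that(1-4)] *[OF that(2,1,4,3)] by blast
    then show False using far that(5) by simp
  qed
qed

end

text \<open>The induced path \<open>a b x d\<close> with an apex \<open>y\<close> over its middle
  edge.\<close>

definition bull_type :: "'a set \<Rightarrow> ('a \<Rightarrow> 'a \<Rightarrow> bool) \<Rightarrow> bool" where
  "bull_type V E \<longleftrightarrow> (\<exists>a b y x d. V = {a, b, y, x, d} \<and> distinct [a, b, y, x, d] \<and>
     E a b \<and> E b y \<and> E b x \<and> E y x \<and> E x d \<and> \<not> E a y \<and> \<not> E a x \<and> \<not> E a d \<and> \<not> E b d \<and> \<not> E y d)"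

text \<open>Twins may be adjacent or not, since the test vertex avoids both of them; but one edge
  inside a class spreads to all of its pairs.\<close>

lemma (in ugraph) twins_on_cases:
  assumes "twins_on E S"
  shows "(\<forall>u\<in>S. \<forall>v\<in>S. u \<noteq> v \<longrightarrow> E u v) \<or> (\<forall>u\<in>S. \<forall>v\<in>S. \<not> E u v)"
proof (rule disjCI)
  assume "\<not> (\<forall>u\<in>S. \<forall>v\<in>S. \<not> E u v)"
  then obtain x y where xy: "x \<in> S" "y \<in> S" "E x y" by blast
  have xv: "E v x" if "v \<in> S" "v \<noteq> x" for v
    using twins_onD[OF assms xy(2) that(1), of x] xy that adj_sym adj_irrefl by metis
  have "E v u" if "u \<in> S" "v \<in> S" "u \<noteq> v" for u v
    using twins_onD[OF assms xy(1) that(1), of v] xv[of v] xv[of u] that adj_sym by metis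
  then show "\<forall>u\<in>S. \<forall>v\<in>S. u \<noteq> v \<longrightarrow> E u v" by blast
qed

section \<open>Far pairs when the complement is tight as well\<close>

locale extremal_far_pair = far_pair +
  assumes co_tight: "tight V (co V E)"
begin

lemma extremal_far_pair_reverse: "extremal_far_pair V E d a"
  using far_pair_reverse co_tight by (simp add: extremal_far_pair_def extremal_far_pair_axioms_def)

text \<open>All three layers are twin classes, so the graph is the blow-up of the path
  \<open>a P Q R\<close> by cliques and edgeless sets. The facts \<open>no_PQ\<close>,
  \<open>no_QR_co\<close>, \<open>no_QR\<close> and \<open>no_PR\<close> test the quadruple
  \<open>{a, b, c, d}\<close> with second members of two layers as resolvers. They forbid certain
  pairs of large layers, and the surviving combinations are of the two types.\<close>

lemma uniform_layers:
  assumes tP: "twins_on E {x. E a x}" and tQ: "twins_on E (sphere2 a)"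
  shows "clique_type V E \<or> clique_type V (co V E)"
proof -
  define P Q R where "P = {x. E a x}" and "Q = sphere2 a" and "R = beyond2 a"
  note PQR = P_def Q_def R_def
  have tP: "twins_on E P" and tQ: "twins_on E Q" and tR: "twins_on E R"
    using assms layer3_twins unfolding PQR by simp_all
  have V: "V = {a} \<union> P \<union> Q \<union> R" using layers[OF a_in] by (simp add: PQR)
  have disj: "a \<notin> P" "a \<notin> Q" "a \<notin> R" "P \<inter> Q = {}" "P \<inter> R = {}" "Q \<inter> R = {}"
    unfolding PQR sphere2_def beyond2_def by auto
  have PQ: "E x y" "E y x" if "x \<in> P" "y \<in> Q" for x y
  proof -
    obtain w where w: "w \<in> P" "E w y" using \<open>y \<in> Q\<close> unfolding PQR sphere2_def by blast
    have "E y w = E y x" using twins_onD[OF tP w(1) that(1), of y] w that disj by blast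
    then show "E x y" "E y x" using w(2) adj_sym by blast+
  qed
  have QR: "E x y" "E y x" if "x \<in> Q" "y \<in> R" for x y
  proof -
    have "y \<in> beyond2 a" using that by (simp add: PQR)
    then obtain w where w: "w \<in> Q" "E w y" using beyond2_neighbour[OF a_in] unfolding PQR by metis
    have "E y w = E y x" using twins_onD[OF tQ w(1) that(1), of y] w that disj by blast
    then show "E x y" "E y x" using w(2) adj_sym by blast+
  qed
  have aP: "E a x" "E x a" if "x \<in> P" for x using that adj_sym unfolding PQR by blast+
  have aQ: "\<not> E a x" "\<not> E x a" if "x \<in> Q" for x using that adj_sym unfolding PQR sphere2_def
    by blast+
  have aR: "\<not> E a x" "\<not> E x a" if "x \<in> R" for x using that adj_sym unfolding PQR beyond2_def
    by blast+
  have PR: "\<not> E x y" "\<not> E y x" if "x \<in> P" "y \<in> R" for x y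
    using beyond2_not_adj that unfolding PQR by blast+
  note [simp] = aP aQ aR PQ QR PR
  have d: "d \<in> R" using far by (simp add: PQR)
  obtain c where c: "c \<in> Q" using beyond2_neighbour[OF a_in far] unfolding PQR by metis
  obtain b where b: "b \<in> P" using c unfolding PQR sphere2_def by blast
  have ne: "x \<noteq> y" if "x \<in> P \<and> (y = a \<or> y \<in> Q \<or> y \<in> R) \<or> x \<in> Q \<and> (y = a \<or> y \<in> P \<or> y \<in> R) \<or>
      x \<in> R \<and> (y = a \<or> y \<in> P \<or> y \<in> Q)" for x y using that disj by blast
  have a_ne: "a \<noteq> x" if "x \<in> P \<or> x \<in> Q \<or> x \<in> R" for x using that disj by blast
  let ?F = "co V E"
  have inV: "a \<in> V" "\<And>x. x \<in> P \<Longrightarrow> x \<in> V" "\<And>x. x \<in> Q \<Longrightarrow> x \<in> V" "\<And>x. x \<in> R \<Longrightarrow> x \<in> V"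
    using V by blast+
  \<comment> \<open>A vertex of \<open>P\<close> and a vertex of \<open>Q\<close> dominate the
    graph, so their distance in the complement exceeds two.\<close>
  have far_co: "\<not> (\<exists>w. ?F x w \<and> ?F w y)" "\<not> (\<exists>w. ?F y w \<and> ?F w x)" if "x \<in> P" "y \<in> Q" for x y
    using that V unfolding co_def by auto
  have no_PQ: False if "b' \<in> P" "b' \<noteq> b" "c' \<in> Q" "c' \<noteq> c" for b' c'
  proof (rule tightD[OF co_tight, of a b c d])
    note that[simp] b[simp] c[simp] d[simp] inV[simp] ne[simp] a_ne[simp]
      that(2,4)[THEN not_sym, simp]
    have new: "b' \<in> V - {a, b, c, d}" "c' \<in> V - {a, b, c, d}" using that b c d V disj by blast+
    show "distinct [a, b, c, d]" "{a, b, c, d} \<subseteq> V" using disj b c d V by auto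
    have "resolves ?F c' a b" by (rule resolves_adjI) (auto simp: co_def disj)
    then show "\<exists>x\<in>V - {a, b, c, d}. resolves ?F x a b" using new by blast
    have "resolves ?F b' a c"
      by (rule resolves_2I; (rule far_co)?) (auto simp: co_def disj intro!: exI[of _ d])
    then show "\<exists>x\<in>V - {a, b, c, d}. resolves ?F x a c" using new by blast
    have "resolves ?F c' a d" by (rule resolves_adjI) (auto simp: co_def disj)
    then show "\<exists>x\<in>V - {a, b, c, d}. resolves ?F x a d" using new by blast
    have "resolves ?F c' b c"
      by (rule resolves_sym, rule resolves_2I; (rule far_co)?)
        (auto simp: co_def disj intro!: exI[of _ a])
    then show "\<exists>x\<in>V - {a, b, c, d}. resolves ?F x b c" using new by blast
    have "resolves ?F c' b d"
      by (rule resolves_sym, rule resolves_2I; (rule far_co)?)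
        (auto simp: co_def disj intro!: exI[of _ a])
    then show "\<exists>x\<in>V - {a, b, c, d}. resolves ?F x b d" using new by blast
    have "resolves ?F b' c d" by (rule resolves_adjI) (auto simp: co_def disj)
    then show "\<exists>x\<in>V - {a, b, c, d}. resolves ?F x c d" using new by blast
  qed
  have no_QR_co: False if "c' \<in> Q" "c' \<noteq> c" "d' \<in> R" "d' \<noteq> d" "\<not> E d d'" for c' d'
  proof (rule tightD[OF co_tight, of a b c d])
    note that[simp] b[simp] c[simp] d[simp] inV[simp] ne[simp] a_ne[simp]
      that(2,4)[THEN not_sym, simp]
    have new: "c' \<in> V - {a, b, c, d}" "d' \<in> V - {a, b, c, d}" using that b c d V disj by blast+
    show "distinct [a, b, c, d]" "{a, b, c, d} \<subseteq> V" using disj b c d V by auto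
    have "resolves ?F c' a b" by (rule resolves_adjI) (auto simp: co_def disj)
    then show "\<exists>x\<in>V - {a, b, c, d}. resolves ?F x a b" using new by blast
    have "resolves ?F d' a c" by (rule resolves_adjI) (auto simp: co_def disj)
    then show "\<exists>x\<in>V - {a, b, c, d}. resolves ?F x a c" using new by blast
    have "resolves ?F c' a d" by (rule resolves_adjI) (auto simp: co_def disj)
    then show "\<exists>x\<in>V - {a, b, c, d}. resolves ?F x a d" using new by blast
    have "resolves ?F d' b c" by (rule resolves_adjI) (auto simp: co_def disj)
    then show "\<exists>x\<in>V - {a, b, c, d}. resolves ?F x b c" using new by blast
    have "resolves ?F c' b d"
      by (rule resolves_sym, rule resolves_2I; (rule far_co)?)
        (auto simp: co_def disj intro!: exI[of _ a])
    then show "\<exists>x\<in>V - {a, b, c, d}. resolves ?F x b d" using new by blast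
    have "resolves ?F d' c d" by (rule resolves_adjI) (auto simp: co_def disj)
    then show "\<exists>x\<in>V - {a, b, c, d}. resolves ?F x c d" using new by blast
  qed
  have no_QR: False if "c' \<in> Q" "c' \<noteq> c" "d' \<in> R" "d' \<noteq> d" "E d d'" "\<not> E c c'" for c' d'
  proof (rule tightD[OF tight, of a b c d])
    note that[simp] b[simp] c[simp] d[simp] inV[simp] ne[simp] a_ne[simp]
      that(2,4)[THEN not_sym, simp]
    have new: "c' \<in> V - {a, b, c, d}" "d' \<in> V - {a, b, c, d}" using that b c d V disj by blast+
    show "distinct [a, b, c, d]" "{a, b, c, d} \<subseteq> V" using disj b c d V by auto
    have "resolves E c' a b" by (rule resolves_adjI) (auto simp: co_def disj)
    then show "\<exists>x\<in>V - {a, b, c, d}. resolves E x a b" using new by blast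
    have "resolves E d' a c" by (rule resolves_adjI) (auto simp: co_def disj)
    then show "\<exists>x\<in>V - {a, b, c, d}. resolves E x a c" using new by blast
    have "resolves E c' a d" by (rule resolves_adjI) (auto simp: co_def disj)
    then show "\<exists>x\<in>V - {a, b, c, d}. resolves E x a d" using new by blast
    have "resolves E c' b c" by (rule resolves_adjI) (auto simp: co_def disj)
    then show "\<exists>x\<in>V - {a, b, c, d}. resolves E x b c" using new by blast
    have "resolves E d' b d" by (rule resolves_adjI) (auto simp: co_def disj)
    then show "\<exists>x\<in>V - {a, b, c, d}. resolves E x b d" using new by blast
    have "resolves E c' c d" by (rule resolves_adjI) (auto simp: co_def disj)
    then show "\<exists>x\<in>V - {a, b, c, d}. resolves E x c d" using new by blast
  qed
  have no_PR: False if "b' \<in> P" "b' \<noteq> b" "d' \<in> R" "d' \<noteq> d" "E b b' \<or> E d d'" for b' d'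
  proof (rule tightD[OF tight, of a b c d])
    note that(1-4)[simp] b[simp] c[simp] d[simp] inV[simp] ne[simp] a_ne[simp]
      that(2,4)[THEN not_sym, simp]
    have new: "b' \<in> V - {a, b, c, d}" "d' \<in> V - {a, b, c, d}" using that b c d V disj by blast+
    show "distinct [a, b, c, d]" "{a, b, c, d} \<subseteq> V" using disj b c d V by auto
    have "resolves E d' a b"
    proof (rule resolves_sym, rule resolves_2I)
      show "E b d' \<or> (\<exists>w. E b w \<and> E w d')" by (auto intro!: exI[of _ c])
      show "\<not> (\<exists>w. E a w \<and> E w d')" using that(3) unfolding PQR beyond2_def by blast
    qed (auto simp: disj)
    then show "\<exists>x\<in>V - {a, b, c, d}. resolves E x a b" using new by blast
    have "resolves E d' a c" by (rule resolves_adjI) (auto simp: disj)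
    then show "\<exists>x\<in>V - {a, b, c, d}. resolves E x a c" using new by blast
    have "resolves E b' a d" by (rule resolves_adjI) (auto simp: disj)
    then show "\<exists>x\<in>V - {a, b, c, d}. resolves E x a d" using new by blast
    have "resolves E d' b c" by (rule resolves_adjI) (auto simp: disj)
    then show "\<exists>x\<in>V - {a, b, c, d}. resolves E x b c" using new by blast
    have "resolves E b' c d" by (rule resolves_adjI) (auto simp: disj)
    then show "\<exists>x\<in>V - {a, b, c, d}. resolves E x c d" using new by blast
    have "resolves E b' b d \<or> resolves E d' b d" using that(5)
      by (auto intro: resolves_adjI simp: disj)
    then show "\<exists>x\<in>V - {a, b, c, d}. resolves E x b d" using new by blast
  qed
  have clique_or_edgeless: "(\<forall>u\<in>S. \<forall>v\<in>S. u \<noteq> v \<longrightarrow> E u v) \<or> (\<forall>u\<in>S. \<forall>v\<in>S. \<not> E u v)"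
    if "S \<in> {P, Q, R}" for S using that tP tQ tR twins_on_cases by blast
  have singleton: "S = {x}" if "x \<in> S" "\<And>y. y \<in> S \<Longrightarrow> y \<noteq> x \<Longrightarrow> False" for S :: "'a set" and x
    using that by blast
  have mem: "c \<notin> P" "c \<notin> R" "d \<notin> P" "d \<notin> Q" "b \<notin> Q" "b \<notin> R" "P \<noteq> {}" "Q \<noteq> {}" "R \<noteq> {}"
    using b c d disj by blast+
  note [simp] = b c d mem
  show ?thesis
  proof (cases "Q = {c}")
    case Qc: True
    have "clique_type V E" if n: "\<not> (\<forall>u\<in>P. \<forall>v\<in>P. \<not> E u v)"
    proof -
      have clique: "\<forall>u\<in>P. \<forall>v\<in>P. u \<noteq> v \<longrightarrow> E u v" using clique_or_edgeless[of P] n by blast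
      obtain b' where b': "b' \<in> P" "b' \<noteq> b"
      proof -
        obtain u v where "u \<in> P" "v \<in> P" "E u v" using n by blast
        moreover then have "u \<noteq> v" by auto
        ultimately show ?thesis using that by blast
      qed
      have "R = {d}" 
      proof (rule singleton[OF d])
        show False if "y \<in> R" "y \<noteq> d" for y using no_PR[OF b' that] clique b b' by simp
      qed
      then have V': "V = {a} \<union> P \<union> {c, d}" using V Qc by blast
      show ?thesis by (rule clique_typeI[OF V']) (auto simp: ne a_ne disj clique)
    qed
    moreover have "clique_type V E" if n: "\<not> (\<forall>u\<in>R. \<forall>v\<in>R. \<not> E u v)"
    proof -
      have clique: "\<forall>u\<in>R. \<forall>v\<in>R. u \<noteq> v \<longrightarrow> E u v" using clique_or_edgeless[of R] n by blast
      obtain d' where d': "d' \<in> R" "d' \<noteq> d"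
      proof -
        obtain u v where "u \<in> R" "v \<in> R" "E u v" using n by blast
        moreover then have "u \<noteq> v" by auto
        ultimately show ?thesis using that by blast
      qed
      have "P = {b}" 
      proof (rule singleton[OF b])
        show False if "y \<in> P" "y \<noteq> b" for y using no_PR[OF that d'] clique d d' by simp
      qed
      then have V': "V = R \<union> {c} \<union> {b, a}" using V Qc by blast
      show ?thesis by (rule clique_typeI[OF V']) (auto simp: ne a_ne disj clique)
    qed
    moreover have "clique_type V (co V E)"
      if "\<forall>u\<in>P. \<forall>v\<in>P. \<not> E u v" "\<forall>u\<in>R. \<forall>v\<in>R. \<not> E u v"
    proof -
      \<comment> \<open>In the complement \<open>P\<close> and \<open>R\<close> together form a
        clique, \<open>a\<close> is joined to exactly \<open>R\<close> and to \<open>c\<close>, and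
        \<open>c\<close> is pendant.\<close>
      have V': "V = P \<union> R \<union> {a, c}" using V Qc by blast
      show ?thesis by (rule co_clique_typeI[OF V']) (auto simp: ne a_ne disj that)
    qed
    ultimately show ?thesis by blast
  next
    case False
    then obtain c' where c': "c' \<in> Q" "c' \<noteq> c" using c by blast
    have P: "P = {b}" 
    proof (rule singleton[OF b])
      show False if "y \<in> P" "y \<noteq> b" for y using no_PQ[OF that c'] .
    qed
    show ?thesis
    proof (cases "\<forall>u\<in>Q. \<forall>v\<in>Q. \<not> E u v")
      case edgeless: True
      have "R = {d}" 
      proof (rule singleton[OF d])
        show False if "y \<in> R" "y \<noteq> d" for y
          using no_QR_co[OF c' that] no_QR[OF c' that] edgeless c c' by blast
      qed
      then have V': "V = Q \<union> {a} \<union> {d, b}" using V P by blast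
      have "clique_type V (co V E)"
        by (rule co_clique_typeI[OF V']) (auto simp: ne a_ne disj edgeless)
      then show ?thesis by simp
    next
      case False
      then have Q: "\<forall>u\<in>Q. \<forall>v\<in>Q. u \<noteq> v \<longrightarrow> E u v" using clique_or_edgeless[of Q] by blast
      have dR: "E d v" if "v \<in> R" "v \<noteq> d" for v using no_QR_co[OF c' that] by blast
      have R: "\<forall>u\<in>R. \<forall>v\<in>R. u \<noteq> v \<longrightarrow> E u v"
        using clique_or_edgeless[of R] dR d by blast
      have V': "V = R \<union> Q \<union> {b, a}" using V P by blast
      have "clique_type V E"
        by (rule clique_typeI[OF V']) (use disj in \<open>auto simp: ne a_ne Q R\<close>)
      then show ?thesis by simp
    qed
  qed
qed

text \<open>By \<open>layer2_split\<close> at both ends, \<open>d\<close> is the only vertex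
  separating two members of \<open>sphere2 a\<close>, and \<open>a\<close> the only one for
  \<open>sphere2 d\<close>. The twin classes of neighbours of \<open>a\<close> and of
  \<open>d\<close> are joined to the whole second spheres around these ends. So a neighbour of
  \<open>d\<close> sees some vertex of \<open>Y\<close>, hence all other neighbours of
  \<open>d\<close>; the same comparison makes \<open>Y\<close> a clique.\<close>

lemma split_layers:
  assumes "twins_on E {x. E a x}" "twins_on E {x. E d x}"
    and "\<not> twins_on E (sphere2 a)" "\<not> twins_on E (sphere2 d)"
  defines "Y \<equiv> {x \<in> V. x \<noteq> a \<and> x \<noteq> d \<and> \<not> E a x \<and> \<not> E d x}"
  shows "\<And>x. E d x \<Longrightarrow> x \<in> sphere2 a" "\<And>y. y \<in> Y \<Longrightarrow> y \<in> sphere2 a"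
    and "\<And>b x. E a b \<Longrightarrow> E d x \<Longrightarrow> E b x" "\<And>b y. E a b \<Longrightarrow> y \<in> Y \<Longrightarrow> E b y"
    and "\<exists>x. E d x" "Y \<noteq> {}"
    and "\<And>x x'. E d x \<Longrightarrow> E d x' \<Longrightarrow> x \<noteq> x' \<Longrightarrow> E x x'"
    and "\<And>y y'. y \<in> Y \<Longrightarrow> y' \<in> Y \<Longrightarrow> y \<noteq> y' \<Longrightarrow> E y y'"
proof -
  interpret rev: far_pair V E d a by (rule far_pair_reverse)
  note split = layer2_split[OF assms(3)] and rsplit = rev.layer2_split[OF assms(4)]
  have dV: "d \<in> V" using far by (rule beyond2_in)
  have ad: "a \<noteq> d" "\<not> E a d" using far by (auto simp: beyond2_def)
  have in_sphere: "x \<in> sphere2 a" if "x \<in> V" "x \<noteq> a" "x \<noteq> d" "\<not> E a x" for x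
    using that layers[OF a_in] split(1) by blast
  have in_rsphere: "x \<in> sphere2 d" if "x \<in> V" "x \<noteq> a" "x \<noteq> d" "\<not> E d x" for x
    using that layers[OF dV] rsplit(1) by blast
  show X2: "x \<in> sphere2 a" if "E d x" for x
    using in_sphere adj_in[OF that] beyond2_not_adj[OF rev.far that] that ad adj_sym adj_irrefl
      by metis
  show Y2: "y \<in> sphere2 a" if "y \<in> Y" for y
    using in_sphere that unfolding Y_def by blast
  have Yr: "y \<in> sphere2 d" if "y \<in> Y" for y
    using in_rsphere that unfolding Y_def by blast
  have full: "E b y" if b: "E a b" and y: "y \<in> sphere2 a" for b y
  proof -
    obtain w where w: "E a w" "E w y" using y by (auto simp: sphere2_def)
    have "y \<noteq> b" "y \<noteq> w" using b w y by (auto simp: sphere2_def)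
    then have "E y w = E y b" using twins_onD[OF assms(1), of w b y] w b by blast
    then show ?thesis using w(2) adj_sym by blast
  qed
  have rfull: "E x y" if x: "E d x" and y: "y \<in> sphere2 d" for x y
  proof -
    obtain w where w: "E d w" "E w y" using y by (auto simp: sphere2_def)
    have "y \<noteq> x" "y \<noteq> w" using x w y by (auto simp: sphere2_def)
    then have "E y w = E y x" using twins_onD[OF assms(2), of w x y] w x by blast
    then show ?thesis using w(2) adj_sym by blast
  qed
  show "E b x" if "E a b" "E d x" for b x using full[OF that(1) X2[OF that(2)]] .
  show "E b y" if "E a b" "y \<in> Y" for b y using full[OF that(1) Y2[OF that(2)]] .
  have xy: "E x y" if "E d x" "y \<in> Y" for x y using rfull[OF that(1) Yr[OF that(2)]] .
  show X: "\<exists>x. E d x" using split(3) adj_sym by blast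
  \<comment> \<open>As \<open>a\<close> separates two members of this sphere, it misses one of them,
    and that one lies in \<open>Y\<close>.\<close>
  obtain y where y: "y \<in> sphere2 d" "\<not> E y a" using rsplit(3) by blast
  have "y \<noteq> a" using y(1) rsplit(1) layers_disjoint(3) by blast
  then have "y \<in> Y" using y sphere2_in[OF y(1)] adj_sym unfolding Y_def sphere2_def by blast
  then show Y: "Y \<noteq> {}" by blast
  show "E x x'" if "E d x" "E d x'" "x \<noteq> x'" for x x'
  proof -
    have "y \<noteq> x" "y \<noteq> x'" "x \<noteq> d" using \<open>y \<in> Y\<close> that unfolding Y_def by auto
    then have "E x x' = E x y"
      using split(2)[OF X2[OF that(2)] Y2[OF \<open>y \<in> Y\<close>], of x] that by blast
    then show ?thesis using xy[OF that(1) \<open>y \<in> Y\<close>] by blast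
  qed
  obtain x where x: "E d x" using X by blast
  show "E y y'" if "y \<in> Y" "y' \<in> Y" "y \<noteq> y'" for y y'
  proof -
    have "x \<noteq> y" "x \<noteq> y'" "y \<noteq> d" using that x unfolding Y_def by auto
    then have "E y y' = E y x"
      using split(2)[OF Y2[OF that(2)] X2[OF x], of y] that by blast
    then show ?thesis using xy[OF x that(1)] adj_sym by blast
  qed
qed

text \<open>A second neighbour \<open>b'\<close> of \<open>a\<close> would make
  \<open>{d, b, y, x}\<close> free in the complement, with \<open>b'\<close> and \<open>a\<close> as
  resolvers.\<close>

lemma split_layers_single:
  assumes "twins_on E {x. E a x}" "twins_on E {x. E d x}"
    and "\<not> twins_on E (sphere2 a)" "\<not> twins_on E (sphere2 d)"
    and "E a b" "E a b'"
  shows "b' = b"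
proof (rule ccontr)
  assume "b' \<noteq> b"
  note s = split_layers[OF assms(1-4)]
  interpret rev: extremal_far_pair V E d a by (rule extremal_far_pair_reverse)
  note r = rev.split_layers[OF assms(2,1,4,3)]
  obtain x y where x: "E d x" and y: "y \<in> V" "y \<noteq> a" "y \<noteq> d" "\<not> E a y" "\<not> E d y" using s(5,6)
    by blast
  then have yr: "y \<in> {x \<in> V. x \<noteq> d \<and> x \<noteq> a \<and> \<not> E d x \<and> \<not> E a x}"
    and ys: "y \<in> {x \<in> V. x \<noteq> a \<and> x \<noteq> d \<and> \<not> E a x \<and> \<not> E d x}" by simp_all
  let ?F = "co V E"
  have ad: "a \<noteq> d" "\<not> E a d" using far by (auto simp: beyond2_def)
  have dV: "d \<in> V" using far by (rule beyond2_in)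
  have nb: "\<not> E d b" "\<not> E d b'" "\<not> E a x"
    using beyond2_not_adj[OF far] beyond2_not_adj[OF rev.far x] assms(5,6) adj_sym by blast+
  have E: "E b x" "E b' x" "E b y" "E b' y" "E b b'" "E x y"
    using s(3)[OF assms(5) x] s(3)[OF assms(6) x] s(4)[OF assms(5) ys] s(4)[OF assms(6) ys]
      r(7)[OF assms(5,6)] \<open>b' \<noteq> b\<close> r(4)[OF x yr] by auto
  then have E': "E x b" "E x b'" "E y b" "E y b'" "E b' b" "E y x" using adj_sym by blast+
  have ne: "distinct [d, b, y, x, a, b']"
    using assms(5,6) x y ad nb E \<open>b' \<noteq> b\<close> by auto
  have in_V: "b \<in> V" "b' \<in> V" "x \<in> V" using adj_in assms(5,6) x by blast+
  have n: "\<not> E b d" "\<not> E b' d" "\<not> E x a" "\<not> E y a" "\<not> E y d" "\<not> E d a" "E b a" "E b' a" "E x d"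
    using nb y ad assms(5,6) x adj_commute by blast+
  note facts = E E' ad nb n y(1,4,5) dV in_V a_in assms(5,6) x
  have new: "b' \<in> V - {d, b, y, x}" "a \<in> V - {d, b, y, x}" using ne in_V a_in by auto
  show False
  proof (rule tightD[OF co_tight, of d b y x])
    show "distinct [d, b, y, x]" "{d, b, y, x} \<subseteq> V" using ne in_V dV y(1) by auto
    have "resolves ?F b' d b" by (rule resolves_adjI) (use ne facts in \<open>auto simp: co_def\<close>)
    then show "\<exists>z\<in>V - {d, b, y, x}. resolves ?F z d b" using new by blast
    have "resolves ?F b' d y" by (rule resolves_adjI) (use ne facts in \<open>auto simp: co_def\<close>)
    then show "\<exists>z\<in>V - {d, b, y, x}. resolves ?F z d y" using new by blast
    have "resolves ?F b' d x" by (rule resolves_adjI) (use ne facts in \<open>auto simp: co_def\<close>)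
    then show "\<exists>z\<in>V - {d, b, y, x}. resolves ?F z d x" using new by blast
    have "resolves ?F a b y" by (rule resolves_adjI) (use ne facts in \<open>auto simp: co_def\<close>)
    then show "\<exists>z\<in>V - {d, b, y, x}. resolves ?F z b y" using new by blast
    have "resolves ?F a b x" by (rule resolves_adjI) (use ne facts in \<open>auto simp: co_def\<close>)
    then show "\<exists>z\<in>V - {d, b, y, x}. resolves ?F z b x" using new by blast
    have "resolves ?F b' y x"
    proof (rule resolves_2I)
      show "?F y b' \<or> (\<exists>w. ?F y w \<and> ?F w b')"
        using ne facts by (auto simp: co_def intro!: exI[of _ d])
      \<comment> \<open>Here \<open>x\<close> and \<open>b'\<close> dominate the graph, so they are
        more than two steps apart in the complement, where \<open>y\<close> reaches
        \<open>b'\<close> through \<open>d\<close>.\<close>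
      have "E x w \<or> E w b' \<or> w = x \<or> w = b'" if "w \<in> V" for w
        using that x adj_sym assms(6) s(3)[OF assms(6)] s(4)[OF assms(6)] s(7)[OF x] r(3)[OF x]
          r(4)[OF x]
        by (cases "w = a \<or> w = d \<or> E a w \<or> E d w") blast+
      then show "\<not> (\<exists>w. ?F x w \<and> ?F w b')" by (auto simp: co_def)
    qed (use ne facts in \<open>auto simp: co_def\<close>)
    then show "\<exists>z\<in>V - {d, b, y, x}. resolves ?F z y x" using new by blast
  qed
qed

text \<open>Once \<open>a\<close> and \<open>d\<close> have the single neighbours \<open>b\<close>
  and \<open>x\<close>, a second vertex \<open>w\<close> of \<open>Y\<close> would make
  \<open>{d, a, x, y}\<close> free in the complement, with \<open>b\<close> and \<open>w\<close> as
  resolvers. So exactly five vertices remain.\<close>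

lemma split_layers_bull:
  assumes "twins_on E {x. E a x}" "twins_on E {x. E d x}"
    and "\<not> twins_on E (sphere2 a)" "\<not> twins_on E (sphere2 d)"
  shows "bull_type V E"
proof -
  note s = split_layers[OF assms(1-4)]
  interpret rev: extremal_far_pair V E d a by (rule extremal_far_pair_reverse)
  note r = rev.split_layers[OF assms(2,1,4,3)]
  obtain b where b: "E a b" using r(5) by blast
  obtain x where x: "E d x" using s(5) by blast
  define Y where "Y = {x \<in> V. x \<noteq> a \<and> x \<noteq> d \<and> \<not> E a x \<and> \<not> E d x}"
  obtain y where y: "y \<in> Y" using s(6) unfolding Y_def by blast
  have B: "w = b" if "E a w" for w using split_layers_single[OF assms(1-4) b that] .
  have X: "w = x" if "E d w" for w using rev.split_layers_single[OF assms(2,1,4,3) x that] .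
  have Ys: "E b w" "E x w" if "w \<in> Y" for w
    using s(4)[OF b, of w] r(4)[OF x, of w] that unfolding Y_def by blast+
  let ?F = "co V E"
  have ad: "a \<noteq> d" "\<not> E a d" using far by (auto simp: beyond2_def)
  have dV: "d \<in> V" using far by (rule beyond2_in)
  have bx: "E b x" using s(3)[OF b x] .
  have nbx: "\<not> E d b" "\<not> E a x"
    using beyond2_not_adj[OF far b] beyond2_not_adj[OF rev.far x] adj_sym by blast+
  have in_V: "b \<in> V" "x \<in> V" using adj_in b x by blast+
  have Y1: "w = y" if w: "w \<in> Y" for w
  proof (rule ccontr)
    assume "w \<noteq> y"
    then have wy: "E w y" using s(8)[of w y] w y unfolding Y_def by blast
    have yw: "y \<in> V" "\<not> E a y" "\<not> E d y" "y \<noteq> a" "y \<noteq> d" "w \<in> V" "\<not> E a w" "\<not> E d w" "w \<noteq> a" "w \<noteq> d"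
      using y w unfolding Y_def by auto
    note E = bx Ys[OF y] Ys[OF w] wy b x
    note E' = E[THEN adj_sym]
    have ne: "distinct [d, a, x, y, b, w]"
      using yw E ad nbx \<open>w \<noteq> y\<close> by auto
    have n: "\<not> E b d" "\<not> E x a" "\<not> E y a" "\<not> E y d" "\<not> E w a" "\<not> E w d" "\<not> E d a"
      using nbx yw ad adj_commute by blast+
    note facts = E E' n yw nbx ad in_V dV a_in
    have new: "w \<in> V - {d, a, x, y}" "b \<in> V - {d, a, x, y}" using ne yw in_V by auto
    show False
    proof (rule tightD[OF co_tight, of d a x y])
      show "distinct [d, a, x, y]" "{d, a, x, y} \<subseteq> V" using ne in_V dV a_in yw(1) by auto
      have "resolves ?F b d a" by (rule resolves_adjI) (use ne facts in \<open>auto simp: co_def\<close>)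
      then show "\<exists>z\<in>V - {d, a, x, y}. resolves ?F z d a" using new by blast
      have "resolves ?F w d x" by (rule resolves_adjI) (use ne facts in \<open>auto simp: co_def\<close>)
      then show "\<exists>z\<in>V - {d, a, x, y}. resolves ?F z d x" using new by blast
      have "resolves ?F w d y" by (rule resolves_adjI) (use ne facts in \<open>auto simp: co_def\<close>)
      then show "\<exists>z\<in>V - {d, a, x, y}. resolves ?F z d y" using new by blast
      have "resolves ?F w a x" by (rule resolves_adjI) (use ne facts in \<open>auto simp: co_def\<close>)
      then show "\<exists>z\<in>V - {d, a, x, y}. resolves ?F z a x" using new by blast
      have "resolves ?F w a y" by (rule resolves_adjI) (use ne facts in \<open>auto simp: co_def\<close>)
      then show "\<exists>z\<in>V - {d, a, x, y}. resolves ?F z a y" using new by blast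
      have "resolves ?F b x y"
      proof (rule resolves_sym, rule resolves_2I)
        show "?F y b \<or> (\<exists>v. ?F y v \<and> ?F v b)"
          using ne facts by (auto simp: co_def intro!: exI[of _ d])
        have "E x v \<or> E v b \<or> v = x \<or> v = b" if "v \<in> V" for v
          using that B[of v] X[of v] Ys[of v] b adj_sym[OF x] unfolding Y_def by blast
        then show "\<not> (\<exists>v. ?F x v \<and> ?F v b)" by (auto simp: co_def)
      qed (use ne facts in \<open>auto simp: co_def\<close>)
      then show "\<exists>z\<in>V - {d, a, x, y}. resolves ?F z x y" using new by blast
    qed
  qed
  have V: "V = {a, b, y, x, d}"
  proof
    show "V \<subseteq> {a, b, y, x, d}" using B X Y1 unfolding Y_def by blast
  qed (use in_V dV a_in y in \<open>simp add: Y_def\<close>)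
  have yY: "\<not> E a y" "\<not> E d y" "y \<noteq> a" "y \<noteq> d" using y unfolding Y_def by auto
  have ne: "distinct [a, b, y, x, d]"
    using b x bx Ys[OF y] yY ad nbx by auto
  have "E b y" "E y x" "E x d" using Ys[OF y] x adj_sym by blast+
  moreover have "\<not> E b d" "\<not> E y d" using nbx yY adj_commute by blast+
  ultimately show ?thesis
    unfolding bull_type_def using V ne b bx yY(1) ad(2) nbx(2)
    by (intro exI[of _ a] exI[of _ b] exI[of _ y] exI[of _ x] exI[of _ d] conjI)
qed

lemma classification:
  "clique_type V E \<or> clique_type V (co V E) \<or> bull_type V E"
proof -
  interpret rev: extremal_far_pair V E d a by (rule extremal_far_pair_reverse)
  show ?thesis
  proof (cases "twins_on E {x. E a x} \<and> twins_on E {x. E d x}")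
    case True
    then have t: "twins_on E {x. E a x}" "twins_on E {x. E d x}" by simp_all
    consider "twins_on E (sphere2 a)" | "twins_on E (sphere2 d)"
      | "\<not> twins_on E (sphere2 a)" "\<not> twins_on E (sphere2 d)" by blast
    then show ?thesis
    proof cases
      case 1
      then show ?thesis using uniform_layers[OF t(1)] by blast
    next
      case 2
      then show ?thesis using rev.uniform_layers[OF t(2)] by blast
    next
      case 3
      then show ?thesis using split_layers_bull[OF t] by simp
    qed
  next
    case False
    then show ?thesis using layer1_split rev.layer1_split
      by (simp only: de_Morgan_conj) (elim disjE; simp)
  qed
qed

end

section \<open>Induced paths and the upper bound\<close>

definition path4 :: "('a \<Rightarrow> 'a \<Rightarrow> bool) \<Rightarrow> 'a \<Rightarrow> 'a \<Rightarrow> 'a \<Rightarrow> 'a \<Rightarrow> bool" where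
  "path4 E a b c d \<longleftrightarrow> distinct [a, b, c, d] \<and> E a b \<and> E b c \<and> E c d \<and> \<not> E a c \<and> \<not> E a d \<and> \<not> E b d"

definition cycle_type :: "'a set \<Rightarrow> ('a \<Rightarrow> 'a \<Rightarrow> bool) \<Rightarrow> bool" where
  "cycle_type V E \<longleftrightarrow> (\<exists>a b c d e. V = {a, b, c, d, e} \<and> distinct [a, b, c, d, e] \<and>
     E a b \<and> E b c \<and> E c d \<and> E d e \<and> E e a \<and> \<not> E a c \<and> \<not> E a d \<and> \<not> E b d \<and> \<not> E b e \<and> \<not> E c e)"

context ugraph
begin

lemma path4_in: "path4 E a b c d \<Longrightarrow> {a, b, c, d} \<subseteq> V"
  unfolding path4_def using adj_in[of a b] adj_in[of c d] by blast

lemma path4_co: "path4 (co V E) a b c d \<Longrightarrow> path4 E b d a c"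
  unfolding path4_def co_def using adj_commute[of d] adj_commute[of b a] by auto

lemma path4I:
  "E a b \<Longrightarrow> E b c \<Longrightarrow> E c d \<Longrightarrow> \<not> E a c \<Longrightarrow> \<not> E a d \<Longrightarrow> \<not> E b d \<Longrightarrow> path4 E a b c d"
  unfolding path4_def using adj_sym[of c d] adj_sym[of b c] by auto

text \<open>A special case of the fact that a graph without an induced path on four vertices is
  disconnected or has a disconnected complement. The neighbour \<open>u\<close> of \<open>v\<close>
  is chosen with the most neighbours among the non-neighbours \<open>M\<close> of \<open>v\<close>.
  If \<open>u'\<close> is a neighbour of \<open>v\<close> that sees a vertex \<open>m\<close> of
  \<open>M\<close> missed by \<open>u\<close>, then by maximality it misses some \<open>m'\<close>
  in \<open>M\<close> seen by \<open>u\<close>. The edges \<open>u u'\<close> and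
  \<open>m m'\<close> decide which four of these vertices form the path.\<close>

lemma path4_of_diameter_2:
  assumes "\<And>u v. u \<in> V \<Longrightarrow> v \<in> V \<Longrightarrow> dist_le E 2 u v"
    and "\<And>u v. u \<in> V \<Longrightarrow> v \<in> V \<Longrightarrow> dist_le (co V E) 2 u v"
    and "v \<in> V" "w \<in> V" "v \<noteq> w"
  shows "\<exists>a b c d. path4 E a b c d"
proof -
  have E2: "\<exists>z. E x z \<and> E z y" if "x \<in> V" "y \<in> V" "x \<noteq> y" "\<not> E x y" for x y
    using assms(1)[OF that(1,2)] that by (auto simp: numeral_2_eq_2)
  have F2: "\<exists>z\<in>V. z \<noteq> x \<and> z \<noteq> y \<and> \<not> E x z \<and> \<not> E z y" if "x \<in> V" "y \<in> V" "x \<noteq> y" "E x y" for x y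
    using assms(2)[OF that(1,2)] that by (auto simp: numeral_2_eq_2 co_def)
  define M where "M = {x \<in> V. x \<noteq> v \<and> \<not> E v x}"
  define f where "f u = card {m \<in> M. E u m}" for u
  have fin: "finite M" using finite_V by (simp add: M_def)
  obtain u0 where "E v u0" using E2[OF assms(3-5)] by blast
  moreover have "\<forall>u. E v u \<longrightarrow> f u < Suc (card M)"
    unfolding f_def using fin by (auto simp: less_Suc_eq_le intro: card_mono)
  ultimately have "\<exists>u. E v u \<and> (\<forall>u'. E v u' \<longrightarrow> f u' \<le> f u)"
    by (rule ex_has_greatest_nat)
  then obtain u where u: "E v u" "\<And>u'. E v u' \<Longrightarrow> f u' \<le> f u" by blast
  have "v \<noteq> u" "u \<in> V" using u(1) adj_in by auto
  \<comment> \<open>The diameter of the complement enters here: the ends of the edge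
    \<open>v u\<close> have a common non-neighbour.\<close>
  then obtain m where "m \<in> V" "m \<noteq> v" "m \<noteq> u" "\<not> E v m" "\<not> E m u"
    using F2[OF assms(3) _ _ u(1)] by blast
  then have m: "m \<in> M" "m \<noteq> u" "\<not> E u m" "m \<in> V" "v \<noteq> m" "\<not> E v m"
    using adj_sym[of u m] by (auto simp: M_def)
  obtain u' where u': "E v u'" "E u' m" using E2[OF assms(3) m(4-6)] by blast
  have "\<not> {x \<in> M. E u x} \<subseteq> {x \<in> M. E u' x}"
  proof
    assume "{x \<in> M. E u x} \<subseteq> {x \<in> M. E u' x}"
    moreover have "m \<in> {x \<in> M. E u' x} - {x \<in> M. E u x}" using m u' by blast
    ultimately have "{x \<in> M. E u x} \<subset> {x \<in> M. E u' x}" by blast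
    then have "f u < f u'" unfolding f_def using fin by (simp add: psubset_card_mono)
    then show False using u(2)[OF u'(1)] by simp
  qed
  then obtain m' where m': "m' \<in> M" "E u m'" "\<not> E u' m'" by blast
  have "\<not> E v m'" using m'(1) by (simp add: M_def)
  then have n: "\<not> E v m" "\<not> E v m'" "\<not> E m v" "\<not> E m' v" "\<not> E m' u'" "\<not> E m u" "E m' u" "E m u'"
    "E u v"
    using m m' u(1) u' adj_sym[of m v] adj_sym[of m' v] adj_sym[of m' u'] adj_sym[of m u]
      adj_sym[of u m'] adj_sym[of u' m] adj_sym[of v u] by fast+
  consider "\<not> E u u'" | "E u u'" "\<not> E m m'" | "E u u'" "E m m'" by blast
  then show ?thesis
  proof cases
    case 1
    then have "path4 E m' u v u'" by (intro path4I) (use n u(1) u' in auto)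
    then show ?thesis by blast
  next
    case 2
    then have "path4 E m u' u m'" by (intro path4I) (use n m' u(1) u' adj_sym[OF 2(1)] in auto)
    then show ?thesis by blast
  next
    case 3
    then have "path4 E v u m' m" by (intro path4I) (use n m m' u(1) u' adj_sym[OF 3(2)] in auto)
    then show ?thesis by blast
  qed
qed

end

locale doubly_connected_ugraph = connected_ugraph +
  assumes co_connected: "connected_on V (co V E)"
begin

lemma doubly_connected_ugraph_co: "doubly_connected_ugraph V (co V E)"
  using ugraph_co connected co_connected
  by (simp add: doubly_connected_ugraph_def doubly_connected_ugraph_axioms_def
      connected_ugraph_def connected_ugraph_axioms_def co_co)

text \<open>If one of the two diameters exceeds two, a geodesic of length three is already the path,
  up to self-complementarity.\<close>

lemma ex_path4:
  assumes "card V \<ge> 2"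
  obtains a b c d where "path4 E a b c d"
proof -
  interpret co: doubly_connected_ugraph V "co V E" by (rule doubly_connected_ugraph_co)
  obtain v w where vw: "v \<in> V" "w \<in> V" "v \<noteq> w"
    using assms by (metis card_le_Suc0_iff_eq finite_V not_less_eq_eq numeral_2_eq_2)
  consider u v where "u \<in> V" "v \<in> V" "\<not> dist_le E 2 u v"
    | u v where "u \<in> V" "v \<in> V" "\<not> dist_le (co V E) 2 u v"
    | "\<And>u v. u \<in> V \<Longrightarrow> v \<in> V \<Longrightarrow> dist_le E 2 u v" "\<And>u v. u \<in> V \<Longrightarrow> v \<in> V \<Longrightarrow> dist_le (co V E) 2 u v"
    by blast
  then show ?thesis
  proof cases
    case 1
    then obtain x b c d where "E x b" "E b c" "E c d" "\<not> E x c" "\<not> E x d" "\<not> E b d"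
      using far_path[OF 1] by metis
    then show ?thesis using that path4I by blast
  next
    case 2
    let ?F = "co V E"
    obtain x b c d where "?F x b" "?F b c" "?F c d" "\<not> ?F x c" "\<not> ?F x d" "\<not> ?F b d"
      using co.far_path[OF 2] by metis
    then show ?thesis using that path4_co[OF co.path4I] by blast
  next
    case 3
    then show ?thesis using path4_of_diameter_2[OF 3 vw] that by blast
  qed
qed

text \<open>If \<open>a\<close> and \<open>d\<close> are far apart, \<open>a\<close> resolves
  \<open>{b, c, d}\<close> by distance. Otherwise they have a common neighbour \<open>x\<close>, and
  in \<open>{c, d, x}\<close> the vertex \<open>a\<close> separates \<open>x\<close> from the rest
  and \<open>b\<close> separates \<open>c\<close> from \<open>d\<close>.\<close>

lemma ex_free_triple:
  assumes "card V \<ge> 2"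
  obtains W where "free_set V E W" "card W = 3"
proof -
  obtain a b c d where p: "path4 E a b c d" using ex_path4[OF assms] .
  then have E: "E a b" "E b c" "E c d" "\<not> E a c" "\<not> E a d" "\<not> E b d"
    and dist: "distinct [a, b, c, d]"
    by (auto simp: path4_def)
  have V: "a \<in> V" "b \<in> V" "c \<in> V" "d \<in> V" using path4_in[OF p] by auto
  have triple: thesis
    if "{p, q, r} \<subseteq> V" "distinct [p, q, r]" "\<exists>x\<in>V - {p, q, r}. resolves E x p q"
      "\<exists>x\<in>V - {p, q, r}. resolves E x p r" "\<exists>x\<in>V - {p, q, r}. resolves E x q r" for p q r
  proof (rule \<open>\<And>W. free_set V E W \<Longrightarrow> card W = 3 \<Longrightarrow> thesis\<close>)
    have all_pairs: "R u v" if "\<And>u v. R u v \<Longrightarrow> R v u" "R p q" "R p r" "R q r"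
      "u \<in> {p, q, r}" "v \<in> {p, q, r}" "u \<noteq> v" for R :: "'a \<Rightarrow> 'a \<Rightarrow> bool" and u v
      using that by auto
    have *: "\<exists>x\<in>V - {p, q, r}. resolves E x u v"
      if "u \<in> {p, q, r}" "v \<in> {p, q, r}" "u \<noteq> v" for u v
      by (rule all_pairs[OF _ \<open>\<exists>x\<in>V - {p, q, r}. resolves E x p q\<close>
            \<open>\<exists>x\<in>V - {p, q, r}. resolves E x p r\<close> \<open>\<exists>x\<in>V - {p, q, r}. resolves E x q r\<close> that])
        (meson resolves_sym)
    show "free_set V E {p, q, r}"
      unfolding free_set_def using \<open>{p, q, r} \<subseteq> V\<close> * by (intro conjI ballI impI) assumption+
    show "card {p, q, r} = 3" using \<open>distinct [p, q, r]\<close> by simp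
  qed
  show thesis
  proof (cases "dist_le E 2 a d")
    case False
    have c2: "c \<in> sphere2 a" unfolding sphere2_def using E dist by auto
    have d3: "d \<in> beyond2 a" using False beyond2_iff V by blast
    have new: "a \<in> V - {b, c, d}" using V dist by auto
    show thesis
    proof (rule triple[of b c d])
      show "\<exists>x\<in>V - {b, c, d}. resolves E x b c" using new resolves_layers(1)[OF E(1) c2] by blast
      show "\<exists>x\<in>V - {b, c, d}. resolves E x b d" using new resolves_layers(2)[OF E(1) d3] by blast
      show "\<exists>x\<in>V - {b, c, d}. resolves E x c d" using new resolves_layers(3)[OF c2 d3] by blast
    qed (use V dist in auto)
  next
    case True
    then obtain x where x: "E a x" "E x d" using E dist by (auto simp: numeral_2_eq_2)
    have xne: "x \<noteq> a" "x \<noteq> b" "x \<noteq> c" "x \<noteq> d" using x E by auto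
    have xV: "x \<in> V" using adj_in x by blast
    have E': "\<not> E c a" "\<not> E d a" "\<not> E d b" "E c b" "E x a"
      using x E adj_sym[of c a] adj_sym[of d a] adj_sym[of d b] adj_sym[of b c] adj_sym[of a x]
      by blast+
    have new: "a \<in> V - {c, d, x}" "b \<in> V - {c, d, x}" using V dist xne by auto
    have "resolves E b c d" "resolves E a c x" "resolves E a d x"
      using E' dist xne by (auto intro!: resolves_adjI)
    then show thesis
      using new V xV dist xne by (intro triple[of c d x]) (blast | simp)+
  qed
qed

end

text \<open>Two outside vertices produce four adjacency patterns, and four vertices showing all of
  them form a free quadruple. Complementation only permutes the patterns.\<close>

lemma tight_adj:
  assumes "tight V E" "distinct [x, y, p, q, r, s]" "{x, y, p, q, r, s} \<subseteq> V"
  shows "\<not> distinct [(E p x, E p y), (E q x, E q y), (E r x, E r y), (E s x, E s y)]"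
proof
  assume d: "distinct [(E p x, E p y), (E q x, E q y), (E r x, E r y), (E s x, E s y)]"
  have new: "x \<in> V - {p, q, r, s}" "y \<in> V - {p, q, r, s}" using assms(2,3) by auto
  have *: "\<exists>z\<in>V - {p, q, r, s}. resolves E z u v"
    if "(E u x, E u y) \<noteq> (E v x, E v y)" "u \<in> {p, q, r, s}" "v \<in> {p, q, r, s}" for u v
  proof -
    have "x \<noteq> u" "x \<noteq> v" "y \<noteq> u" "y \<noteq> v" using that(2,3) new by blast+
    then have "resolves E x u v \<or> resolves E y u v" using that(1) by (auto intro: resolves_adjI)
    then show ?thesis using new by blast
  qed
  show False
  proof (rule tightD[OF assms(1), of p q r s])
    show "distinct [p, q, r, s]" "{p, q, r, s} \<subseteq> V" using assms(2,3) by simp_all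
    show "\<exists>z\<in>V - {p, q, r, s}. resolves E z p q" by (rule *) (use d in simp_all)
    show "\<exists>z\<in>V - {p, q, r, s}. resolves E z p r" by (rule *) (use d in simp_all)
    show "\<exists>z\<in>V - {p, q, r, s}. resolves E z p s" by (rule *) (use d in simp_all)
    show "\<exists>z\<in>V - {p, q, r, s}. resolves E z q r" by (rule *) (use d in simp_all)
    show "\<exists>z\<in>V - {p, q, r, s}. resolves E z q s" by (rule *) (use d in simp_all)
    show "\<exists>z\<in>V - {p, q, r, s}. resolves E z r s" by (rule *) (use d in simp_all)
  qed
qed

section \<open>Graphs without a free quadruple\<close>

context ugraph
begin

text \<open>With two vertices of the pentagon as resolvers, \<open>tight_adj\<close> says that a
  further vertex \<open>y\<close> does not see both ends of an edge and does not miss both vertices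
  of a non-adjacent pair. This would divide the pentagon into an independent set and a clique, but
  each has at most two vertices.\<close>

lemma tight_cycle:
  assumes "tight V E" "path4 E a b c d" "E a x" "E x d" "\<not> E x b" "\<not> E x c"
  shows "cycle_type V E"
proof (cases "V = {a, b, c, d, x}")
  case True
  have "distinct [a, b, c, d, x]" using assms(2-6) by (auto simp: path4_def)
  then show ?thesis unfolding cycle_type_def
    using assms True adj_sym[of a x] adj_sym[of x d] adj_sym[of b x] adj_sym[of c x]
    by (intro exI[of _ a] exI[of _ b] exI[of _ c] exI[of _ d] exI[of _ x])
      (simp add: path4_def, blast)
next
  case False
  have V: "{a, b, c, d, x} \<subseteq> V" using path4_in[OF assms(2)] adj_in[OF assms(3)] by simp
  then obtain y where y: "y \<in> V" "y \<notin> {a, b, c, d, x}" using False by blast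
  have E: "E a b" "E b c" "E c d" "\<not> E a c" "\<not> E a d" "\<not> E b d" "distinct [a, b, c, d, x]"
    using assms(2-6) by (auto simp: path4_def)
  then have dist: "distinct [a, b, c, d, x, y]" and V': "{a, b, c, d, x, y} \<subseteq> V" using y V by auto
  have sym: "E b a" "E c b" "E d c" "\<not> E c a" "\<not> E d a" "\<not> E d b" "E x a" "E d x" "\<not> E b x"
    "\<not> E c x"
    using E assms(3-6) adj_sym by metis+
  have t: "\<not> distinct [(E r p, E r q), (E s p, E s q), (E t p, E t q), (E u p, E u q)]"
    if "distinct [p, q, r, s, t, u]" "{p, q, r, s, t, u} \<subseteq> V" for p q r s t u
    by (rule tight_adj[OF assms(1) that])
  \<comment> \<open>The resolving pairs, listed first, are the edges \<open>a b\<close>,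
    \<open>a x\<close>, \<open>c d\<close> and the non-edges \<open>a c\<close>, \<open>a d\<close>,
    \<open>b x\<close> of the pentagon; these six already exclude every choice of neighbours of
    \<open>y\<close>.\<close>
  have d: "distinct [a, b, c, d, x, y]" "distinct [a, c, b, d, x, y]"
    "distinct [a, d, b, c, x, y]" "distinct [a, x, b, c, d, y]" "distinct [b, x, a, c, d, y]"
    "distinct [c, d, a, b, x, y]"
    using dist by auto
  have v: "{a, b, c, d, x, y} \<subseteq> V" "{a, c, b, d, x, y} \<subseteq> V" "{a, d, b, c, x, y} \<subseteq> V"
    "{a, x, b, c, d, y} \<subseteq> V" "{b, x, a, c, d, y} \<subseteq> V" "{c, d, a, b, x, y} \<subseteq> V"
    using V' by auto
  have "False"
    using t[OF d(1) v(1)] t[OF d(2) v(2)] t[OF d(3) v(3)] t[OF d(4) v(4)] t[OF d(5) v(5)] t[OF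
      d(6) v(6)]
    by (cases "E y a"; cases "E y b"; cases "E y c"; cases "E y d"; cases "E y x")
      (simp_all add: E sym assms(3-6))
  then show ?thesis ..
qed

text \<open>A common neighbour \<open>x\<close> of \<open>a\<close> and \<open>d\<close> sees
  \<open>b\<close> or \<open>c\<close>, since otherwise it closes the path to an induced pentagon.
  For the same reason a common non-neighbour \<open>y\<close> of \<open>b\<close> and
  \<open>c\<close> misses \<open>a\<close> or \<open>d\<close>.\<close>

lemma tight_diameter_2:
  assumes "tight V E" "path4 E a b c d" "dist_le E 2 a d" "dist_le (co V E) 2 b c"
  shows "cycle_type V E"
proof (rule ccontr)
  assume no: "\<not> cycle_type V E"
  have E: "E a b" "E b c" "E c d" "\<not> E a c" "\<not> E a d" "\<not> E b d" and dist4: "distinct [a, b, c, d]"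
    using assms(2) by (auto simp: path4_def)
  obtain x where x: "E a x" "E x d" using assms(3) E dist4 by (auto simp: numeral_2_eq_2)
  obtain y where y: "y \<in> V" "y \<noteq> b" "y \<noteq> c" "\<not> E b y" "\<not> E y c"
    using assms(4) E dist4 by (auto simp: numeral_2_eq_2 co_def)
  have xbc: "E x b \<or> E x c" using tight_cycle[OF assms(1,2) x] no by blast
  have yad: "\<not> (E y a \<and> E y d)"
    using tight_cycle[OF assms(1,2), of y] no y(4,5) adj_sym[of y a] adj_sym[of y b] by blast
  have V: "{a, b, c, d} \<subseteq> V" "x \<in> V" using path4_in[OF assms(2)] adj_in[OF x(1)] by auto
  have "x \<noteq> y" using xbc y(4,5) adj_sym[of x b] by auto
  moreover have "x \<notin> {a, b, c, d}" "y \<notin> {a, b, c, d}" using x y E adj_sym[of a b] adj_sym[of c d]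
    by auto
  ultimately have dist: "distinct [a, b, c, d, x, y]" and V': "{a, b, c, d, x, y} \<subseteq> V"
    using V dist4 y(1) by auto
  have sym: "E b a" "E c b" "E d c" "\<not> E c a" "\<not> E d a" "\<not> E d b" "E x a" "E d x" "\<not> E y b"
    "\<not> E c y"
    using E x y(4,5) adj_sym by metis+
  have t: "\<not> distinct [(E r p, E r q), (E s p, E s q), (E t p, E t q), (E u p, E u q)]"
    if "distinct [p, q, r, s, t, u]" "{p, q, r, s, t, u} \<subseteq> V" for p q r s t u
    by (rule tight_adj[OF assms(1) that])
  have d: "distinct [a, b, c, d, x, y]" "distinct [a, c, b, d, x, y]"
    "distinct [a, d, b, c, x, y]" "distinct [b, d, a, c, x, y]" "distinct [c, d, a, b, x, y]"
    using dist by auto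
  have v: "{a, b, c, d, x, y} \<subseteq> V" "{a, c, b, d, x, y} \<subseteq> V" "{a, d, b, c, x, y} \<subseteq> V"
    "{b, d, a, c, x, y} \<subseteq> V" "{c, d, a, b, x, y} \<subseteq> V"
    using V' by auto
  \<comment> \<open>The five instances forbid \<open>E x b\<close> together with
    \<open>E y a\<close>, and \<open>E x c\<close> together with \<open>E y d\<close>. They require
    \<open>E x c\<close> or \<open>E y a\<close>, \<open>E x b\<close> or \<open>E y d\<close>, and
    \<open>E y a\<close> or \<open>E y d\<close>. With \<open>xbc\<close> and \<open>yad\<close> no
    assignment is left.\<close>
  show False
    using t[OF d(1) v(1)] t[OF d(2) v(2)] t[OF d(3) v(3)] t[OF d(4) v(4)] t[OF d(5) v(5)] xbc yad
    by (cases "E y a"; cases "E y d"; cases "E x b"; cases "E x c")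
      (simp_all add: E sym x y(4,5))
qed

end

lemma far_pair_classification:
  assumes "doubly_connected_ugraph V E" "tight V E" "tight V (co V E)"
    and "u \<in> V" "v \<in> V" "\<not> dist_le E 2 u v"
  shows "clique_type V E \<or> clique_type V (co V E) \<or> bull_type V E"
proof -
  interpret doubly_connected_ugraph V E by fact
  interpret extremal_far_pair V E u v
    by unfold_locales (use assms beyond2_iff in simp_all)
  show ?thesis by (rule classification)
qed

text \<open>In the complement the same path has the ends \<open>b\<close> and \<open>c\<close>, so a
  missing common non-neighbour of these is the far case of the complement.\<close>

lemma (in doubly_connected_ugraph) tight_classification:
  assumes "card V \<ge> 2" "tight V E" "tight V (co V E)"
  shows "clique_type V E \<or> clique_type V (co V E) \<or> cycle_type V E \<or> bull_type V E \<or>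
    bull_type V (co V E)"
proof -
  interpret co: doubly_connected_ugraph V "co V E" by (rule doubly_connected_ugraph_co)
  obtain a b c d where p: "path4 E a b c d" using ex_path4[OF assms(1)] .
  then have V: "a \<in> V" "b \<in> V" "c \<in> V" "d \<in> V" using path4_in by auto
  show ?thesis
  proof (cases "dist_le E 2 a d \<and> dist_le (co V E) 2 b c")
    case True
    then show ?thesis using tight_diameter_2[OF assms(2) p] by simp
  next
    case False
    then consider "\<not> dist_le E 2 a d" | "\<not> dist_le (co V E) 2 b c" by blast
    then show ?thesis
    proof cases
      case 1
      show ?thesis using far_pair_classification[OF doubly_connected_ugraph_axioms assms(2,3)
        V(1,4) 1] by blast
    next
      case 2
      show ?thesis
        using far_pair_classification[OF doubly_connected_ugraph_co assms(3) _ V(2,3) 2] assms(2)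
          by (simp add: co_co) blast
    qed
  qed
qed

section \<open>The extremal graphs have no free quadruple\<close>

lemma twins_not_resolves:
  assumes "\<And>z. z \<noteq> u \<Longrightarrow> z \<noteq> v \<Longrightarrow> E u z = E v z" "x \<noteq> u" "x \<noteq> v"
  shows "\<not> resolves E x u v"
proof -
  have "dist_le E k v x" if "dist_le E k u x" "x \<noteq> u" "x \<noteq> v"
    "\<And>z. z \<noteq> u \<Longrightarrow> z \<noteq> v \<Longrightarrow> E u z = E v z" for k and u v :: 'a
    using that
  proof (induction k)
    case (Suc k)
    show ?case
    proof (cases "dist_le E k u x")
      case True
      then show ?thesis using Suc.IH Suc.prems by simp
    next
      case False
      then obtain y where y: "E u y" "dist_le E k y x" using Suc.prems(1) by auto
      \<comment> \<open>A first step from \<open>u\<close> to its twin \<open>v\<close> leaves a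
        shorter walk from \<open>v\<close>; any other first step can be copied by the twin.\<close>
      show ?thesis
      proof (cases "y = u \<or> y = v")
        case True
        then show ?thesis using y(2) False by auto
      next
        case False
        then show ?thesis using Suc.prems(4)[of y] y by auto
      qed
    qed
  qed simp
  from this[of _ u v] this[of _ v u] show ?thesis
    using assms unfolding resolves_def by metis
qed

lemma adj_not_resolves:
  assumes "x \<noteq> u" "x \<noteq> v" "E u x" "E v x"
  shows "\<not> resolves E x u v"
proof -
  have "dist_le E k w x \<longleftrightarrow> k \<noteq> 0" if "E w x" "w \<noteq> x" for k w
    using that by (cases k) auto
  then show ?thesis unfolding resolves_def using assms by metis
qed

lemma distance_2_not_resolves:
  assumes "x \<noteq> u" "x \<noteq> v" "\<not> E u x" "\<not> E v x" "E u w" "E w x" "E v w'" "E w' x"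
  shows "\<not> resolves E x u v"
proof -
  have "dist_le E k z x \<longleftrightarrow> k \<ge> 2" if "E z y" "E y x" "z \<noteq> x" "\<not> E z x" for k z y
  proof
    assume "dist_le E k z x"
    moreover have "\<not> dist_le E (Suc 0) z x" using that by simp
    ultimately show "k \<ge> 2" using dist_le_mono[of E k z x "Suc 0"] by force
  next
    assume "k \<ge> 2"
    moreover have "dist_le E 2 z x" using that by (auto simp: numeral_2_eq_2)
    ultimately show "dist_le E k z x" using dist_le_mono by metis
  qed
  then show ?thesis unfolding resolves_def using assms by metis
qed

text \<open>A free quadruple has at most one vertex in each of \<open>A\<close> and
  \<open>B\<close>, so it contains \<open>c\<close> and \<open>d\<close>. A resolver for its
  remaining two vertices must then lie in \<open>A \<union> B\<close>, where there is none.\<close>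

lemma tightI_partition:
  assumes "V = A \<union> B \<union> {c, d}" "finite V"
    and "\<And>u v x. u \<in> A \<Longrightarrow> v \<in> A \<Longrightarrow> x \<noteq> u \<Longrightarrow> x \<noteq> v \<Longrightarrow> \<not> resolves E x u v"
    and "\<And>u v x. u \<in> B \<Longrightarrow> v \<in> B \<Longrightarrow> x \<noteq> u \<Longrightarrow> x \<noteq> v \<Longrightarrow> \<not> resolves E x u v"
    and "\<And>u v x. u \<in> A \<Longrightarrow> v \<in> B \<Longrightarrow> x \<in> A \<union> B \<Longrightarrow> x \<noteq> u \<Longrightarrow> x \<noteq> v \<Longrightarrow> \<not> resolves E x u v"
  shows "tight V E"
  unfolding tight_def
proof (intro allI impI notI)
  fix W assume W: "free_set V E W" "card W = 4"
  have fin: "finite W" using W(2) by (metis card.infinite zero_neq_numeral)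
  have res: "\<exists>x\<in>V - W. resolves E x u v" if "u \<in> W" "v \<in> W" "u \<noteq> v" for u v
    using that W(1) by (simp add: free_set_def)
  have le_1: "card (W \<inter> S) \<le> 1"
    if S: "\<And>u v x. u \<in> S \<Longrightarrow> v \<in> S \<Longrightarrow> x \<noteq> u \<Longrightarrow> x \<noteq> v \<Longrightarrow> \<not> resolves E x u v" for S
  proof -
    have "u = v" if uv: "u \<in> W \<inter> S" "v \<in> W \<inter> S" for u v
    proof (rule ccontr)
      assume "u \<noteq> v"
      then obtain x where "x \<in> V - W" "resolves E x u v" using res uv by blast
      moreover then have "x \<noteq> u" "x \<noteq> v" using uv by blast+
      ultimately show False using S uv by blast
    qed
    then show ?thesis using fin card_le_Suc0_iff_eq[of "W \<inter> S"] by simp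
  qed
  have "card (W \<inter> A) \<le> 1" using assms(3) by (rule le_1)
  moreover have "card (W \<inter> B) \<le> 1" using assms(4) by (rule le_1)
  moreover have "card (W \<inter> {c, d}) \<le> 2"
  proof -
    have "card (W \<inter> {c, d}) \<le> card {c, d}" by (rule card_mono) auto
    also have "\<dots> \<le> 2" by (simp add: card_insert_if)
    finally show ?thesis .
  qed
  moreover have "W = (W \<inter> A) \<union> ((W \<inter> B) \<union> (W \<inter> {c, d}))"
    using W(1) assms(1) by (auto simp: free_set_def)
  then have "card W \<le> card (W \<inter> A) + card ((W \<inter> B) \<union> (W \<inter> {c, d}))"
    by (metis card_Un_le)
  moreover have "card ((W \<inter> B) \<union> (W \<inter> {c, d})) \<le> card (W \<inter> B) + card (W \<inter> {c, d})"
    by (rule card_Un_le)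
  ultimately have cards: "card (W \<inter> A) = 1" "card (W \<inter> B) = 1" "card (W \<inter> {c, d}) = 2"
    using W(2) by linarith+
  have "c \<in> W" "d \<in> W"
  proof -
    have "card {c, d} \<le> 2" by (simp add: card_insert_if)
    then have "W \<inter> {c, d} = {c, d}" using cards(3) by (intro card_seteq) auto
    then show "c \<in> W" "d \<in> W" by blast+
  qed
  obtain u v where uv: "u \<in> W" "u \<in> A" "v \<in> W" "v \<in> B"
    using cards(1,2) by (metis Int_iff card_1_singletonE insertI1)
  show False
  \<comment> \<open>The sets \<open>A\<close> and \<open>B\<close> may overlap here; a common vertex
    leaves too few elements for a quadruple.\<close>
  proof (cases "u = v")
    case True
    then have "W \<inter> A = {u}" "W \<inter> B = {u}"
      using uv cards(1,2) by (metis IntI card_1_singletonE singletonD)+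
    then have "W = {u, c, d}" using \<open>W = (W \<inter> A) \<union> ((W \<inter> B) \<union> (W \<inter> {c, d}))\<close> \<open>c \<in> W\<close> \<open>d \<in> W\<close>
      by blast
    moreover have "card {u, c, d} \<le> 3" by (simp add: card_insert_if)
    ultimately show False using W(2) by simp
  next
    case False
    then obtain x where "x \<in> V - W" "resolves E x u v" using res uv by blast
    moreover then have "x \<in> A \<union> B" "x \<noteq> u" "x \<noteq> v" using assms(1) \<open>c \<in> W\<close> \<open>d \<in> W\<close> uv by auto
    ultimately show False using assms(5) uv by blast
  qed
qed

text \<open>Each part consists of twins, in the graph and in the complement. Distinct vertices of
  \<open>A \<union> B\<close> are all at distance one in the graph. In the complement they are all
  at distance two, through the common neighbour \<open>d\<close>.\<close>

lemma (in ugraph) clique_type_tight: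
  assumes "clique_type V E"
  shows "tight V E" "tight V (co V E)"
proof -
  from assms obtain A B c d where V: "V = A \<union> B \<union> {c, d}" and disj: "A \<inter> B = {}" "c \<notin> A \<union> B"
    "d \<notin> A \<union> B"
    "c \<noteq> d" and ne: "A \<noteq> {}" "B \<noteq> {}" and adj: "\<forall>u\<in>A \<union> B. \<forall>v\<in>A \<union> B. u \<noteq> v \<longrightarrow> E u v"
      "\<forall>u\<in>A. \<not> E u c \<and> \<not> E u d" "\<forall>u\<in>B. E u c \<and> \<not> E u d"
    and cd: "E c d"
    unfolding clique_type_def by (elim exE conjE)
  note clique = adj(1)[rule_format] and A = adj(2)[rule_format] and B = adj(3)[rule_format]
  have twins: "E u z = E v z" if "u \<in> A \<and> v \<in> A \<or> u \<in> B \<and> v \<in> B" "z \<noteq> u" "z \<noteq> v" for u v z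
  proof (cases "z \<in> V")
    case True
    then consider "z \<in> A \<union> B" | "z = c" | "z = d" using V by blast
    then show ?thesis
    proof cases
      case 1
      then show ?thesis using clique[of u z] clique[of v z] that by blast
    qed (use A B that in blast)+
  qed (use adj_in in blast)
  have co_twins: "co V E u z = co V E v z" if "u \<in> A \<and> v \<in> A \<or> u \<in> B \<and> v \<in> B" "z \<noteq> u" "z \<noteq> v"
    for u v z
    using twins[OF that] that V by (auto simp: co_def)
  show "tight V E"
  proof (rule tightI_partition[OF V finite_V])
    show "\<not> resolves E x u v" if "u \<in> A" "v \<in> A" "x \<noteq> u" "x \<noteq> v" for u v x
      by (rule twins_not_resolves) (use twins that in auto)
    show "\<not> resolves E x u v" if "u \<in> B" "v \<in> B" "x \<noteq> u" "x \<noteq> v" for u v x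
      by (rule twins_not_resolves) (use twins that in auto)
    show "\<not> resolves E x u v" if "u \<in> A" "v \<in> B" "x \<in> A \<union> B" "x \<noteq> u" "x \<noteq> v" for u v x
      by (rule adj_not_resolves) (use clique that in auto)
  qed
  show "tight V (co V E)"
  proof (rule tightI_partition[OF V finite_V])
    show "\<not> resolves (co V E) x u v" if "u \<in> A" "v \<in> A" "x \<noteq> u" "x \<noteq> v" for u v x
      by (rule twins_not_resolves) (use co_twins that in auto)
    show "\<not> resolves (co V E) x u v" if "u \<in> B" "v \<in> B" "x \<noteq> u" "x \<noteq> v" for u v x
      by (rule twins_not_resolves) (use co_twins that in auto)
    show "\<not> resolves (co V E) x u v" if "u \<in> A" "v \<in> B" "x \<in> A \<union> B" "x \<noteq> u" "x \<noteq> v" for u v x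
    proof -
      have d: "co V E w d" "co V E d w" if "w \<in> A \<union> B" for w
        using that A B V disj adj_sym[of d w] by (auto simp: co_def)
      show ?thesis
        by (rule distance_2_not_resolves[where w = d and w' = d])
          (use clique[of u x] clique[of v x] that d in \<open>auto simp: co_def\<close>)
    qed
  qed
qed

text \<open>On five vertices a quadruple leaves a single vertex outside, which would have to resolve
  all pairs by itself.\<close>

lemma tightI_5:
  assumes "card V = 5" "\<And>x. x \<in> V \<Longrightarrow> \<exists>u\<in>V - {x}. \<exists>v\<in>V - {x}. u \<noteq> v \<and> \<not> resolves E x u v"
  shows "tight V E"
  unfolding tight_def
proof (intro allI impI notI)
  fix W assume W: "free_set V E W" "card W = 4"
  have sub: "W \<subseteq> V" "finite V" using W(1) assms(1)
    by (auto simp: free_set_def intro: card_ge_0_finite)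
  then have "card (V - W) = 1" using assms(1) W(2) by (simp add: card_Diff_subset finite_subset)
  then obtain x where x: "V - W = {x}" by (rule card_1_singletonE)
  then have "W = V - {x}" "x \<in> V" using sub by blast+
  then show False using assms(2)[of x] W(1) x unfolding free_set_def by auto
qed

lemma (in ugraph) bull_type_tight:
  assumes "bull_type V E"
  shows "tight V E"
proof -
  from assms obtain a b y x d where V: "V = {a, b, y, x, d}" and dist: "distinct [a, b, y, x, d]"
    and E: "E a b" "E b y" "E b x" "E y x" "E x d" "\<not> E a y" "\<not> E a x" "\<not> E a d" "\<not> E b d" "\<not> E y d"
    unfolding bull_type_def by metis
  have E': "E b a" "E y b" "E x b" "E x y" "E d x" "\<not> E y a" "\<not> E x a" "\<not> E d a" "\<not> E d b" "\<not> E d y"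
    using E adj_sym by metis+
  show ?thesis
  proof (rule tightI_5)
    show "card V = 5" using V dist by simp
    have "\<not> resolves E a y x"
      by (rule distance_2_not_resolves[where w = b and w' = b]) (use E E' dist in auto)
    moreover have "\<not> resolves E b a y" "\<not> resolves E y b x" "\<not> resolves E x b y"
      by (rule adj_not_resolves; use E E' dist in auto)+
    moreover have "\<not> resolves E d b y"
      by (rule distance_2_not_resolves[where w = x and w' = x]) (use E E' dist in auto)
    ultimately have res: "\<not> resolves E a y x" "\<not> resolves E b a y" "\<not> resolves E y b x"
      "\<not> resolves E x b y" "\<not> resolves E d b y" by simp_all
    have pair: "\<exists>u\<in>V - {z}. \<exists>v\<in>V - {z}. u \<noteq> v \<and> \<not> resolves E z u v"
      if "\<not> resolves E z u v" "{z, u, v} \<subseteq> V" "distinct [z, u, v]" for z u v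
      using that by auto
    fix z assume "z \<in> V"
    then consider "z = a" | "z = b" | "z = y" | "z = x" | "z = d" using V by blast
    then show "\<exists>u\<in>V - {z}. \<exists>v\<in>V - {z}. u \<noteq> v \<and> \<not> resolves E z u v"
    proof cases
      case 1
      show ?thesis unfolding \<open>z = a\<close> by (rule pair[OF res(1)]) (use V dist in auto)
    next
      case 2
      show ?thesis unfolding \<open>z = b\<close> by (rule pair[OF res(2)]) (use V dist in auto)
    next
      case 3
      show ?thesis unfolding \<open>z = y\<close> by (rule pair[OF res(3)]) (use V dist in auto)
    next
      case 4
      show ?thesis unfolding \<open>z = x\<close> by (rule pair[OF res(4)]) (use V dist in auto)
    next
      case 5
      show ?thesis unfolding \<open>z = d\<close> by (rule pair[OF res(5)]) (use V dist in auto)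
    qed
  qed
qed

text \<open>Complementation turns the path \<open>a b x d\<close> into \<open>x a d b\<close> and
  keeps \<open>y\<close> as the apex over the middle edge.\<close>

lemma (in ugraph) bull_type_co:
  assumes "bull_type V E"
  shows "bull_type V (co V E)"
proof -
  from assms obtain a b y x d where V: "V = {a, b, y, x, d}" and dist: "distinct [a, b, y, x, d]"
    and E: "E a b" "E b y" "E b x" "E y x" "E x d" "\<not> E a y" "\<not> E a x" "\<not> E a d" "\<not> E b d" "\<not> E y d"
    unfolding bull_type_def by metis
  have E': "E b a" "E y b" "E x b" "E x y" "E d x" "\<not> E y a" "\<not> E x a" "\<not> E d a" "\<not> E d b" "\<not> E d y"
    using E adj_sym by metis+
  have V': "V = {x, a, y, d, b}" using V by blast
  show ?thesis unfolding bull_type_def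
    by (intro exI[of _ x] exI[of _ a] exI[of _ y] exI[of _ d] exI[of _ b] conjI, rule V')
      (use V' dist E E' in \<open>auto simp: co_def\<close>)
qed

lemma (in ugraph) cycle_type_tight:
  assumes "cycle_type V E"
  shows "tight V E"
proof -
  from assms obtain a b c d e where V: "V = {a, b, c, d, e}" and dist: "distinct [a, b, c, d, e]"
    and E: "E a b" "E b c" "E c d" "E d e" "E e a"
    unfolding cycle_type_def by metis
  have E': "E b a" "E c b" "E d c" "E e d" "E a e" using E adj_sym by metis+
  show ?thesis
  proof (rule tightI_5)
    show "card V = 5" using V dist by simp
    have "\<not> resolves E a b e" "\<not> resolves E b a c" "\<not> resolves E c b d" "\<not> resolves E d c e"
      "\<not> resolves E e d a"
      by (rule adj_not_resolves; use E E' dist in auto)+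
    note res = this
    have pair: "\<exists>u\<in>V - {z}. \<exists>v\<in>V - {z}. u \<noteq> v \<and> \<not> resolves E z u v"
      if "\<not> resolves E z u v" "{z, u, v} \<subseteq> V" "distinct [z, u, v]" for z u v
      using that by auto
    fix z assume "z \<in> V"
    then consider "z = a" | "z = b" | "z = c" | "z = d" | "z = e" using V by blast
    then show "\<exists>u\<in>V - {z}. \<exists>v\<in>V - {z}. u \<noteq> v \<and> \<not> resolves E z u v"
    proof cases
      case 1
      show ?thesis unfolding \<open>z = a\<close> by (rule pair[OF res(1)]) (use V dist in auto)
    next
      case 2
      show ?thesis unfolding \<open>z = b\<close> by (rule pair[OF res(2)]) (use V dist in auto)
    next
      case 3
      show ?thesis unfolding \<open>z = c\<close> by (rule pair[OF res(3)]) (use V dist in auto)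
    next
      case 4
      show ?thesis unfolding \<open>z = d\<close> by (rule pair[OF res(4)]) (use V dist in auto)
    next
      case 5
      show ?thesis unfolding \<open>z = e\<close> by (rule pair[OF res(5)]) (use V dist in auto)
    qed
  qed
qed

lemma (in ugraph) cycle_type_co:
  assumes "cycle_type V E"
  shows "cycle_type V (co V E)"
proof -
  from assms obtain a b c d e where V: "V = {a, b, c, d, e}" and dist: "distinct [a, b, c, d, e]"
    and E: "E a b" "E b c" "E c d" "E d e" "E e a" "\<not> E a c" "\<not> E a d" "\<not> E b d" "\<not> E b e" "\<not> E c e"
    unfolding cycle_type_def by metis
  have E': "E b a" "E c b" "E d c" "E e d" "E a e" "\<not> E c a" "\<not> E d a" "\<not> E d b" "\<not> E e b" "\<not> E e c"
    using E adj_sym by metis+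
  have V': "V = {a, c, e, b, d}" using V by blast
  show ?thesis unfolding cycle_type_def
    by (intro exI[of _ a] exI[of _ c] exI[of _ e] exI[of _ b] exI[of _ d] conjI, rule V')
      (use V' dist E E' in \<open>auto simp: co_def\<close>)
qed

text \<open>Pentagon and bull are self-complementary, so only the clique type is listed for the
  complement too.\<close>

lemma (in doubly_connected_ugraph) tight_iff:
  assumes "card V \<ge> 2"
  shows "tight V E \<and> tight V (co V E) \<longleftrightarrow>
    clique_type V E \<or> clique_type V (co V E) \<or> cycle_type V E \<or> bull_type V E"
proof -
  interpret co: doubly_connected_ugraph V "co V E" by (rule doubly_connected_ugraph_co)
  show ?thesis
  proof
    assume "tight V E \<and> tight V (co V E)"
    then show "clique_type V E \<or> clique_type V (co V E) \<or> cycle_type V E \<or> bull_type V E"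
      using tight_classification[OF assms] co.bull_type_co by (simp add: co_co) blast
  next
    assume "clique_type V E \<or> clique_type V (co V E) \<or> cycle_type V E \<or> bull_type V E"
    then show "tight V E \<and> tight V (co V E)"
    proof (elim disjE)
      assume "clique_type V E"
      then show ?thesis using clique_type_tight by simp
    next
      assume "clique_type V (co V E)"
      then show ?thesis using co.clique_type_tight by (simp add: co_co)
    next
      assume "cycle_type V E"
      then show ?thesis using cycle_type_tight co.cycle_type_tight cycle_type_co by simp
    next
      assume "bull_type V E"
      then show ?thesis using bull_type_tight co.bull_type_tight bull_type_co by simp
    qed
  qed
qed

section \<open>Location numbers\<close>

abbreviation adj :: "'a pair_pre_digraph \<Rightarrow> 'a \<Rightarrow> 'a \<Rightarrow> bool" where
  "adj G u v \<equiv> (u, v) \<in> parcs G"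

lemma adj_complement: "adj (complement G) = co (pverts G) (adj G)"
  by (auto simp: complement_def co_def fun_eq_iff)

lemma pverts_complement [simp]: "pverts (complement G) = pverts G"
  by (simp add: complement_def)

lemma pair_graph_ugraph: "pair_graph G \<Longrightarrow> ugraph (pverts G) (adj G)"
proof -
  assume "pair_graph G"
  then interpret pair_graph G .
  show ?thesis
  proof
    show "finite (pverts G)" by (rule pair_finite_verts)
    show "\<And>u v. adj G u v \<Longrightarrow> u \<in> pverts G \<and> v \<in> pverts G" by (blast dest: wellformed')
    show "\<And>u v. adj G u v \<Longrightarrow> adj G v u" using pair_sym_arcs by (auto simp: symmetric_def dest: symD)
    show "\<And>u. \<not> adj G u u" using pair_no_loops by force
  qed
qed

section \<open>Locating sets and distances in terms of balls\<close>

context pair_graph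
begin

lemma dist_le_iff_awalk:
  assumes "u \<in> pverts G"
  shows "dist_le (adj G) k u v \<longleftrightarrow> (\<exists>p. awalk u p v \<and> length p \<le> k)"
proof
  assume "dist_le (adj G) k u v"
  then show "\<exists>p. awalk u p v \<and> length p \<le> k"
    using assms
  proof (induction k arbitrary: u)
    case 0
    then show ?case by (intro exI[of _ "[]"]) (auto simp: awalk_Nil_iff)
  next
    case (Suc k)
    then consider "dist_le (adj G) k u v" | w where "adj G u w" "dist_le (adj G) k w v" by auto
    then show ?case
    proof cases
      case 1
      then obtain p where "awalk u p v" "length p \<le> k" using Suc by blast
      then show ?thesis by (intro exI[of _ p]) simp
    next
      case 2
      then have "w \<in> pverts G" by (blast dest: wellformed')
      with 2(2) obtain p where "awalk w p v" "length p \<le> k" using Suc.IH by blast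
      then show ?thesis using 2(1) by (intro exI[of _ "(u, w) # p"]) (simp add: awalk_Cons_iff)
    qed
  qed
next
  assume "\<exists>p. awalk u p v \<and> length p \<le> k"
  then obtain p where p: "awalk u p v" "length p \<le> k" by blast
  from p(1) have "dist_le (adj G) (length p) u v"
  proof (induction p arbitrary: u)
    case Nil
    then show ?case by (simp add: awalk_Nil_iff)
  next
    case (Cons e p)
    then have "adj G u (snd e)" "awalk (snd e) p v" by (auto simp: awalk_Cons_iff)
    then show ?case using Cons.IH by auto
  qed
  then show "dist_le (adj G) k u v" using p(2) by (rule dist_le_mono)
qed

text \<open>The length of a walk is itself an admissible radius, and each admissible radius is at
  least the length of some walk. For an unreachable vertex both families are empty and both infima
  are infinite.\<close>

lemma distance_INF:
  assumes "u \<in> pverts G"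
  shows "distance G u v = (INF k\<in>{k. dist_le (adj G) k u v}. ereal (real k))"
proof -
  have cost: "awalk_cost (\<lambda>_. 1) p = real (length p)" for p :: "('a \<times> 'a) list"
    by (induction p) auto
  have "(INF p\<in>{p. awalk u p v}. ereal (real (length p))) = (INF k\<in>{k. dist_le (adj G) k u v}.
    ereal (real k))"
  proof (rule INF_eq)
    show "\<exists>k\<in>{k. dist_le (adj G) k u v}. ereal (real k) \<le> ereal (real (length p))"
      if "p \<in> {p. awalk u p v}" for p
      using that dist_le_iff_awalk[OF assms] by (intro bexI[of _ "length p"]) auto
    show "\<exists>p\<in>{p. awalk u p v}. ereal (real (length p)) \<le> ereal (real k)"
      if "k \<in> {k. dist_le (adj G) k u v}" for k
      using that dist_le_iff_awalk[OF assms] by auto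
  qed
  then show ?thesis by (simp add: distance_def \<mu>_def cost)
qed

lemma distance_le_iff:
  assumes "u \<in> pverts G"
  shows "distance G u v \<le> ereal (real k) \<longleftrightarrow> dist_le (adj G) k u v"
proof
  assume "dist_le (adj G) k u v"
  then show "distance G u v \<le> ereal (real k)"
    unfolding distance_INF[OF assms] by (intro INF_lower) simp
next
  assume le: "distance G u v \<le> ereal (real k)"
  show "dist_le (adj G) k u v"
  proof (rule ccontr)
    assume n: "\<not> dist_le (adj G) k u v"
    \<comment> \<open>The admissible radii are integers, so missing the radius \<open>k\<close>
      pushes the infimum up by a full unit.\<close>
    have "ereal (real (Suc k)) \<le> distance G u v"
      unfolding distance_INF[OF assms]
    proof (rule INF_greatest)
      fix l assume "l \<in> {k. dist_le (adj G) k u v}"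
      then have "\<not> l \<le> k" using n dist_le_mono[of "adj G" l u v k] by blast
      then show "ereal (real (Suc k)) \<le> ereal (real l)" by simp
    qed
    then have "ereal (real (Suc k)) \<le> ereal (real k)" using le by (rule order_trans)
    then show False by simp
  qed
qed

lemma resolves_iff_distance:
  assumes "u \<in> pverts G" "v \<in> pverts G"
  shows "resolves (adj G) x u v \<longleftrightarrow> distance G u x \<noteq> distance G v x"
proof
  assume "resolves (adj G) x u v"
  then show "distance G u x \<noteq> distance G v x"
    unfolding resolves_def distance_le_iff[OF assms(1), symmetric] distance_le_iff[OF assms(2),
      symmetric]
    by auto
next
  assume "distance G u x \<noteq> distance G v x"
  then show "resolves (adj G) x u v"
    unfolding resolves_def distance_INF[OF assms(1)] distance_INF[OF assms(2)]
      by (rule contrapos_np) simp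
qed

text \<open>A vertex of \<open>D\<close> is separated from all others by its distance zero to
  itself, so only pairs outside \<open>D\<close> impose a condition.\<close>

lemma locating_set_iff_free:
  assumes "D \<subseteq> pverts G"
  shows "locating_set G D \<longleftrightarrow> free_set (pverts G) (adj G) (pverts G - D)"
proof -
  have eq: "(\<lambda>x\<in>D. distance G u x) = (\<lambda>x\<in>D. distance G v x)
      \<longleftrightarrow> (\<forall>x\<in>D. distance G u x = distance G v x)" for u v
    by (auto simp: restrict_def fun_eq_iff)
  have D: "pverts G - (pverts G - D) = D" using assms by blast
  have "locating_set G D \<longleftrightarrow>
      (\<forall>u\<in>pverts G. \<forall>v\<in>pverts G. u \<noteq> v \<longrightarrow> (\<exists>x\<in>D. resolves (adj G) x u v))"
    unfolding locating_set_def inj_on_def eq using assms resolves_iff_distance by blast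
  also have "\<dots> \<longleftrightarrow> (\<forall>u\<in>pverts G - D. \<forall>v\<in>pverts G - D. u \<noteq> v \<longrightarrow> (\<exists>x\<in>D. resolves (adj G) x u v))"
    (is "?L \<longleftrightarrow> ?R")
  proof
    assume R: ?R
    have "\<exists>x\<in>D. resolves (adj G) x u v" if "u \<in> pverts G" "v \<in> pverts G" "u \<noteq> v" for u v
    proof (cases "u \<in> D \<or> v \<in> D")
      case True
      then show ?thesis
        using resolves_self[OF that(3)] resolves_sym[OF resolves_self[OF that(3)[symmetric]]]
          by blast
    next
      case False
      then show ?thesis using R that by simp
    qed
    then show ?L by blast
  qed simp
  finally show ?thesis unfolding free_set_def D by blast
qed

lemma location_number_attained:
  obtains W where "free_set (pverts G) (adj G) W" "location_number G = card (pverts G) - card W"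
    "card W \<le> card (pverts G)"
proof -
  have "free_set (pverts G) (adj G) {}" by (simp add: free_set_def)
  then have "\<exists>k D. locating_set G D \<and> card D = k"
    using locating_set_iff_free[of "pverts G"] by auto
  then have "\<exists>D. locating_set G D \<and> card D = location_number G"
    unfolding location_number_def by (rule LeastI_ex)
  then obtain D where D: "locating_set G D" "card D = location_number G" by blast
  then have sub: "D \<subseteq> pverts G" by (simp add: locating_set_def)
  have "card (pverts G - D) = card (pverts G) - card D" "card D \<le> card (pverts G)"
    using sub pair_finite_verts by (auto simp: card_Diff_subset finite_subset card_mono)
  then show ?thesis
    using that[of "pverts G - D"] D locating_set_iff_free[OF sub] by simp
qed

lemma location_number_le:
  assumes "free_set (pverts G) (adj G) W"
  shows "location_number G \<le> card (pverts G) - card W"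
proof -
  have sub: "W \<subseteq> pverts G" using assms by (simp add: free_set_def)
  then have "pverts G - (pverts G - W) = W" by blast
  then have "locating_set G (pverts G - W)"
    using assms locating_set_iff_free[of "pverts G - W"] by simp
  moreover have "card (pverts G - W) = card (pverts G) - card W"
    using sub pair_finite_verts by (simp add: card_Diff_subset finite_subset)
  ultimately show ?thesis unfolding location_number_def by (intro Least_le) blast
qed

lemma tight_iff_location_number:
  assumes "card (pverts G) \<ge> 4"
  shows "tight (pverts G) (adj G) \<longleftrightarrow> location_number G \<ge> card (pverts G) - 3"
proof
  assume t: "tight (pverts G) (adj G)"
  obtain W where W: "free_set (pverts G) (adj G) W" "location_number G = card (pverts G) - card W"
    by (rule location_number_attained)
  have "\<not> card W \<ge> 4"
  proof
    assume "card W \<ge> 4"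
    then obtain T where "T \<subseteq> W" "card T = 4" by (meson obtain_subset_with_card_n)
    then show False using t free_set_subset[OF W(1)] unfolding tight_def by blast
  qed
  then show "location_number G \<ge> card (pverts G) - 3" using W(2) by simp
next
  assume l: "location_number G \<ge> card (pverts G) - 3"
  show "tight (pverts G) (adj G)"
    unfolding tight_def
  proof (intro allI impI notI)
    fix W assume "free_set (pverts G) (adj G) W" "card W = 4"
    \<comment> \<open>With at least four vertices the truncated subtraction still makes
      \<open>card (pverts G) - 4\<close> smaller than \<open>card (pverts G) - 3\<close>.\<close>
    then show False using location_number_le[of W] l assms by simp
  qed
qed

lemma location_number_pos:
  assumes "card (pverts G) \<ge> 2"
  shows "location_number G \<ge> 1"
proof (rule ccontr)
  assume "\<not> location_number G \<ge> 1"
  moreover obtain W where W: "free_set (pverts G) (adj G) W"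
    "location_number G = card (pverts G) - card W" "card W \<le> card (pverts G)"
    by (rule location_number_attained)
  ultimately have "card W = card (pverts G)" by simp
  moreover have "W \<subseteq> pverts G" using W(1) by (simp add: free_set_def)
  ultimately have "W = pverts G" using pair_finite_verts by (simp add: card_subset_eq)
  moreover obtain u v where "u \<in> pverts G" "v \<in> pverts G" "u \<noteq> v"
    using assms by (metis card_le_Suc0_iff_eq pair_finite_verts not_less_eq_eq numeral_2_eq_2)
  ultimately show False using W(1) unfolding free_set_def by blast
qed

lemma location_number_1E:
  assumes "location_number G = 1" "card (pverts G) \<ge> 2"
  obtains x where "x \<in> pverts G" "free_set (pverts G) (adj G) (pverts G - {x})"
proof -
  obtain W where W: "free_set (pverts G) (adj G) W"
    "location_number G = card (pverts G) - card W" "card W \<le> card (pverts G)"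
    by (rule location_number_attained)
  have sub: "W \<subseteq> pverts G" using W(1) by (simp add: free_set_def)
  then have "card (pverts G - W) = 1"
    using W(2) assms pair_finite_verts by (simp add: card_Diff_subset finite_subset)
  then obtain x where "pverts G - W = {x}" by (rule card_1_singletonE)
  then have "x \<in> pverts G" "W = pverts G - {x}" using sub by blast+
  then show ?thesis using that W(1) by blast
qed

lemma connected_connected_on:
  assumes "Digraph_Component.connected (with_proj G)"
  shows "connected_on (pverts G) (adj G)"
proof -
  have "strongly_connected (with_proj G)"
    using symmetric_connected_imp_strongly_connected pair_sym_arcs assms by blast
  then have "\<exists>p. awalk u p v" if "u \<in> pverts G" "v \<in> pverts G" for u v
    using that reachable_awalk[of u v] by (simp add: strongly_connected_def)
  then show ?thesis
    unfolding connected_on_def using dist_le_iff_awalk by (metis order_refl)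
qed

end

lemma doubly_connected_ugraph:
  assumes "pair_graph G" "doubly_connected G"
  shows "doubly_connected_ugraph (pverts G) (adj G)"
proof -
  interpret ugraph "pverts G" "adj G" using assms(1) by (rule pair_graph_ugraph)
  show ?thesis
  proof
    show "connected_on (pverts G) (adj G)"
      using assms pair_graph.connected_connected_on unfolding doubly_connected_def by blast
    have "connected_on (pverts (complement G)) (adj (complement G))"
      using assms pair_graph.connected_connected_on[OF pair_graph_complement]
      unfolding doubly_connected_def by blast
    then show "connected_on (pverts G) (co (pverts G) (adj G))" by (simp add: adj_complement)
  qed
qed

text \<open>Distances to \<open>x\<close> are injective and change by at most one along an edge, so a vertex of degree
  three is impossible if \<open>{x}\<close> is locating.\<close>

lemma (in connected_ugraph) locating_singleton_degree:
  assumes "x \<in> V" "free_set V E (V - {x})" "E y u" "E y v" "E y w"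
  shows "\<not> distinct [u, v, w]"
proof
  assume dist: "distinct [u, v, w]"
  define f where "f z = (LEAST k. dist_le E k z x)" for z
  have f: "dist_le E k z x \<longleftrightarrow> f z \<le> k" if "z \<in> V" for z k
  proof
    assume "dist_le E k z x"
    then show "f z \<le> k" unfolding f_def by (rule Least_le)
  next
    have "\<exists>k. dist_le E k z x" using connected that assms(1) by (simp add: connected_on_def)
    then have "dist_le E (f z) z x" unfolding f_def by (rule LeastI_ex)
    then show "f z \<le> k \<Longrightarrow> dist_le E k z x" by (rule dist_le_mono)
  qed
  have inj: "s = t" if "s \<in> V" "t \<in> V" "f s = f t" for s t
  proof (rule ccontr)
    assume "s \<noteq> t"
    have "resolves E x s t"
    proof (cases "s = x \<or> t = x")
      case True
      then show ?thesis using resolves_self[of s t] resolves_self[of t s] resolves_sym \<open>s \<noteq> t\<close>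
        by metis
    next
      case False
      have "V - (V - {x}) = {x}" using assms(1) by blast
      then show ?thesis using assms(2) that False \<open>s \<noteq> t\<close> by (auto simp: free_set_def)
    qed
    then show False using f that unfolding resolves_def by simp
  qed
  have step: "f s \<le> Suc (f t)" if "E s t" for s t
    using f[of s "Suc (f t)"] f[of t "f t"] adj_in[OF that] that by auto
  have V: "y \<in> V" "u \<in> V" "v \<in> V" "w \<in> V" using adj_in assms(3-5) by blast+
  have ne: "y \<noteq> u" "y \<noteq> v" "y \<noteq> w" using assms(3-5) by auto
  have "f y \<noteq> f u" "f y \<noteq> f v" "f y \<noteq> f w" "f u \<noteq> f v" "f u \<noteq> f w" "f v \<noteq> f w"
    using inj V ne dist by auto
  moreover have "f y \<le> Suc (f u)" "f u \<le> Suc (f y)" "f y \<le> Suc (f v)" "f v \<le> Suc (f y)"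
    "f y \<le> Suc (f w)" "f w \<le> Suc (f y)"
    using step assms(3-5) adj_sym by blast+
  ultimately show False by linarith
qed

text \<open>All neighbours of \<open>y\<close> in the complement are at distance one from
  \<open>y\<close>, so there is at most one. With five or more vertices, \<open>y\<close> then has
  three neighbours in the graph, against the degree bound given by \<open>x\<close>.\<close>

lemma (in doubly_connected_ugraph) locating_singletons_order:
  assumes "x \<in> V" "free_set V E (V - {x})" "y \<in> V" "free_set V (co V E) (V - {y})"
  shows "card V \<le> 4"
proof (rule ccontr)
  assume "\<not> card V \<le> 4"
  interpret co: doubly_connected_ugraph V "co V E" by (rule doubly_connected_ugraph_co)
  have y: "V - (V - {y}) = {y}" using assms(3) by blast
  let ?N = "{u. co V E y u}"
  have "u = v" if "u \<in> ?N" "v \<in> ?N" for u v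
  proof (rule ccontr)
    assume "u \<noteq> v"
    have "u \<in> V - {y}" "v \<in> V - {y}" using that by (auto simp: co_def)
    then have "\<exists>x\<in>V - (V - {y}). resolves (co V E) x u v"
      using assms(4) \<open>u \<noteq> v\<close> unfolding free_set_def by blast
    then have "resolves (co V E) y u v" unfolding y by simp
    moreover have "\<not> resolves (co V E) y u v"
      by (rule adj_not_resolves) (use that co.adj_sym[of y u] co.adj_sym[of y v] in \<open>auto simp:
        co_def\<close>)
    ultimately show False by blast
  qed
  moreover have finN: "finite ?N" by (rule finite_subset[OF _ finite_V]) (auto simp: co_def)
  ultimately have "card ?N \<le> 1" using card_le_Suc0_iff_eq[of ?N] by simp
  moreover have "card (V - insert y ?N) \<ge> card V - card (insert y ?N)"
    using finN by (intro diff_card_le_card_Diff) simp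
  moreover have "card (insert y ?N) \<le> Suc (card ?N)" by (rule card_insert_le_m1) simp_all
  ultimately have "3 \<le> card (V - insert y ?N)" using \<open>\<not> card V \<le> 4\<close> by linarith
  then obtain T where T: "T \<subseteq> V - insert y ?N" "card T = 3" by (meson obtain_subset_with_card_n)
  then obtain u v w where uvw: "T = {u, v, w}" "distinct [u, v, w]"
    by (auto simp: card_3_iff)
  have "E y z" if "z \<in> T" for z
  proof -
    have "z \<in> V" "z \<noteq> y" "\<not> co V E y z" using that T(1) by blast+
    then show ?thesis using assms(3) by (simp add: co_def)
  qed
  then have "E y u" "E y v" "E y w" using uvw(1) by simp_all
  then show False using locating_singleton_degree[OF assms(1,2)] uvw(2) by blast
qed

section \<open>Isomorphisms\<close>

text \<open>In a graph without parallel arcs the arc map of an isomorphism is determined by the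
  vertex map, so a vertex bijection carries all the information.\<close>

definition graph_map :: "'a pair_pre_digraph \<Rightarrow> 'b pair_pre_digraph \<Rightarrow> ('a \<Rightarrow> 'b) \<Rightarrow> bool" where
  "graph_map G H f \<longleftrightarrow> bij_betw f (pverts G) (pverts H) \<and>
     (\<forall>u\<in>pverts G. \<forall>v\<in>pverts G. adj G u v \<longleftrightarrow> adj H (f u) (f v))"

lemma digraph_iso_iff:
  assumes "pair_graph G" "pair_graph H"
  shows "digraph_iso (with_proj G) (with_proj H) \<longleftrightarrow> (\<exists>f. graph_map G H f)"
proof
  interpret G: pair_graph G by fact
  interpret H: pair_graph H by fact
  {
    assume "digraph_iso (with_proj G) (with_proj H)"
    then obtain f where f: "G.digraph_isomorphism f" and H: "with_proj H = app_iso f (with_proj G)"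
      by (auto simp: digraph_iso_def)
    have verts: "pverts H = iso_verts f ` pverts G" and arcs: "parcs H = iso_arcs f ` parcs G"
      using arg_cong[OF H, of verts] arg_cong[OF H, of arcs] by simp_all
    \<comment> \<open>The record equation fixes tail and head of the image as the projections, and
      this forces the arc map to act componentwise.\<close>
    have tail: "iso_tail f = fst" and head: "iso_head f = snd"
      using arg_cong[OF H, of tail] arg_cong[OF H, of head] by simp_all
    have inj: "inj_on (iso_verts f) (pverts G)"
      using f by (simp add: G.digraph_isomorphism_def)
    have image: "iso_arcs f (u, v) = (iso_verts f u, iso_verts f v)" if "adj G u v" for u v
      using f that by (auto simp: G.digraph_isomorphism_def tail head intro!: prod_eqI)
    have "adj G u v \<longleftrightarrow> adj H (iso_verts f u) (iso_verts f v)" if "u \<in> pverts G" "v \<in> pverts G"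
      for u v
    proof
      assume "adj G u v"
      then show "adj H (iso_verts f u) (iso_verts f v)" using image arcs by (metis imageI)
    next
      assume "adj H (iso_verts f u) (iso_verts f v)"
      then obtain u' v' where a: "adj G u' v'"
        "(iso_verts f u, iso_verts f v) = iso_arcs f (u', v')"
        unfolding arcs by auto
      then have "u' \<in> pverts G" "v' \<in> pverts G" by (auto dest: G.wellformed')
      then have "u = u'" "v = v'" using a image[OF a(1)] inj that by (auto dest: inj_onD)
      then show "adj G u v" using a(1) by simp
    qed
    then show "\<exists>f. graph_map G H f"
      using inj verts by (intro exI[of _ "iso_verts f"]) (auto simp: graph_map_def bij_betw_def)
  }
  assume "\<exists>f. graph_map G H f"
  then obtain f where bij: "bij_betw f (pverts G) (pverts H)"
    and adj: "\<And>u v. u \<in> pverts G \<Longrightarrow> v \<in> pverts G \<Longrightarrow> adj G u v \<longleftrightarrow> adj H (f u) (f v)"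
    by (auto simp: graph_map_def)
  define g where "g = \<lparr>iso_verts = f, iso_arcs = map_prod f f, iso_head = snd, iso_tail = fst\<rparr>"
  have inj: "inj_on f (pverts G)" and verts: "pverts H = f ` pverts G"
    using bij by (auto simp: bij_betw_def)
  have "inj_on (map_prod f f) (parcs G)"
  proof (rule inj_on_subset)
    show "inj_on (map_prod f f) (pverts G \<times> pverts G)" using inj
      by (rule map_prod_inj_on) (rule inj)
    show "parcs G \<subseteq> pverts G \<times> pverts G" by (auto dest: G.wellformed')
  qed
  then have "G.digraph_isomorphism g"
    using inj G.wf_digraph_axioms by (simp add: G.digraph_isomorphism_def g_def)
  moreover have "parcs H = map_prod f f ` parcs G"
  proof (rule set_eqI, rule iffI)
    fix e assume "e \<in> parcs H"
    obtain x y where e: "e = (x, y)" by (cases e)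
    then have "x \<in> pverts H" "y \<in> pverts H" using \<open>e \<in> parcs H\<close> by (auto dest: H.wellformed')
    then obtain u v where uv: "u \<in> pverts G" "v \<in> pverts G" "x = f u" "y = f v" using verts by auto
    then have "adj G u v" using adj \<open>e \<in> parcs H\<close> e by simp
    then show "e \<in> map_prod f f ` parcs G" using uv e by force
  next
    fix e assume "e \<in> map_prod f f ` parcs G"
    then obtain u v where "adj G u v" "e = (f u, f v)" by auto
    then show "e \<in> parcs H" using adj G.wellformed' by metis
  qed
  then have "with_proj H = app_iso g (with_proj G)"
    using verts by (simp add: app_iso_def g_def with_proj_def)
  ultimately show "digraph_iso (with_proj G) (with_proj H)" unfolding digraph_iso_def by blast
qed

lemma graph_map_complement:
  "graph_map G H f \<Longrightarrow> graph_map (complement G) (complement H) f"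
  unfolding graph_map_def by (auto simp: complement_def bij_betw_def dest: inj_onD)

text \<open>The extremal types assert the existence of vertices in \<open>H\<close>; moving these to
  \<open>G\<close> takes the inverse map.\<close>

lemma graph_map_preimage:
  assumes "graph_map G H f"
  obtains g where "bij_betw g (pverts H) (pverts G)"
    "\<And>u v. u \<in> pverts H \<Longrightarrow> v \<in> pverts H \<Longrightarrow> adj G (g u) (g v) \<longleftrightarrow> adj H u v"
proof -
  have bij: "bij_betw f (pverts G) (pverts H)" using assms by (simp add: graph_map_def)
  let ?g = "inv_into (pverts G) f"
  have g: "bij_betw ?g (pverts H) (pverts G)" using bij by (rule bij_betw_inv_into)
  have "adj G (?g u) (?g v) \<longleftrightarrow> adj H u v" if "u \<in> pverts H" "v \<in> pverts H" for u v
  proof -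
    have "?g u \<in> pverts G" "?g v \<in> pverts G" using g that by (auto simp: bij_betw_def)
    moreover have "f (?g u) = u" "f (?g v) = v" using bij that
      by (simp_all add: bij_betw_inv_into_right)
    ultimately show ?thesis using assms by (simp add: graph_map_def)
  qed
  then show ?thesis using that g by blast
qed

section \<open>Transport of the extremal types along isomorphisms\<close>

lemma clique_type_iso:
  assumes "graph_map G H f" "clique_type (pverts H) (adj H)"
  shows "clique_type (pverts G) (adj G)"
proof -
  obtain g where bij: "bij_betw g (pverts H) (pverts G)"
    and g: "\<And>u v. u \<in> pverts H \<Longrightarrow> v \<in> pverts H \<Longrightarrow> adj G (g u) (g v) \<longleftrightarrow> adj H u v"
    using graph_map_preimage[OF assms(1)] by blast
  obtain A B c d where V: "pverts H = A \<union> B \<union> {c, d}" and disj: "A \<inter> B = {}" "c \<notin> A \<union> B"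
    "d \<notin> A \<union> B" "c \<noteq> d"
    and ne: "A \<noteq> {}" "B \<noteq> {}"
    and adj: "\<forall>u\<in>A \<union> B. \<forall>v\<in>A \<union> B. u \<noteq> v \<longrightarrow> adj H u v"
      "\<forall>u\<in>A. \<not> adj H u c \<and> \<not> adj H u d" "\<forall>u\<in>B. adj H u c \<and> \<not> adj H u d"
    and cd: "adj H c d"
    using assms(2) unfolding clique_type_def by (elim exE conjE)
  note clique = adj(1)[rule_format] and A = adj(2)[rule_format] and B = adj(3)[rule_format]
  have inj: "inj_on g (A \<union> B \<union> {c, d})" and img: "pverts G = g ` (A \<union> B \<union> {c, d})"
    using bij V by (auto simp: bij_betw_def)
  have eq: "g u = g v \<longleftrightarrow> u = v" if "u \<in> A \<union> B \<union> {c, d}" "v \<in> A \<union> B \<union> {c, d}" for u v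
    using inj that by (rule inj_on_eq_iff)
  show ?thesis
  proof (rule clique_typeI[of _ "g ` A" "g ` B" "g c" "g d"])
    show "pverts G = g ` A \<union> g ` B \<union> {g c, g d}" using img by auto
    show "g ` A \<inter> g ` B = {}" "g c \<notin> g ` A \<union> g ` B" "g d \<notin> g ` A \<union> g ` B" "g c \<noteq> g d"
      using disj eq by auto
    show "adj G u v" if "u \<in> g ` A \<union> g ` B" "v \<in> g ` A \<union> g ` B" "u \<noteq> v" for u v
      using that clique g V by (auto; metis UnCI)
    show "\<not> adj G u (g c) \<and> \<not> adj G u (g d)" if "u \<in> g ` A" for u using that A g V by auto
    show "adj G u (g c) \<and> \<not> adj G u (g d)" if "u \<in> g ` B" for u using that B g V by auto
    show "adj G (g c) (g d)" using cd g V by simp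
  qed (use ne in auto)
qed

lemma bull_type_iso:
  assumes "graph_map G H f" "bull_type (pverts H) (adj H)"
  shows "bull_type (pverts G) (adj G)"
proof -
  obtain g where bij: "bij_betw g (pverts H) (pverts G)"
    and g: "\<And>u v. u \<in> pverts H \<Longrightarrow> v \<in> pverts H \<Longrightarrow> adj G (g u) (g v) \<longleftrightarrow> adj H u v"
    using graph_map_preimage[OF assms(1)] by blast
  from assms(2) obtain a b y x d where V: "pverts H = {a, b, y, x, d}"
    and dist: "distinct [a, b, y, x, d]"
    and E: "adj H a b" "adj H b y" "adj H b x" "adj H y x" "adj H x d" "\<not> adj H a y" "\<not> adj H a x"
      "\<not> adj H a d" "\<not> adj H b d" "\<not> adj H y d"
    unfolding bull_type_def by metis
  have V': "pverts G = {g a, g b, g y, g x, g d}" and inj: "inj_on g {a, b, y, x, d}"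
    using bij V by (auto simp: bij_betw_def)
  have "distinct (map g [a, b, y, x, d])" unfolding distinct_map using dist inj by simp
  then have D: "distinct [g a, g b, g y, g x, g d]" by simp
  have "adj G (g a) (g b)" "adj G (g b) (g y)" "adj G (g b) (g x)" "adj G (g y) (g x)"
    "adj G (g x) (g d)" "\<not> adj G (g a) (g y)" "\<not> adj G (g a) (g x)"
      "\<not> adj G (g a) (g d)" "\<not> adj G (g b) (g d)" "\<not> adj G (g y) (g d)"
    using E by (simp_all add: g V)
  then show ?thesis
    unfolding bull_type_def using V' D
    by (intro exI[of _ "g a"] exI[of _ "g b"] exI[of _ "g y"] exI[of _ "g x"] exI[of _ "g d"] conjI)
qed

lemma cycle_type_iso:
  assumes "graph_map G H f" "cycle_type (pverts H) (adj H)"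
  shows "cycle_type (pverts G) (adj G)"
proof -
  obtain g where bij: "bij_betw g (pverts H) (pverts G)"
    and g: "\<And>u v. u \<in> pverts H \<Longrightarrow> v \<in> pverts H \<Longrightarrow> adj G (g u) (g v) \<longleftrightarrow> adj H u v"
    using graph_map_preimage[OF assms(1)] by blast
  from assms(2) obtain a b c d e where V: "pverts H = {a, b, c, d, e}"
    and dist: "distinct [a, b, c, d, e]"
    and E: "adj H a b" "adj H b c" "adj H c d" "adj H d e" "adj H e a" "\<not> adj H a c" "\<not> adj H a d"
      "\<not> adj H b d" "\<not> adj H b e" "\<not> adj H c e"
    unfolding cycle_type_def by metis
  have V': "pverts G = {g a, g b, g c, g d, g e}" and inj: "inj_on g {a, b, c, d, e}"
    using bij V by (auto simp: bij_betw_def)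
  have "distinct (map g [a, b, c, d, e])" unfolding distinct_map using dist inj by simp
  then have D: "distinct [g a, g b, g c, g d, g e]" by simp
  have "adj G (g a) (g b)" "adj G (g b) (g c)" "adj G (g c) (g d)" "adj G (g d) (g e)"
    "adj G (g e) (g a)" "\<not> adj G (g a) (g c)" "\<not> adj G (g a) (g d)"
      "\<not> adj G (g b) (g d)" "\<not> adj G (g b) (g e)" "\<not> adj G (g c) (g e)"
    using E by (simp_all add: g V)
  then show ?thesis
    unfolding cycle_type_def using V' D
    by (intro exI[of _ "g a"] exI[of _ "g b"] exI[of _ "g c"] exI[of _ "g d"] exI[of _ "g e"] conjI)
qed

section \<open>The extremal families\<close>

lemma pverts_path4: "pverts (path_graph 4) = {1, 2, 3, 4}"
  by (auto simp: path_graph_def)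

lemma adj_path4: "adj (path_graph 4) i j \<longleftrightarrow> (i, j) \<in> {(1, 2), (2, 1), (2, 3), (3, 2), (3, 4), (4, 3)}"
proof (cases "i \<in> {1, 2, 3, 4} \<and> j \<in> {1, 2, 3, 4}")
  case True
  then show ?thesis by (elim conjE insertE emptyE) (simp_all add: path_graph_def)
next
  case False
  then have "\<not> adj (path_graph 4) i j" using pverts_path4 by (auto simp: path_graph_def)
  then show ?thesis using False by auto
qed

lemma complete_graph_1: "complete_graph 1 = edgeless_graph 1"
  by (auto simp: complete_graph_def edgeless_graph_def)

text \<open>The map \<open>p\<close> names the class of each vertex, and \<open>C\<close> says
  whether the classes are cliques or edgeless. Numbering each class from zero gives the isomorphism.
  Classes with one vertex fit both values of \<open>C\<close>.\<close>

lemma graph_map_substitute: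
  assumes "finite (pverts G)" "\<And>u. u \<in> pverts G \<Longrightarrow> p u \<in> pverts \<Gamma>"
    and "\<And>i. i \<in> pverts \<Gamma> \<Longrightarrow> pverts (F i) = {0..<card {u \<in> pverts G. p u = i}}"
    and "\<And>i x y. i \<in> pverts \<Gamma> \<Longrightarrow> x \<in> pverts (F i) \<Longrightarrow> y \<in> pverts (F i) \<Longrightarrow> adj (F i) x y \<longleftrightarrow> C \<and> x \<noteq> y"
    and "\<And>u v. u \<in> pverts G \<Longrightarrow> v \<in> pverts G \<Longrightarrow>
      adj G u v \<longleftrightarrow> adj \<Gamma> (p u) (p v) \<or> p u = p v \<and> C \<and> u \<noteq> v"
  shows "\<exists>f. graph_map G (substitute \<Gamma> F) f"
proof -
  define S where "S i = {u \<in> pverts G. p u = i}" for i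
  have "\<forall>i. \<exists>h. bij_betw h (S i) {0..<card (S i)}"
    using assms(1) by (simp add: S_def ex_bij_betw_finite_nat)
  then obtain g where g: "\<And>i. bij_betw (g i) (S i) {0..<card (S i)}" by metis
  have F: "pverts (F i) = {0..<card (S i)}" if "i \<in> pverts \<Gamma>" for i
    using assms(3)[OF that] by (simp add: S_def)
  have S: "u \<in> S (p u)" if "u \<in> pverts G" for u using that by (simp add: S_def)
  have g_in: "g (p u) u \<in> pverts (F (p u))" if "u \<in> pverts G" for u
    using F[OF assms(2)[OF that]] bij_betwE[OF g] S[OF that] by blast
  have g_inj: "g (p u) u = g (p u) v \<longleftrightarrow> u = v" if "u \<in> pverts G" "v \<in> pverts G" "p u = p v" for u v
    using S[OF that(1)] S[OF that(2)] that(3) bij_betw_imp_inj_on[OF g[of "p u"]]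
    by (simp add: inj_on_eq_iff)
  let ?f = "\<lambda>u. (p u, g (p u) u)"
  have "bij_betw ?f (pverts G) (pverts (substitute \<Gamma> F))"
    unfolding bij_betw_def
  proof (intro conjI set_eqI iffI)
    show "inj_on ?f (pverts G)" using g_inj by (auto simp: inj_on_def)
    show "x \<in> pverts (substitute \<Gamma> F)" if "x \<in> ?f ` pverts G" for x
      using that assms(2) g_in by (auto simp: substitute_def)
    show "x \<in> ?f ` pverts G" if x: "x \<in> pverts (substitute \<Gamma> F)" for x
    proof -
      obtain i h where ih: "x = (i, h)" "i \<in> pverts \<Gamma>" "h \<in> pverts (F i)"
        using x by (auto simp: substitute_def)
      then have "h \<in> g i ` S i" using F g by (simp add: bij_betw_def)
      then obtain u where "u \<in> S i" "h = g i u" by blast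
      then have "u \<in> pverts G" "x = ?f u" using ih(1) by (auto simp: S_def)
      then show ?thesis by blast
    qed
  qed
  moreover have "adj G u v \<longleftrightarrow> adj (substitute \<Gamma> F) (?f u) (?f v)" if "u \<in> pverts G" "v \<in> pverts G"
    for u v
  proof -
    have "adj (substitute \<Gamma> F) (?f u) (?f v)
        \<longleftrightarrow> adj \<Gamma> (p u) (p v) \<or> p u = p v \<and> adj (F (p u)) (g (p u) u) (g (p u) v)"
      using that assms(2) g_in by (auto simp: substitute_def)
    also have "\<dots> \<longleftrightarrow> adj \<Gamma> (p u) (p v) \<or> p u = p v \<and> C \<and> u \<noteq> v"
      using assms(4)[OF assms(2)[OF that(1)] g_in[OF that(1)], of "g (p u) v"] g_in[OF that(2)]
        g_inj[OF that]
      by auto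
    finally show ?thesis using assms(5)[OF that] by simp
  qed
  ultimately show ?thesis unfolding graph_map_def by blast
qed

lemma mem_substitute: "(i, h) \<in> pverts (substitute \<Gamma> F) \<longleftrightarrow> i \<in> pverts \<Gamma> \<and> h \<in> pverts (F i)"
  by (simp add: substitute_def)

lemma adj_substitute:
  "adj (substitute \<Gamma> F) (i, h) (j, h') \<longleftrightarrow> i \<in> pverts \<Gamma> \<and> h \<in> pverts (F i) \<and> j \<in> pverts \<Gamma> \<and>
     h' \<in> pverts (F j) \<and> (adj \<Gamma> i j \<or> i = j \<and> adj (F i) h h')"
  by (simp add: substitute_def)

lemma complete_graph_simps:
  "x \<in> pverts (complete_graph m) \<longleftrightarrow> x < m" "adj (complete_graph m) x y \<longleftrightarrow> x < m \<and> y < m \<and> x \<noteq> y"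
  by (simp_all add: complete_graph_def)

lemma edgeless_graph_simps:
  "x \<in> pverts (edgeless_graph m) \<longleftrightarrow> x < m" "\<not> adj (edgeless_graph m) x y"
  by (simp_all add: edgeless_graph_def)

lemmas substitute_path4_simps = mem_substitute adj_substitute complete_graph_simps
  edgeless_graph_simps
  pverts_path4 adj_path4

lemma clique_type_substitute2:
  assumes "r \<ge> 1" "s \<ge> 1"
  shows "clique_type (pverts (substitute2 (path_graph 4) 1 (complete_graph r) 2 (complete_graph s)))
    (adj (substitute2 (path_graph 4) 1 (complete_graph r) 2 (complete_graph s)))"
  unfolding substitute2_def
proof (rule clique_typeI[of _ "{1} \<times> {0..<r}" "{2} \<times> {0..<s}" "(3, 0)" "(4, 0)"])
  let ?H = "substitute (path_graph 4) ((\<lambda>_. complete_graph 1)(1 := complete_graph r, 2 :=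
    complete_graph s))"
  note [simp] = substitute_path4_simps
  have "x \<in> pverts ?H \<longleftrightarrow> x \<in> {1} \<times> {0..<r} \<union> {2} \<times> {0..<s} \<union> {(3, 0), (4, 0)}" for x
    by (cases x) auto
  then show "pverts ?H = {1} \<times> {0..<r} \<union> {2} \<times> {0..<s} \<union> {(3, 0), (4, 0)}" by blast
  show "adj ?H u v" if "u \<in> {1} \<times> {0..<r} \<union> {2} \<times> {0..<s}" "v \<in> {1} \<times> {0..<r} \<union> {2} \<times> {0..<s}"
    "u \<noteq> v" for u v
    using that by (cases u; cases v) auto
  show "\<not> adj ?H u (3, 0) \<and> \<not> adj ?H u (4, 0)" if "u \<in> {1} \<times> {0..<r}" for u
    using that by (cases u) auto
  show "adj ?H u (3, 0) \<and> \<not> adj ?H u (4, 0)" if "u \<in> {2} \<times> {0..<s}" for u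
    using that by (cases u) auto
  show "adj ?H (3, 0) (4, 0)" by simp
qed (use assms in auto)

text \<open>The complement of the path \<open>1 2 3 4\<close> is the path \<open>3 1 4 2\<close>, so
  the roles \<open>A\<close>, \<open>B\<close>, \<open>c\<close>, \<open>d\<close> fall on these
  positions in this order.\<close>

lemma co_clique_type_substitute2:
  assumes "r \<ge> 1" "s \<ge> 1"
  shows "clique_type (pverts (substitute2 (path_graph 4) 1 (edgeless_graph r) 3 (edgeless_graph s)))
    (co (pverts (substitute2 (path_graph 4) 1 (edgeless_graph r) 3 (edgeless_graph s)))
      (adj (substitute2 (path_graph 4) 1 (edgeless_graph r) 3 (edgeless_graph s))))"
  unfolding substitute2_def
proof (rule co_clique_typeI[of _ "{3} \<times> {0..<s}" "{1} \<times> {0..<r}" "(4, 0)" "(2, 0)"])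
  let ?H = "substitute (path_graph 4) ((\<lambda>_. complete_graph 1)(1 := edgeless_graph r, 3 :=
    edgeless_graph s))"
  note [simp] = substitute_path4_simps
  have "x \<in> pverts ?H \<longleftrightarrow> x \<in> {3} \<times> {0..<s} \<union> {1} \<times> {0..<r} \<union> {(4, 0), (2, 0)}" for x
    by (cases x) auto
  then show "pverts ?H = {3} \<times> {0..<s} \<union> {1} \<times> {0..<r} \<union> {(4, 0), (2, 0)}" by blast
  show "\<not> adj ?H u v" if "u \<in> {3} \<times> {0..<s} \<union> {1} \<times> {0..<r}" "v \<in> {3} \<times> {0..<s} \<union> {1} \<times> {0..<r}"
    for u v
    using that by (cases u; cases v) auto
  show "adj ?H u (4, 0) \<and> adj ?H u (2, 0)" if "u \<in> {3} \<times> {0..<s}" for u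
    using that by (cases u) auto
  show "\<not> adj ?H u (4, 0) \<and> adj ?H u (2, 0)" if "u \<in> {1} \<times> {0..<r}" for u
    using that by (cases u) auto
  show "\<not> adj ?H (4, 0) (2, 0)" by simp
qed (use assms in auto)

text \<open>This member of \<open>Omega2\<close> agrees with one of \<open>Omega3\<close> only after
  reversing the path, so the complementary path is read as \<open>2 4 1 3\<close>.\<close>

lemma co_clique_type_substitute1:
  assumes "s \<ge> 1"
  shows "clique_type (pverts (substitute1 (path_graph 4) 2 (edgeless_graph s)))
    (co (pverts (substitute1 (path_graph 4) 2 (edgeless_graph s)))
      (adj (substitute1 (path_graph 4) 2 (edgeless_graph s))))"
  unfolding substitute1_def
proof (rule co_clique_typeI[of _ "{2} \<times> {0..<s}" "{(4, 0)}" "(1, 0)" "(3, 0)"])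
  let ?H = "substitute (path_graph 4) ((\<lambda>_. complete_graph 1)(2 := edgeless_graph s))"
  note [simp] = substitute_path4_simps
  have "x \<in> pverts ?H \<longleftrightarrow> x \<in> {2} \<times> {0..<s} \<union> {(4, 0)} \<union> {(1, 0), (3, 0)}" for x
    by (cases x) auto
  then show "pverts ?H = {2} \<times> {0..<s} \<union> {(4, 0)} \<union> {(1, 0), (3, 0)}" by blast
  show "\<not> adj ?H u v" if "u \<in> {2} \<times> {0..<s} \<union> {(4, 0)}" "v \<in> {2} \<times> {0..<s} \<union> {(4, 0)}" for u v
    using that by (cases u; cases v) auto
  show "adj ?H u (1, 0) \<and> adj ?H u (3, 0)" if "u \<in> {2} \<times> {0..<s}" for u
    using that by (cases u) auto
  show "\<not> adj ?H u (1, 0) \<and> adj ?H u (3, 0)" if "u \<in> {(4, 0)}" for u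
    using that by (cases u) auto
  show "\<not> adj ?H (1, 0) (3, 0)" by simp
qed (use assms in auto)

lemma pair_graph_substitute1: "pair_graph H \<Longrightarrow> pair_graph (substitute1 (path_graph m) i H)"
  unfolding substitute1_def
  by (rule pair_graph_substitute) (auto simp: pair_graph_path_graph pair_graph_complete_graph)

lemma pair_graph_substitute2:
  "pair_graph H \<Longrightarrow> pair_graph H' \<Longrightarrow> pair_graph (substitute2 (path_graph m) i H j H')"
  unfolding substitute2_def
  by (rule pair_graph_substitute) (auto simp: pair_graph_path_graph pair_graph_complete_graph)

lemma Omega23_type:
  assumes "n \<ge> 4" "H \<in> Omega2 n \<union> Omega3 n"
  shows "pair_graph H" "clique_type (pverts H) (adj H) \<or> clique_type (pverts H) (co (pverts H)
    (adj H))"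
proof -
  \<comment> \<open>The other members of \<open>Omega2\<close> are literally members of
    \<open>Omega3\<close>: replacing a vertex by a one-vertex graph changes nothing, and complete
    and edgeless graphs on one vertex coincide.\<close>
  have K: "substitute1 (path_graph 4) 1 (complete_graph m)
      = substitute2 (path_graph 4) 1 (complete_graph m) 2 (complete_graph 1)"
    "substitute1 (path_graph 4) 2 (complete_graph m)
      = substitute2 (path_graph 4) 1 (complete_graph 1) 2 (complete_graph m)"
    "substitute1 (path_graph 4) 1 (edgeless_graph m)
      = substitute2 (path_graph 4) 1 (edgeless_graph m) 3 (edgeless_graph 1)" for m
    unfolding substitute1_def substitute2_def
    by (rule arg_cong[where f = "substitute (path_graph 4)"], simp add: fun_eq_iff
      complete_graph_1[unfolded One_nat_def])+
  \<comment> \<open>The bound on \<open>n\<close> keeps both truncated differences positive, so no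
    part of a blow-up is empty.\<close>
  have n: "n - 3 \<ge> 1" using assms(1) by linarith
  have nr: "n - r - 2 \<ge> 1" if "r \<le> n - 3" for r using assms(1) that by linarith
  have "(\<exists>r s. r \<ge> 1 \<and> s \<ge> 1 \<and>
        H = substitute2 (path_graph 4) 1 (complete_graph r) 2 (complete_graph s)) \<or>
      (\<exists>r s. r \<ge> 1 \<and> s \<ge> 1 \<and>
        H = substitute2 (path_graph 4) 1 (edgeless_graph r) 3 (edgeless_graph s)) \<or>
      (\<exists>s. s \<ge> 1 \<and> H = substitute1 (path_graph 4) 2 (edgeless_graph s))"
    (is "?K \<or> ?E \<or> ?M")
    using assms(2)
  proof
    assume "H \<in> Omega2 n"
    then consider "H = substitute2 (path_graph 4) 1 (complete_graph (n - 3)) 2 (complete_graph 1)"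
      | "H = substitute2 (path_graph 4) 1 (edgeless_graph (n - 3)) 3 (edgeless_graph 1)"
      | "H = substitute2 (path_graph 4) 1 (complete_graph 1) 2 (complete_graph (n - 3))"
      | "H = substitute1 (path_graph 4) 2 (edgeless_graph (n - 3))"
      unfolding Omega2_def K by blast
    then show ?thesis
    proof cases
      case 1
      then have ?K using n by (intro exI conjI) auto
      then show ?thesis ..
    next
      case 2
      then have ?E using n by (intro exI conjI) auto
      then show ?thesis by (intro disjI2 disjI1)
    next
      case 3
      then have ?K using n by (intro exI conjI) auto
      then show ?thesis ..
    next
      case 4
      then have ?M using n by (intro exI conjI) auto
      then show ?thesis by (intro disjI2)
    qed
  next
    assume "H \<in> Omega3 n"
    then consider r where "1 \<le> r" "r \<le> n - 3"
        "H = substitute2 (path_graph 4) 1 (complete_graph r) 2 (complete_graph (n - r - 2))"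
      | r where "1 \<le> r" "r \<le> n - 3"
        "H = substitute2 (path_graph 4) 1 (edgeless_graph r) 3 (edgeless_graph (n - r - 2))"
      unfolding Omega3_def by blast
    then show ?thesis
    proof cases
      case 1
      then have ?K using nr by blast
      then show ?thesis ..
    next
      case 2
      then have ?E using nr by blast
      then show ?thesis by (intro disjI2 disjI1)
    qed
  qed
  then consider (clique) r s where "r \<ge> 1" "s \<ge> 1"
      "H = substitute2 (path_graph 4) 1 (complete_graph r) 2 (complete_graph s)"
    | (edgeless) r s where "r \<ge> 1" "s \<ge> 1"
      "H = substitute2 (path_graph 4) 1 (edgeless_graph r) 3 (edgeless_graph s)"
    | (middle) s where "s \<ge> 1" "H = substitute1 (path_graph 4) 2 (edgeless_graph s)"
    by blast
  then have "pair_graph H \<and>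
    (clique_type (pverts H) (adj H) \<or> clique_type (pverts H) (co (pverts H) (adj H)))"
  proof cases
    case clique
    then show ?thesis
      using clique_type_substitute2[OF clique(1,2)] pair_graph_substitute2 pair_graph_complete_graph
      by blast
  next
    case edgeless
    then show ?thesis
      using co_clique_type_substitute2[OF edgeless(1,2)] pair_graph_substitute2
        pair_graph_edgeless_graph
      by blast
  next
    case middle
    then show ?thesis
      using co_clique_type_substitute1[OF middle(1)] pair_graph_substitute1
        pair_graph_edgeless_graph
      by blast
  qed
  then show "pair_graph H" "clique_type (pverts H) (adj H) \<or> clique_type (pverts H) (co (pverts H)
    (adj H))"
    by blast+
qed

text \<open>In \<open>Omega3\<close> the two clique sizes run through all positive pairs with sum
  \<open>n - 2\<close>, so the sizes of \<open>A\<close> and \<open>B\<close> always occur.\<close>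

lemma clique_type_Omega3:
  assumes "finite (pverts G)" "\<And>u v. adj G u v \<Longrightarrow> adj G v u" "\<And>u. \<not> adj G u u"
    and "clique_type (pverts G) (adj G)"
  obtains H f where "H \<in> Omega3 (card (pverts G))" "graph_map G H f"
proof -
  obtain A B c d where V: "pverts G = A \<union> B \<union> {c, d}" and disj: "A \<inter> B = {}" "c \<notin> A \<union> B"
    "d \<notin> A \<union> B" "c \<noteq> d"
    and ne: "A \<noteq> {}" "B \<noteq> {}"
    and adj: "\<forall>u\<in>A \<union> B. \<forall>v\<in>A \<union> B. u \<noteq> v \<longrightarrow> adj G u v"
      "\<forall>u\<in>A. \<not> adj G u c \<and> \<not> adj G u d" "\<forall>u\<in>B. adj G u c \<and> \<not> adj G u d"
    and cd: "adj G c d"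
    using assms(4) unfolding clique_type_def by (elim exE conjE)
  note clique = adj(1)[rule_format] and A = adj(2)[rule_format] and B = adj(3)[rule_format]
  have fin: "finite A" "finite B" using assms(1) V by auto
  have card: "card (pverts G) = card A + card B + 2" "card A \<ge> 1" "card B \<ge> 1"
    using disj fin ne by (auto simp: V card_Un_disjoint card_gt_0_iff Suc_le_eq)
  define p :: "'a \<Rightarrow> nat" where "p u = (if u \<in> A then 1 else if u \<in> B then 2 else
    if u = c then 3 else 4)" for u
  have cls: "{u \<in> pverts G. p u = 1} = A" "{u \<in> pverts G. p u = 2} = B"
    "{u \<in> pverts G. p u = 3} = {c}" "{u \<in> pverts G. p u = 4} = {d}"
    using disj by (auto simp: V p_def)
  let ?F = "(\<lambda>_. complete_graph 1)(1 := complete_graph (card A), 2 := complete_graph (card B))"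
  have "\<exists>f. graph_map G (substitute (path_graph 4) ?F) f"
  proof (rule graph_map_substitute[where p = p and C = True, OF assms(1)])
    show "p u \<in> pverts (path_graph 4)" for u by (simp add: p_def pverts_path4)
    show "pverts (?F i) = {0..<card {u \<in> pverts G. p u = i}}" if "i \<in> pverts (path_graph 4)" for i
      using that cls by (auto simp: pverts_path4 complete_graph_def)
    show "adj (?F i) x y \<longleftrightarrow> True \<and> x \<noteq> y" if "x \<in> pverts (?F i)" "y \<in> pverts (?F i)" for i x y
      using that by (auto simp: complete_graph_def split: if_splits)
    show "adj G u v \<longleftrightarrow> adj (path_graph 4) (p u) (p v) \<or> p u = p v \<and> True \<and> u \<noteq> v"
      if u: "u \<in> pverts G" and v: "v \<in> pverts G" for u v
    proof -
      have 1: "p w = 1" if "w \<in> A" for w using that by (simp add: p_def)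
      have 2: "p w = 2" if "w \<in> B" for w using that disj by (auto simp: p_def)
      have 3: "p c = 3" "p d = 4" using disj by (auto simp: p_def)
      have adj: "adj G w c \<longleftrightarrow> False" "adj G c w \<longleftrightarrow> False" "adj G w d \<longleftrightarrow> False" "adj G d w \<longleftrightarrow> False"
        if "w \<in> A" for w using A[OF that] assms(2) by blast+
      have adjB: "adj G w c" "adj G c w" "adj G w d \<longleftrightarrow> False" "adj G d w \<longleftrightarrow> False"
        if "w \<in> B" for w using B[OF that] assms(2) by blast+
      have "adj G d c" using assms(2) cd by blast
      have cl: "adj G u v \<longleftrightarrow> u \<noteq> v" if "u \<in> A \<or> u \<in> B" "v \<in> A \<or> v \<in> B"
        using clique[of u v] that assms(3) by auto
      have AB: "u \<noteq> v" if "u \<in> A \<and> v \<in> B \<or> u \<in> B \<and> v \<in> A" using that disj by blast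
      have u4: "u \<in> A \<or> u \<in> B \<or> u = c \<or> u = d" and v4: "v \<in> A \<or> v \<in> B \<or> v = c \<or> v = d"
        using u v V by blast+
      from u4 v4 show ?thesis
        by (elim disjE) (simp_all add: 1 2 3 adj adjB cl AB cd \<open>adj G d c\<close> assms(3) disj(4)
          adj_path4)
    qed
  qed
  moreover have "substitute (path_graph 4) ?F \<in> Omega3 (card (pverts G))"
  proof -
    have "card B = card (pverts G) - card A - 2" "card A \<le> card (pverts G) - 3" using card
      by linarith+
    then show ?thesis using card(2) unfolding Omega3_def substitute2_def by auto
  qed
  ultimately show ?thesis using that by blast
qed

lemma co_clique_type_Omega3:
  assumes "finite (pverts G)" "\<And>u v. adj G u v \<Longrightarrow> adj G v u" "\<And>u. \<not> adj G u u"
    and "clique_type (pverts G) (co (pverts G) (adj G))"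
  obtains H f where "H \<in> Omega3 (card (pverts G))" "graph_map G H f"
proof -
  let ?F = "co (pverts G) (adj G)"
  obtain A B c d where V: "pverts G = A \<union> B \<union> {c, d}" and disj: "A \<inter> B = {}" "c \<notin> A \<union> B"
    "d \<notin> A \<union> B" "c \<noteq> d"
    and ne: "A \<noteq> {}" "B \<noteq> {}"
    and adj: "\<forall>u\<in>A \<union> B. \<forall>v\<in>A \<union> B. u \<noteq> v \<longrightarrow> ?F u v"
      "\<forall>u\<in>A. \<not> ?F u c \<and> \<not> ?F u d" "\<forall>u\<in>B. ?F u c \<and> \<not> ?F u d"
    and cd: "?F c d"
    using assms(4) unfolding clique_type_def by (elim exE conjE)
  note clique = adj(1)[rule_format] and A = adj(2)[rule_format] and B = adj(3)[rule_format]
  have fin: "finite A" "finite B" using assms(1) V by auto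
  have card: "card (pverts G) = card A + card B + 2" "card A \<ge> 1" "card B \<ge> 1"
    using disj fin ne by (auto simp: V card_Un_disjoint card_gt_0_iff Suc_le_eq)
  \<comment> \<open>The classes are placed along \<open>3 1 4 2\<close>, the complement of the path,
    so that \<open>B\<close> gets position 1 and \<open>A\<close> position 3.\<close>
  define p :: "'a \<Rightarrow> nat" where "p u = (if u \<in> B then 1 else if u \<in> A then 3 else
    if u = d then 2 else 4)" for u
  have cls: "{u \<in> pverts G. p u = 1} = B" "{u \<in> pverts G. p u = 3} = A"
    "{u \<in> pverts G. p u = 2} = {d}" "{u \<in> pverts G. p u = 4} = {c}"
    using disj by (auto simp: V p_def)
  let ?S = "(\<lambda>_. complete_graph 1)(1 := edgeless_graph (card B), 3 := edgeless_graph (card A))"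
  have "\<exists>f. graph_map G (substitute (path_graph 4) ?S) f"
  proof (rule graph_map_substitute[where p = p and C = False, OF assms(1)])
    show "p u \<in> pverts (path_graph 4)" for u by (simp add: p_def pverts_path4)
    show "pverts (?S i) = {0..<card {u \<in> pverts G. p u = i}}" if "i \<in> pverts (path_graph 4)" for i
      using that cls by (auto simp: pverts_path4 complete_graph_def edgeless_graph_def)
    show "adj (?S i) x y \<longleftrightarrow> False \<and> x \<noteq> y" if "x \<in> pverts (?S i)" "y \<in> pverts (?S i)" for i x y
      using that by (auto simp: complete_graph_def edgeless_graph_def split: if_splits)
    show "adj G u v \<longleftrightarrow> adj (path_graph 4) (p u) (p v) \<or> p u = p v \<and> False \<and> u \<noteq> v"
      if u: "u \<in> pverts G" and v: "v \<in> pverts G" for u v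
    proof -
      have 1: "p w = 1" if "w \<in> B" for w using that by (simp add: p_def)
      have 2: "p w = 3" if "w \<in> A" for w using that disj by (auto simp: p_def)
      have 3: "p c = 4" "p d = 2" using disj by (auto simp: p_def)
      have adj: "adj G w c" "adj G c w" "adj G w d" "adj G d w" if "w \<in> A" for w
        using A[OF that] that V disj assms(2)[of w c] assms(2)[of w d] by (auto simp: co_def)
      have adjB: "adj G w c \<longleftrightarrow> False" "adj G c w \<longleftrightarrow> False" "adj G w d" "adj G d w" if "w \<in> B" for w
        using B[OF that] that V disj assms(2)[of c w] assms(2)[of w d] by (auto simp: co_def)
      have ncd: "\<not> adj G c d" "\<not> adj G d c" using cd assms(2)[of d c] by (auto simp: co_def)
      have cl: "\<not> adj G u v" if "u \<in> A \<or> u \<in> B" "v \<in> A \<or> v \<in> B"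
        using clique[of u v] that assms(3) by (cases "u = v") (auto simp: co_def)
      have u4: "u \<in> A \<or> u \<in> B \<or> u = c \<or> u = d" and v4: "v \<in> A \<or> v \<in> B \<or> v = c \<or> v = d"
        using u v V by blast+
      from u4 v4 show ?thesis
        by (elim disjE) (simp_all add: 1 2 3 adj adjB cl ncd assms(3) adj_path4)
    qed
  qed
  moreover have "substitute (path_graph 4) ?S \<in> Omega3 (card (pverts G))"
  proof -
    have "card A = card (pverts G) - card B - 2" "card B \<le> card (pverts G) - 3" using card
      by linarith+
    then show ?thesis using card(3) unfolding Omega3_def substitute2_def by auto
  qed
  ultimately show ?thesis using that by blast
qed

section \<open>Path, bull and pentagon as concrete graphs\<close>

lemma graph_map_path4:
  assumes "pverts G = {a, b, c, d}" "path4 (adj G) a b c d"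
    and "\<And>u v. adj G u v \<Longrightarrow> adj G v u" "\<And>u. \<not> adj G u u"
  shows "\<exists>f. graph_map G (path_graph 4) f"
proof -
  let ?f = "\<lambda>u. if u = a then 1 else if u = b then 2 else if u = c then 3 else 4"
  have dist: "distinct [a, b, c, d]" and E: "adj G a b" "adj G b c" "adj G c d"
    and N: "\<not> adj G a c" "\<not> adj G a d" "\<not> adj G b d"
    using assms(2) by (auto simp: path4_def)
  have N': "\<not> adj G c a" "\<not> adj G d a" "\<not> adj G d b" using N assms(3) by blast+
  have "graph_map G (path_graph 4) ?f"
    unfolding graph_map_def bij_betw_def inj_on_def
    using dist E N N' E[THEN assms(3)] assms(4) by (simp add: assms(1) pverts_path4 adj_path4) auto
  then show ?thesis by blast
qed

lemma pverts_bull: "pverts bull_graph = {0, 1, 2, 3, 4}"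
  by (simp add: bull_graph_def)

lemma adj_bull: "adj bull_graph i j \<longleftrightarrow>
  (i, j) \<in> {(0, 1), (1, 2), (0, 2), (0, 3), (1, 4), (1, 0), (2, 1), (2, 0), (3, 0), (4, 1)}"
  by (auto simp: bull_graph_def symcl_def)

lemma graph_map_bull:
  assumes "bull_type (pverts G) (adj G)" "\<And>u v. adj G u v \<Longrightarrow> adj G v u" "\<And>u. \<not> adj G u u"
  shows "\<exists>f. graph_map G bull_graph f"
proof -
  obtain a b y x d where V: "pverts G = {a, b, y, x, d}" and dist: "distinct [a, b, y, x, d]"
    and E: "adj G a b" "adj G b y" "adj G b x" "adj G y x" "adj G x d"
    and N: "\<not> adj G a y" "\<not> adj G a x" "\<not> adj G a d" "\<not> adj G b d" "\<not> adj G y d"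
    using assms(1) unfolding bull_type_def by metis
  have N': "\<not> adj G y a" "\<not> adj G x a" "\<not> adj G d a" "\<not> adj G d b" "\<not> adj G d y"
    using N assms(2) by blast+
  let ?f = "\<lambda>u. if u = b then 0 else if u = x then 1 else if u = y then 2 else
    if u = a then 3 else 4"
  have "graph_map G bull_graph ?f"
    unfolding graph_map_def bij_betw_def inj_on_def
    using dist E N N' E[THEN assms(2)] assms(3) by (simp add: V pverts_bull adj_bull) auto
  then show ?thesis by blast
qed

lemma bull_type_bull_graph: "bull_type (pverts bull_graph) (adj bull_graph)"
  unfolding bull_type_def pverts_bull adj_bull
  by (intro exI[of _ 3] exI[of _ 0] exI[of _ 2] exI[of _ 1] exI[of _ 4]) auto

lemma pverts_cycle5: "pverts (cycle_graph 5) = {0, 1, 2, 3, 4}"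
  by (auto simp: cycle_graph_def)

lemma adj_cycle5: "adj (cycle_graph 5) i j \<longleftrightarrow>
  (i, j) \<in> {(0, 1), (1, 2), (2, 3), (3, 4), (4, 0), (1, 0), (2, 1), (3, 2), (4, 3), (0, 4)}"
proof (cases "i < 5 \<and> j < 5")
  case True
  then have "i \<in> {0, 1, 2, 3, 4}" "j \<in> {0, 1, 2, 3, 4}" by auto
  then show ?thesis by (elim insertE emptyE) (simp_all add: cycle_graph_def)
qed (auto simp: cycle_graph_def)

lemma graph_map_cycle:
  assumes "cycle_type (pverts G) (adj G)" "\<And>u v. adj G u v \<Longrightarrow> adj G v u" "\<And>u. \<not> adj G u u"
  shows "\<exists>f. graph_map G (cycle_graph 5) f"
proof -
  obtain a b c d e where V: "pverts G = {a, b, c, d, e}" and dist: "distinct [a, b, c, d, e]"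
    and E: "adj G a b" "adj G b c" "adj G c d" "adj G d e" "adj G e a"
    and N: "\<not> adj G a c" "\<not> adj G a d" "\<not> adj G b d" "\<not> adj G b e" "\<not> adj G c e"
    using assms(1) unfolding cycle_type_def by metis
  have N': "\<not> adj G c a" "\<not> adj G d a" "\<not> adj G d b" "\<not> adj G e b" "\<not> adj G e c"
    using N assms(2) by blast+
  let ?f = "\<lambda>u. if u = a then 0 else if u = b then 1 else if u = c then 2 else
    if u = d then 3 else 4"
  have "graph_map G (cycle_graph 5) ?f"
    unfolding graph_map_def bij_betw_def inj_on_def
    using dist E N N' E[THEN assms(2)] assms(3) by (simp add: V pverts_cycle5 adj_cycle5) auto
  then show ?thesis by blast
qed

lemma cycle_type_cycle_graph: "cycle_type (pverts (cycle_graph 5)) (adj (cycle_graph 5))"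
  unfolding cycle_type_def pverts_cycle5 adj_cycle5
  by (intro exI[of _ 0] exI[of _ 1] exI[of _ 2] exI[of _ 3] exI[of _ 4]) auto

text \<open>With singletons for both cliques, the path on four vertices is itself of clique
  type.\<close>

lemma clique_type_path_graph: "clique_type (pverts (path_graph 4)) (adj (path_graph 4))"
  by (rule clique_typeI[of _ "{1}" "{2}" 3 4]) (auto simp: pverts_path4 adj_path4)

theorem theorem2:
  fixes G :: "'a pair_pre_digraph" and n :: nat
  assumes "pair_graph G" and "doubly_connected G"
    and "card (pverts G) = n" and "n \<ge> 4"
  shows "2 \<le> location_number G + location_number (complement G)
    \<and> location_number G + location_number (complement G) \<le> 2 * n - 6
    \<and> (location_number G + location_number (complement G) = 2
        \<longleftrightarrow> digraph_iso (with_proj G) (with_proj (path_graph 4)))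
    \<and> (location_number G + location_number (complement G) = 2 * n - 6
        \<longleftrightarrow> (\<exists>H \<in> Omega1. digraph_iso (with_proj G) (with_proj H))
          \<or> (\<exists>H \<in> Omega2 n \<union> Omega3 n. digraph_iso (with_proj G) (with_proj H)))"
proof -
  let ?V = "pverts G" and ?E = "adj G" and ?F = "co (pverts G) (adj G)"
  interpret G: pair_graph G by fact
  interpret co: pair_graph "complement G" using assms(1) by (rule pair_graph_complement)
  interpret D: doubly_connected_ugraph ?V ?E using assms(1,2) by (rule doubly_connected_ugraph)
  interpret D': doubly_connected_ugraph ?V ?F by (rule D.doubly_connected_ugraph_co)
  let ?b = "location_number G" and ?b' = "location_number (complement G)"
  have n2: "card ?V \<ge> 2" using assms(3,4) by simp
  have pos: "?b \<ge> 1" "?b' \<ge> 1"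
    using G.location_number_pos co.location_number_pos n2 by simp_all
  have up: "?b \<le> n - 3"
    using D.ex_free_triple[OF n2] G.location_number_le assms(3) by metis
  have up': "?b' \<le> n - 3"
    using D'.ex_free_triple[OF n2] co.location_number_le assms(3) pverts_complement adj_complement
      by metis
  \<comment> \<open>Each summand is at most \<open>n - 3\<close>, so the maximal sum is attained
    only if both are maximal.\<close>
  have "?b + ?b' = 2 * n - 6 \<longleftrightarrow> ?b \<ge> n - 3 \<and> ?b' \<ge> n - 3" using up up' assms(4) by linarith
  also have "\<dots> \<longleftrightarrow> tight ?V ?E \<and> tight ?V ?F"
    using G.tight_iff_location_number co.tight_iff_location_number assms(3,4)
      by (simp add: adj_complement)
  finally have extremal: "?b + ?b' = 2 * n - 6 \<longleftrightarrow>
      clique_type ?V ?E \<or> clique_type ?V ?F \<or> cycle_type ?V ?E \<or> bull_type ?V ?E"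
    using D.tight_iff[OF n2] by simp
  note iso = digraph_iso_iff[OF assms(1)]
  have sym: "adj G v u" if "adj G u v" for u v using that by (rule D.adj_sym)
  have irrefl: "\<not> adj G u u" for u by (rule D.adj_irrefl)
  have fin: "finite ?V" by (rule G.pair_finite_verts)
  have P4: "?b + ?b' = 2 \<longleftrightarrow> digraph_iso (with_proj G) (with_proj (path_graph 4))"
  proof
    assume "?b + ?b' = 2"
    then have "?b = 1" "?b' = 1" using pos by linarith+
    then obtain x y where "x \<in> ?V" "free_set ?V ?E (?V - {x})" "y \<in> ?V" "free_set ?V ?F (?V - {y})"
      using G.location_number_1E co.location_number_1E n2 pverts_complement adj_complement by metis
    \<comment> \<open>With four vertices the induced path exhausts the graph.\<close>
    then have "card ?V = 4" using D.locating_singletons_order assms(3,4) by fastforce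
    obtain a b c d where p: "path4 ?E a b c d" using D.ex_path4[OF n2] .
    then have "card {a, b, c, d} = card ?V" using \<open>card ?V = 4\<close> by (simp add: path4_def)
    then have "?V = {a, b, c, d}" using D.path4_in[OF p] fin by (metis card_subset_eq)
    then show "digraph_iso (with_proj G) (with_proj (path_graph 4))"
      unfolding iso[OF pair_graph_path_graph] using p sym irrefl by (rule graph_map_path4)
  next
    assume "digraph_iso (with_proj G) (with_proj (path_graph 4))"
    then obtain f where "graph_map G (path_graph 4) f" unfolding iso[OF pair_graph_path_graph]
      by blast
    then have "card ?V = card (pverts (path_graph 4))"
      unfolding graph_map_def using bij_betw_same_card by blast
    then have "n = 4" using assms(3) by (simp add: pverts_path4)
    \<comment> \<open>For \<open>n = 4\<close> the lower bound 1 and the upper bound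
      \<open>n - 3\<close> coincide.\<close>
    then show "?b + ?b' = 2" using pos up up' by simp
  qed
  have "?b + ?b' = 2 * n - 6 \<longleftrightarrow> (\<exists>H \<in> Omega1. digraph_iso (with_proj G) (with_proj H))
          \<or> (\<exists>H \<in> Omega2 n \<union> Omega3 n. digraph_iso (with_proj G) (with_proj H))"
    unfolding extremal
  proof
    assume "clique_type ?V ?E \<or> clique_type ?V ?F \<or> cycle_type ?V ?E \<or> bull_type ?V ?E"
    then show "(\<exists>H \<in> Omega1. digraph_iso (with_proj G) (with_proj H))
          \<or> (\<exists>H \<in> Omega2 n \<union> Omega3 n. digraph_iso (with_proj G) (with_proj H))"
    proof (elim disjE)
      assume "clique_type ?V ?E"
      then obtain H f where H: "H \<in> Omega3 n" "graph_map G H f"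
        using clique_type_Omega3[OF fin sym irrefl] assms(3) by metis
      then have "digraph_iso (with_proj G) (with_proj H)"
        using iso[OF Omega23_type(1)[OF assms(4)]] by blast
      then show ?thesis using H(1) by blast
    next
      assume "clique_type ?V ?F"
      then obtain H f where H: "H \<in> Omega3 n" "graph_map G H f"
        using co_clique_type_Omega3[OF fin sym irrefl] assms(3) by metis
      then have "digraph_iso (with_proj G) (with_proj H)"
        using iso[OF Omega23_type(1)[OF assms(4)]] by blast
      then show ?thesis using H(1) by blast
    next
      assume "cycle_type ?V ?E"
      then have "digraph_iso (with_proj G) (with_proj (cycle_graph 5))"
        using graph_map_cycle[OF _ sym irrefl] iso[OF pair_graph_cycle_graph] by simp
      then show ?thesis by (simp add: Omega1_def)
    next
      assume "bull_type ?V ?E"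
      then have "digraph_iso (with_proj G) (with_proj bull_graph)"
        using graph_map_bull[OF _ sym irrefl] iso[OF pair_graph_bull_graph] by simp
      then show ?thesis by (simp add: Omega1_def)
    qed
  next
    assume "(\<exists>H \<in> Omega1. digraph_iso (with_proj G) (with_proj H))
          \<or> (\<exists>H \<in> Omega2 n \<union> Omega3 n. digraph_iso (with_proj G) (with_proj H))"
    then show "clique_type ?V ?E \<or> clique_type ?V ?F \<or> cycle_type ?V ?E \<or> bull_type ?V ?E"
    proof
      assume "\<exists>H \<in> Omega1. digraph_iso (with_proj G) (with_proj H)"
      then consider "digraph_iso (with_proj G) (with_proj (path_graph 4))"
        | "digraph_iso (with_proj G) (with_proj (cycle_graph 5))"
        | "digraph_iso (with_proj G) (with_proj bull_graph)"
        by (auto simp: Omega1_def)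
      then show ?thesis
      proof cases
        case 1
        then show ?thesis
          using iso[OF pair_graph_path_graph] clique_type_iso clique_type_path_graph by blast
      next
        case 2
        then show ?thesis
          using iso[OF pair_graph_cycle_graph] cycle_type_iso cycle_type_cycle_graph by fastforce
      next
        case 3
        then show ?thesis
          using iso[OF pair_graph_bull_graph] bull_type_iso bull_type_bull_graph by blast
      qed
    next
      assume "\<exists>H \<in> Omega2 n \<union> Omega3 n. digraph_iso (with_proj G) (with_proj H)"
      then obtain H where H: "H \<in> Omega2 n \<union> Omega3 n" "digraph_iso (with_proj G) (with_proj H)"
        by blast
      note type = Omega23_type[OF assms(4) H(1)]
      obtain f where f: "graph_map G H f" using H(2) iso[OF type(1)] by blast
      from type(2) show ?thesis
      proof
        assume "clique_type (pverts H) (adj H)"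
        then show ?thesis using clique_type_iso[OF f] by blast
      next
        assume "clique_type (pverts H) (co (pverts H) (adj H))"
        then have "clique_type ?V ?F"
          using clique_type_iso[OF graph_map_complement[OF f]] by (simp add: adj_complement)
        then show ?thesis by blast
      qed
    qed
  qed
  then show ?thesis using P4 pos up up' assms(4) by linarith
qed

end
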